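(* Let $d,r$ be positive integers with $r\mid d$ and let $n\ge3$. The number of fully commutative elements in the group $G(d,r,n)$ is equal to $$\sum_{k=0}^n C(n,k)\,|\mathcal P(n,k)| = \frac{d(d-1)}{r}\,\mathfrak F_{n,n-2}(d)+\Big(\frac{2d}{r}-1\Big)C_n-\Big(\frac dr-1\Big),$$ where $|\mathcal P(n,k)|$ is the number of collections in the packet $\mathcal P(n,k)$ of $G(d,r,n)$.
   Context: Numbers: $C(n,k)=\frac{(n+k)!\,(n-k+1)}{k!\,(n+1)!}$ for $0\le k\le n$; $C_n=\frac1{n+1}\binom{2n}{n}$; $\mathfrak F_{n,k}(x)=\sum_{s=0}^{k}C(n,s)x^{k-s}$. Group: $G(d,1,n)$ is the group generated by $s_1,\dots,s_n$ with defining relations $s_n^d=1$; $s_i^2=1$ $(1\le i\le n-1)$; $s_is_j=s_js_i$ $(j+1<i\le n)$; $s_{i+1}s_is_{i+1}=s_is_{i+1}s_i$ $(1\le i\le n-2)$; $s_ns_{n-1}s_ns_{n-1}=s_{n-1}s_ns_{n-1}s_n$. Canonical words: put $s_{ij}=s_is_{i-1}\cdots s_j$ if $i>j$, $s_{ii}=s_i$, $s_{ij}=$ the empty word if $i<j$; and $s^{(k)}_{nj}=s_n^k s_{n-1,j}$ for $k\ge1$, $1\le j\le n$. Every element of $G(d,1,n)$ has a unique canonical (reduced) word $s_{1i_1}s_{2i_2}\cdots s_{n-1,i_{n-1}}\,s^{(k_1)}_{nj_1}\cdots s^{(k_\ell)}_{nj_\ell}$ with $1\le i_p\le p+1$ for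 $1\le p\le n-1$, $\ell\ge0$, $1\le j_1<\cdots<j_\ell\le n$, $1\le k_p\le d-1$. The set of canonical words is $\mathcal W(d,1,n)$. The left factor $s_{1i_1}\cdots s_{n-1,i_{n-1}}$ is the prefix and the right factor $s^{(k_1)}_{nj_1}\cdots s^{(k_\ell)}_{nj_\ell}$ is the suffix. The subgroup $G(d,r,n)$: for $r\mid d$, the complex reflection group $G(d,r,n)$ is identified, via a fixed embedding, with the subgroup of $G(d,1,n)$ generated by $s_1,\dots,s_{n-1}$, $s_n^{d-1}s_{n-1}s_n$ and $s_n^r$; it consists of the elements whose canonical words satisfy $k_1+\cdots+k_\ell\equiv0\pmod r$. Full commutativity: for $w\in G(d,1,n)$, $R(w)$ is the set of words in $s_1,\dots,s_n$ of minimal length representing $w$; $w$ is fully commutative if any element of $R(w)$ can be obtained from any other using only the commutations $s_is_j=s_js_i$ $(j+1<i\le n)$ on adjacent letters. An element of $G(d,r,n)$ is fully commutative if it is fully commutative as an element of $G(d,1,n)$. A canonical word is fully commutative if the element it represents is. Collections: for a suffix $\boldsymbol w'$, the collection $\mathbf c^n_{\boldsymbol w'}$ is the set of fully commutative words in $\mathcal W(d,1,n)$ whose suffix is $\boldsymbol w'$. Packets of $G(d,1,n)$ (all exponents $t,t_i$ range over $1,\dots,d-1$): the $(n,0)$-packet is the set of collections labeled by suffixes $s^{(t_1)}_{n1}s^{(t_2)}_{nj_2}\cdots s^{(t_\ell)}_{nj_\ell}$ with $\ell\ge2$, $1<j_2<\cdots<j_\ell\le n$; for $1\le k\le n-2$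 the $(n,k)$-packet is the set of collections labeled by $s^{(t)}_{nk}$ or by $s^{(t_1)}_{n,k+1}s^{(t_2)}_{nj_2}\cdots s^{(t_\ell)}_{nj_\ell}$ with $\ell\ge2$, $k+1<j_2<\cdots<j_\ell\le n$; the $(n,n-1)$-packet is the set of collections labeled by $s_n^t$ or $s^{(t)}_{n,n-1}=s_n^ts_{n-1}$; the $(n,n)$-packet contains only the collection labeled by the empty suffix. The packet $\mathcal P(n,k)$ of $G(d,r,n)$ is the set of those collections in the $(n,k)$-packet of $G(d,1,n)$ that are contained in $G(d,r,n)$. *)

theory Defs
  imports Complex_Main "HOL-Algebra.Generated_Groups"
begin

section \<open>Catalan triangle numbers\<close>

definition catalan_triangle :: "nat \<Rightarrow> nat \<Rightarrow> real" where
  "catalan_triangle n k = (fact (n + k) * (real n - real k + 1)) / (fact k * fact (n + 1))"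

definition catalan :: "nat \<Rightarrow> real" where
  "catalan n = 1 / (real n + 1) * real ((2 * n) choose n)"

definition catalan_poly :: "nat \<Rightarrow> nat \<Rightarrow> real \<Rightarrow> real" where
  "catalan_poly n k x = (\<Sum>s=0..k. catalan_triangle n s * x ^ (k - s))"

section \<open>Groups given by generators and relations\<close>

text \<open>
  A letter \<open>(x, True)\<close> stands for the generator \<open>x\<close> and \<open>(x, False)\<close> for its formal inverse.
\<close>

type_synonym 'a signed_word = "('a \<times> bool) list"

definition pos_word :: "'a list \<Rightarrow> 'a signed_word" where
  "pos_word w = map (\<lambda>x. (x, True)) w"

inductive pres_cong ::
    "'a set \<Rightarrow> ('a signed_word \<times> 'a signed_word) set \<Rightarrow> 'a signed_word \<Rightarrow> 'a signed_word \<Rightarrow> bool"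
  for X R where
  refl: "set u \<subseteq> X \<times> UNIV \<Longrightarrow> pres_cong X R u u"
| sym: "pres_cong X R u v \<Longrightarrow> pres_cong X R v u"
| trans: "pres_cong X R u v \<Longrightarrow> pres_cong X R v w \<Longrightarrow> pres_cong X R u w"
| append: "pres_cong X R u u' \<Longrightarrow> pres_cong X R v v' \<Longrightarrow> pres_cong X R (u @ v) (u' @ v')"
| cancel: "x \<in> X \<Longrightarrow> pres_cong X R [(x, b), (x, \<not> b)] []"
| rel: "(u, v) \<in> R \<Longrightarrow> pres_cong X R u v"

definition pres_class ::
    "'a set \<Rightarrow> ('a signed_word \<times> 'a signed_word) set \<Rightarrow> 'a signed_word \<Rightarrow> 'a signed_word set" where
  "pres_class X R u = {v. pres_cong X R u v}"

definition presented_group ::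
    "'a set \<Rightarrow> ('a signed_word \<times> 'a signed_word) set \<Rightarrow> 'a signed_word set monoid" where
  "presented_group X R =
    \<lparr>carrier = pres_class X R ` {u. set u \<subseteq> X \<times> UNIV},
     mult = (\<lambda>A B. \<Union>u\<in>A. \<Union>v\<in>B. pres_class X R (u @ v)),
     one = pres_class X R []\<rparr>"

section \<open>The groups \<open>G(d,1,n)\<close> and \<open>G(d,r,n)\<close>\<close>

text \<open>The generator \<open>s\<^sub>i\<close> is represented by the number \<open>i\<close>, for \<open>1 \<le> i \<le> n\<close>; throughout, \<open>n \<ge> 2\<close>.\<close>

definition refl_relations :: "nat \<Rightarrow> nat \<Rightarrow> (nat list \<times> nat list) set" where
  "refl_relations d n =
     {(replicate d n, [])}
   \<union> {([i, i], []) | i. 1 \<le> i \<and> i < n}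
   \<union> {([i, j], [j, i]) | i j. 1 \<le> j \<and> j + 1 < i \<and> i \<le> n}
   \<union> {([i + 1, i, i + 1], [i, i + 1, i]) | i. 1 \<le> i \<and> i + 2 \<le> n}
   \<union> {([n, n - 1, n, n - 1], [n - 1, n, n - 1, n])}"

definition signed_relations :: "nat \<Rightarrow> nat \<Rightarrow> (nat signed_word \<times> nat signed_word) set" where
  "signed_relations d n = map_prod pos_word pos_word ` refl_relations d n"

definition Gd1 :: "nat \<Rightarrow> nat \<Rightarrow> nat signed_word set monoid" where
  "Gd1 d n = presented_group {1..n} (signed_relations d n)"

definition word_elt :: "nat \<Rightarrow> nat \<Rightarrow> nat list \<Rightarrow> nat signed_word set" where
  "word_elt d n w = pres_class {1..n} (signed_relations d n) (pos_word w)"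

definition Gdr :: "nat \<Rightarrow> nat \<Rightarrow> nat \<Rightarrow> nat signed_word set set" where
  "Gdr d r n = generate (Gd1 d n)
     (word_elt d n ` ({[i] | i. 1 \<le> i \<and> i < n}
                      \<union> {replicate (d - 1) n @ [n - 1, n], replicate r n}))"

section \<open>Full commutativity\<close>

definition reduced_words :: "nat \<Rightarrow> nat \<Rightarrow> nat signed_word set \<Rightarrow> nat list set" where
  "reduced_words d n g =
     {w \<in> lists {1..n}. word_elt d n w = g \<and>
        (\<forall>v \<in> lists {1..n}. word_elt d n v = g \<longrightarrow> length w \<le> length v)}"

definition comm_step :: "nat \<Rightarrow> nat list \<Rightarrow> nat list \<Rightarrow> bool" where
  "comm_step n u v \<longleftrightarrow>
     (\<exists>x y i j. i \<in> {1..n} \<and> j \<in> {1..n} \<and> (j + 1 < i \<or> i + 1 < j) \<and>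
        u = x @ [i, j] @ y \<and> v = x @ [j, i] @ y)"

definition fully_commutative :: "nat \<Rightarrow> nat \<Rightarrow> nat signed_word set \<Rightarrow> bool" where
  "fully_commutative d n g \<longleftrightarrow>
     (\<forall>u \<in> reduced_words d n g. \<forall>v \<in> reduced_words d n g. (comm_step n)\<^sup>*\<^sup>* u v)"

section \<open>Canonical words\<close>

text \<open>\<open>desc_word i j\<close> is \<open>s\<^sub>i s\<^sub>i\<^sub>-\<^sub>1 \<dots> s\<^sub>j\<close>, and it is the empty word if \<open>i < j\<close>.\<close>

definition desc_word :: "nat \<Rightarrow> nat \<Rightarrow> nat list" where
  "desc_word i j = rev [j..<Suc i]"

definition prefix_words :: "nat \<Rightarrow> nat list set" where
  "prefix_words n =
     {concat (map (\<lambda>p. desc_word p (i p)) [1..<n]) | i.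
        \<forall>p. 1 \<le> p \<and> p < n \<longrightarrow> 1 \<le> i p \<and> i p \<le> p + 1}"

definition suffix_block :: "nat \<Rightarrow> nat \<Rightarrow> nat \<Rightarrow> nat list" where
  "suffix_block n k j = replicate k n @ desc_word (n - 1) j"

text \<open>A suffix is encoded by its list of pairs \<open>(k\<^sub>1, j\<^sub>1), \<dots>, (k\<^sub>\<ell>, j\<^sub>\<ell>)\<close>.\<close>

definition suffix_data :: "nat \<Rightarrow> nat \<Rightarrow> (nat \<times> nat) list \<Rightarrow> bool" where
  "suffix_data d n ps \<longleftrightarrow>
     sorted_wrt (<) (map snd ps) \<and> (\<forall>(k, j) \<in> set ps. 1 \<le> k \<and> k < d \<and> 1 \<le> j \<and> j \<le> n)"

definition suffix_word :: "nat \<Rightarrow> (nat \<times> nat) list \<Rightarrow> nat list" where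
  "suffix_word n ps = concat (map (\<lambda>(k, j). suffix_block n k j) ps)"

definition canonical_words :: "nat \<Rightarrow> nat \<Rightarrow> nat list set" where
  "canonical_words d n =
     {p @ suffix_word n ps | p ps. p \<in> prefix_words n \<and> suffix_data d n ps}"

section \<open>Collections and packets\<close>

definition collection :: "nat \<Rightarrow> nat \<Rightarrow> nat list \<Rightarrow> nat list set" where
  "collection d n w' =
     {w \<in> canonical_words d n. fully_commutative d n (word_elt d n w) \<and>
        (\<exists>p \<in> prefix_words n. w = p @ w')}"

text \<open>The suffixes with at least two blocks, the first of which ends at index \<open>m\<close>.\<close>

definition long_suffixes :: "nat \<Rightarrow> nat \<Rightarrow> nat \<Rightarrow> nat list set" where
  "long_suffixes d n m =
     {suffix_word n ((t, m) # ps) | t ps. ps \<noteq> [] \<and> suffix_data d n ((t, m) # ps)}"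

text \<open>The cases below are mutually exclusive as listed when \<open>n \<ge> 2\<close>.\<close>

definition packet_labels :: "nat \<Rightarrow> nat \<Rightarrow> nat \<Rightarrow> nat list set" where
  "packet_labels d n k =
     (if k = 0 then long_suffixes d n 1
      else if k + 2 \<le> n then {suffix_block n t k | t. 1 \<le> t \<and> t < d} \<union> long_suffixes d n (k + 1)
      else if k + 1 = n then {suffix_block n t j | t j. 1 \<le> t \<and> t < d \<and> j \<in> {n - 1, n}}
      else if k = n then {[]}
      else {})"

definition packet :: "nat \<Rightarrow> nat \<Rightarrow> nat \<Rightarrow> nat \<Rightarrow> nat list set set" where
  "packet d r n k =
     {c \<in> collection d n ` packet_labels d n k. \<forall>w \<in> c. word_elt d n w \<in> Gdr d r n}"

end

theory Submission
  imports Defs "HOL-Combinatorics.Transposition"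
begin

text \<open>
  The count has two independent halves: a criterion that tells, for each suffix, which prefixes
  make a fully commutative canonical word, and an enumeration of suffixes by exponent sum.

  \<^bold>\<open>Reduction to canonical words.\<close>  Appending a letter to a canonical word and sorting it back into
  canonical form needs only the commutations, the braid move \<open>s\<^sub>i s\<^sub>i\<^sub>+\<^sub>1 s\<^sub>i \<leftrightarrow> s\<^sub>i\<^sub>+\<^sub>1 s\<^sub>i s\<^sub>i\<^sub>+\<^sub>1\<close>, the move
  \<open>s\<^sub>n\<^sup>a s\<^sub>n\<^sub>-\<^sub>1 s\<^sub>n\<^sup>b s\<^sub>n\<^sub>-\<^sub>1 \<leftrightarrow> s\<^sub>n\<^sub>-\<^sub>1 s\<^sub>n\<^sup>b s\<^sub>n\<^sub>-\<^sub>1 s\<^sub>n\<^sup>a\<close> for arbitrary \<open>a, b \<ge> 1\<close>, all of which keep the length, and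
  at worst a cancellation, which shortens the word (\<open>reduces_to_canonical\<close>).  Distinct canonical
  words act differently on coloured arrangements, hence represent distinct elements
  (\<open>canonical_unique\<close>).  Together these facts say that canonical words are reduced and that all
  reduced words of an element are linked by the three kinds of moves.  Each non-commutation move
  leaves the commutation class, because it alters the subword on two neighbouring letters, so an
  element is fully commutative exactly when its canonical word is \<^emph>\<open>rigid\<close>: no word in its
  commutation class admits such a move (\<open>fully_commutative_iff_rigid\<close>).

  \<^bold>\<open>Rigid canonical words.\<close>  A canonical prefix is a product of descending runs.  It is rigid iff the
  last letters of the nonempty runs increase strictly.  A suffix with at least two blocks, the first
  ending in \<open>s\<^sub>j\<close>, allows exactly those prefixes whose runs all end below \<open>j\<close>.  A single block
  ending in \<open>s\<^sub>j\<close> also allows a final stretch of one-letter runs \<open>s\<^sub>x s\<^sub>x\<^sub>+\<^sub>1 \<dots> s\<^sub>n\<^sub>-\<^sub>1\<close> with \<open>x \<ge> j\<close>.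
  Outside these sets a run end slides up to the following block and creates a braid; inside them,
  two-letter subwords, which are invariants of the commutation class, exclude every braid
  (\<open>rigid_imp_good_prefix\<close>, \<open>good_prefix_imp_rigid\<close>).  Removing the last run shows that both families
  satisfy the recursion of the Catalan triangle, so each collection in the packet \<open>k\<close> has
  \<open>C(n,k)\<close> members (\<open>card_good_prefixes\<close>).

  \<^bold>\<open>Suffixes.\<close>  An element lies in \<open>G(d,r,n)\<close> iff the number of letters \<open>s\<^sub>n\<close> in a word for it is
  divisible by \<open>r\<close> (\<open>word_elt_mem_Gdr\<close>); for a canonical word this is the sum of the exponents of
  its suffix.  Since \<open>r\<close> divides \<open>d\<close>, the exponent at position \<open>n\<close> is equidistributed modulo \<open>r\<close>, which gives
  closed formulas for the sizes of the packets (\<open>card_packet_values\<close>).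
\<close>

section \<open>Groups given by a presentation\<close>

lemma pos_word_append [simp]: "pos_word (u @ v) = pos_word u @ pos_word v"
  by (simp add: pos_word_def)

lemma pos_word_Nil [simp]: "pos_word [] = []"
  by (simp add: pos_word_def)

lemma set_pos_word: "set (pos_word w) \<subseteq> X \<times> UNIV \<longleftrightarrow> set w \<subseteq> X"
  by (auto simp: pos_word_def)

text \<open>
  Relators may only use the given generators; otherwise congruent words could leave the free
  monoid on which the group lives.
\<close>

definition relators_over :: "'a set \<Rightarrow> ('a signed_word \<times> 'a signed_word) set \<Rightarrow> bool" where
  "relators_over X R \<longleftrightarrow> (\<forall>(u, v) \<in> R. set u \<subseteq> X \<times> UNIV \<and> set v \<subseteq> X \<times> UNIV)"

lemma pres_class_eq_iff:
  assumes "set u \<subseteq> X \<times> UNIV"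
  shows "pres_class X R u = pres_class X R v \<longleftrightarrow> pres_cong X R u v"
proof
  assume "pres_class X R u = pres_class X R v"
  moreover have "u \<in> pres_class X R u"
    using assms by (simp add: pres_class_def pres_cong.refl)
  ultimately show "pres_cong X R u v"
    by (auto simp: pres_class_def intro: pres_cong.sym)
next
  assume "pres_cong X R u v"
  then show "pres_class X R u = pres_class X R v"
    by (auto simp: pres_class_def intro: pres_cong.sym pres_cong.trans)
qed

definition inv_word :: "'a signed_word \<Rightarrow> 'a signed_word" where
  "inv_word u = rev (map (\<lambda>(x, b). (x, \<not> b)) u)"

lemma set_inv_word: "set u \<subseteq> X \<times> UNIV \<Longrightarrow> set (inv_word u) \<subseteq> X \<times> UNIV"
  by (auto simp: inv_word_def)

lemma inv_word_inv_word [simp]: "inv_word (inv_word u) = u"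
  by (simp add: inv_word_def rev_map o_def case_prod_unfold)

lemma pres_cong_inv_right:
  assumes "set u \<subseteq> X \<times> UNIV"
  shows "pres_cong X R (u @ inv_word u) []"
  using assms
proof (induction u)
  case Nil
  then show ?case by (simp add: inv_word_def pres_cong.refl)
next
  case (Cons a u)
  obtain x b where a: "a = (x, b)" by force
  have x: "x \<in> X" using Cons.prems a by auto
  have "pres_cong X R (u @ inv_word u) []" using Cons by auto
  then have "pres_cong X R ([a] @ (u @ inv_word u) @ [(x, \<not> b)]) ([a] @ [] @ [(x, \<not> b)])"
    using x a by (intro pres_cong.append pres_cong.refl) auto
  moreover have "pres_cong X R ([a] @ [] @ [(x, \<not> b)]) []"
    using x a by (simp add: pres_cong.cancel)
  ultimately have "pres_cong X R ([a] @ (u @ inv_word u) @ [(x, \<not> b)]) []"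
    by (rule pres_cong.trans)
  then show ?case by (simp add: inv_word_def a)
qed

lemma pres_cong_inv_left:
  assumes "set u \<subseteq> X \<times> UNIV"
  shows "pres_cong X R (inv_word u @ u) []"
  using pres_cong_inv_right[OF set_inv_word[OF assms]] by simp

lemma pres_cong_cancel_right:
  assumes "pres_cong X R (u @ w) (v @ w)"
    and "set u \<subseteq> X \<times> UNIV" "set v \<subseteq> X \<times> UNIV" "set w \<subseteq> X \<times> UNIV"
  shows "pres_cong X R u v"
proof -
  have c: "pres_cong X R (y @ w @ inv_word w) y" if "set y \<subseteq> X \<times> UNIV" for y
    using pres_cong.append[OF pres_cong.refl[OF that] pres_cong_inv_right[OF assms(4)]] by simp
  have "pres_cong X R ((u @ w) @ inv_word w) ((v @ w) @ inv_word w)"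
    using assms(1) pres_cong.refl[OF set_inv_word[OF assms(4)]] by (rule pres_cong.append)
  then have "pres_cong X R (u @ w @ inv_word w) (v @ w @ inv_word w)" by simp
  from pres_cong.trans[OF pres_cong.sym[OF c[OF assms(2)]] pres_cong.trans[OF this c[OF assms(3)]]]
  show ?thesis .
qed

text \<open>
  The product of two classes is a union over all representatives; since congruence is compatible
  with concatenation, every pair of representatives contributes the same class.
\<close>

lemma presented_group_mult:
  assumes "relators_over X R" "set u \<subseteq> X \<times> UNIV" "set v \<subseteq> X \<times> UNIV"
  shows "pres_class X R u \<otimes>\<^bsub>presented_group X R\<^esub> pres_class X R v = pres_class X R (u @ v)"
proof -
  have "pres_class X R (u' @ v') = pres_class X R (u @ v)"
    if "pres_cong X R u u'" "pres_cong X R v v'" for u' v'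
  proof -
    have "pres_class X R (u @ v) = pres_class X R (u' @ v')"
      using pres_cong.append[OF that] assms(2,3) by (subst pres_class_eq_iff) auto
    then show ?thesis ..
  qed
  then have "pres_class X R (u' @ v') = pres_class X R (u @ v)"
    if "u' \<in> pres_class X R u" "v' \<in> pres_class X R v" for u' v'
    using that unfolding pres_class_def[of X R u] pres_class_def[of X R v] by blast
  moreover have "u \<in> pres_class X R u" "v \<in> pres_class X R v"
    using assms by (auto simp: pres_class_def pres_cong.refl)
  ultimately have "(\<Union>u'\<in>pres_class X R u. \<Union>v'\<in>pres_class X R v. pres_class X R (u' @ v'))
      = pres_class X R (u @ v)"
    by blast
  then show ?thesis by (simp add: presented_group_def)
qed

lemma presented_group_carrier:
  "g \<in> carrier (presented_group X R) \<longleftrightarrow> (\<exists>u. set u \<subseteq> X \<times> UNIV \<and> g = pres_class X R u)"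
  by (auto simp: presented_group_def)

lemma presented_group_one: "\<one>\<^bsub>presented_group X R\<^esub> = pres_class X R []"
  by (simp add: presented_group_def)

lemma group_presented_group:
  assumes "relators_over X R"
  shows "group (presented_group X R)"
proof (rule groupI)
  fix x assume "x \<in> carrier (presented_group X R)"
  then obtain u where u: "set u \<subseteq> X \<times> UNIV" "x = pres_class X R u"
    by (auto simp: presented_group_carrier)
  have "pres_class X R (inv_word u @ u) = pres_class X R []"
    using u pres_cong_inv_left[OF u(1)] set_inv_word[OF u(1)] by (subst pres_class_eq_iff) auto
  then show "\<exists>y\<in>carrier (presented_group X R). y \<otimes>\<^bsub>presented_group X R\<^esub> x = \<one>\<^bsub>presented_group X R\<^esub>"
    using u set_inv_word[OF u(1)]
    by (intro bexI[of _ "pres_class X R (inv_word u)"])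
       (auto simp: presented_group_carrier presented_group_mult[OF assms] presented_group_one)
next
  fix x y assume "x \<in> carrier (presented_group X R)" "y \<in> carrier (presented_group X R)"
  then obtain u v where "set u \<subseteq> X \<times> UNIV" "x = pres_class X R u"
      "set v \<subseteq> X \<times> UNIV" "y = pres_class X R v"
    by (auto simp: presented_group_carrier)
  then show "x \<otimes>\<^bsub>presented_group X R\<^esub> y \<in> carrier (presented_group X R)"
    by (auto simp: presented_group_carrier presented_group_mult[OF assms] intro!: exI[of _ "u @ v"])
next
  show "\<one>\<^bsub>presented_group X R\<^esub> \<in> carrier (presented_group X R)"
    by (auto simp: presented_group_carrier presented_group_one intro!: exI[of _ "[]"])
qed (auto simp: presented_group_carrier presented_group_one presented_group_mult[OF assms])

section \<open>The group \<open>G(d,1,n)\<close>\<close>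

lemma relators_over_signed:
  assumes "n \<ge> 2"
  shows "relators_over {1..n} (signed_relations d n)"
  using assms unfolding relators_over_def signed_relations_def refl_relations_def
  by (auto simp: pos_word_def)

text \<open>
  Equality in \<open>G(d,1,n)\<close> of the elements represented by two positive words.
\<close>

definition elt_equiv :: "nat \<Rightarrow> nat \<Rightarrow> nat list \<Rightarrow> nat list \<Rightarrow> bool" where
  "elt_equiv d n u v \<longleftrightarrow> pres_cong {1..n} (signed_relations d n) (pos_word u) (pos_word v)"

lemma elt_equiv_refl: "set u \<subseteq> {1..n} \<Longrightarrow> elt_equiv d n u u"
  by (simp add: elt_equiv_def pres_cong.refl set_pos_word)

lemma elt_equiv_sym: "elt_equiv d n u v \<Longrightarrow> elt_equiv d n v u"
  by (simp add: elt_equiv_def pres_cong.sym)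

lemma elt_equiv_trans [trans]: "elt_equiv d n u v \<Longrightarrow> elt_equiv d n v w \<Longrightarrow> elt_equiv d n u w"
  unfolding elt_equiv_def by (rule pres_cong.trans)

lemma elt_equiv_append: "elt_equiv d n u u' \<Longrightarrow> elt_equiv d n v v' \<Longrightarrow> elt_equiv d n (u @ v) (u' @ v')"
  by (simp add: elt_equiv_def pres_cong.append)

lemma elt_equiv_context:
  assumes "elt_equiv d n u v" "set x \<subseteq> {1..n}" "set y \<subseteq> {1..n}"
  shows "elt_equiv d n (x @ u @ y) (x @ v @ y)"
  using assms by (intro elt_equiv_append elt_equiv_refl)

lemma elt_equiv_rel: "(u, v) \<in> refl_relations d n \<Longrightarrow> elt_equiv d n u v"
  unfolding elt_equiv_def signed_relations_def by (intro pres_cong.rel) (auto simp: map_prod_def)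

lemma word_elt_eq_iff:
  assumes "set u \<subseteq> {1..n}"
  shows "word_elt d n u = word_elt d n v \<longleftrightarrow> elt_equiv d n u v"
  unfolding word_elt_def elt_equiv_def using assms by (intro pres_class_eq_iff) (simp add: set_pos_word)

lemma word_elt_mult:
  assumes "n \<ge> 2" "set u \<subseteq> {1..n}" "set v \<subseteq> {1..n}"
  shows "word_elt d n u \<otimes>\<^bsub>Gd1 d n\<^esub> word_elt d n v = word_elt d n (u @ v)"
  unfolding word_elt_def Gd1_def
  using assms by (subst presented_group_mult) (simp_all add: relators_over_signed set_pos_word del: One_nat_def)

lemma group_Gd1: "n \<ge> 2 \<Longrightarrow> group (Gd1 d n)"
  unfolding Gd1_def by (intro group_presented_group relators_over_signed)

lemma word_elt_carrier: "set w \<subseteq> {1..n} \<Longrightarrow> word_elt d n w \<in> carrier (Gd1 d n)"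
  unfolding Gd1_def presented_group_carrier word_elt_def
  by (intro exI[of _ "pos_word w"]) (simp add: set_pos_word)

lemma word_elt_Nil: "word_elt d n [] = \<one>\<^bsub>Gd1 d n\<^esub>"
  by (simp add: word_elt_def Gd1_def presented_group_one)

lemma positive_inverse:
  assumes "x \<in> {1..n}" "d > 0"
  obtains w where "set w \<subseteq> {1..n}" "elt_equiv d n (w @ [x]) []"
proof (cases "x = n")
  case True
  have "elt_equiv d n (replicate (d - 1) n @ [n]) []"
  proof -
    have "replicate (d - 1) n @ [n] = replicate d n"
      using assms(2) by (metis Suc_diff_1 replicate_Suc replicate_append_same)
    then show ?thesis by (simp add: elt_equiv_rel refl_relations_def)
  qed
  moreover have "set (replicate (d - 1) n) \<subseteq> {1..n}" using True assms by auto
  ultimately show ?thesis using that True by blast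
next
  case False
  then have "elt_equiv d n ([x] @ [x]) []"
    using assms by (intro elt_equiv_rel) (auto simp: refl_relations_def)
  with that[of "[x]"] assms show ?thesis by auto
qed

text \<open>
  Each generator has finite order, so its formal inverse can be replaced by a positive power.
\<close>

lemma carrier_positive:
  assumes "n \<ge> 2" "d > 0" "g \<in> carrier (Gd1 d n)"
  obtains w where "set w \<subseteq> {1..n}" "g = word_elt d n w"
proof -
  have "\<exists>w. set w \<subseteq> {1..n} \<and> pres_cong {1..n} (signed_relations d n) u (pos_word w)"
    if "set u \<subseteq> {1..n} \<times> UNIV" for u
    using that
  proof (induction u)
    case Nil
    then show ?case by (intro exI[of _ "[]"]) (auto intro: pres_cong.refl)
  next
    case (Cons a u)
    let ?C = "pres_cong {1..n} (signed_relations d n)"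
    obtain x b where a: "a = (x, b)" by force
    have x: "x \<in> {1..n}" using Cons.prems a by auto
    have "\<exists>v. set v \<subseteq> {1..n} \<and> ?C [a] (pos_word v)"
    proof (cases b)
      case True
      with x a show ?thesis
        by (intro exI[of _ "[x]"]) (auto simp: pos_word_def intro: pres_cong.refl)
    next
      case False
      obtain w where w: "set w \<subseteq> {1..n}" "elt_equiv d n (w @ [x]) []"
        using positive_inverse[OF x \<open>d > 0\<close>] by blast
      have xx: "?C [a] [a]" using x a by (intro pres_cong.refl) auto
      have "?C ((pos_word w @ [(x, True)]) @ [a]) ([] @ [a])"
        using w(2) xx unfolding elt_equiv_def by (intro pres_cong.append) (simp_all add: pos_word_def)
      moreover have "?C (pos_word w @ [(x, True), a]) (pos_word w @ [])"
        using w(1) pres_cong.cancel[OF x, of "signed_relations d n" True] False a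
        by (intro pres_cong.append pres_cong.refl) (auto simp: set_pos_word)
      ultimately have "?C [a] (pos_word w)"
        by (simp, meson pres_cong.sym pres_cong.trans)
      with w show ?thesis by blast
    qed
    then obtain v where v: "set v \<subseteq> {1..n}" "?C [a] (pos_word v)" by blast
    obtain w where w: "set w \<subseteq> {1..n}" "?C u (pos_word w)" using Cons by auto
    show ?case using pres_cong.append[OF v(2) w(2)] v(1) w(1)
      by (intro exI[of _ "v @ w"]) auto
  qed
  moreover obtain u where u: "set u \<subseteq> {1..n} \<times> UNIV"
      "g = pres_class {1..n} (signed_relations d n) u"
    using assms(3) unfolding Gd1_def presented_group_carrier by blast
  ultimately obtain w where w: "set w \<subseteq> {1..n}"
      "pres_cong {1..n} (signed_relations d n) u (pos_word w)"
    by blast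
  have "g = word_elt d n w"
    unfolding word_elt_def u(2) using u(1) w(2) by (subst pres_class_eq_iff)
  with w(1) that show ?thesis by blast
qed

section \<open>Braid moves\<close>

text \<open>
  The second family contains more than the defining relation, which is the case \<open>a = b = 1\<close>: for
  \<open>a, b \<ge> 2\<close> both sides may be reduced although neither contains the defining braid, so the
  defining relations alone would not connect all reduced words.
\<close>

definition braid_moves :: "nat \<Rightarrow> (nat list \<times> nat list) set" where
  "braid_moves n =
     {([i, i + 1, i], [i + 1, i, i + 1]) | i. 1 \<le> i \<and> i + 2 \<le> n}
   \<union> {(replicate a n @ [n - 1] @ replicate b n @ [n - 1],
       [n - 1] @ replicate b n @ [n - 1] @ replicate a n) | a b. 1 \<le> a \<and> 1 \<le> b}"

definition braid_step :: "nat \<Rightarrow> nat list \<Rightarrow> nat list \<Rightarrow> bool" where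
  "braid_step n u v \<longleftrightarrow>
     (\<exists>x l r y. ((l, r) \<in> braid_moves n \<or> (r, l) \<in> braid_moves n) \<and> u = x @ l @ y \<and> v = x @ r @ y)"

lemma braid_moves_step: "(l, r) \<in> braid_moves n \<Longrightarrow> braid_step n l r"
  unfolding braid_step_def by (metis append_Nil append_Nil2)

lemma braid4_move:
  "1 \<le> a \<Longrightarrow> 1 \<le> b \<Longrightarrow>
   (replicate a n @ [n - 1] @ replicate b n @ [n - 1], [n - 1] @ replicate b n @ [n - 1] @ replicate a n)
     \<in> braid_moves n"
  unfolding braid_moves_def by blast

lemma braid3_move: "1 \<le> i \<Longrightarrow> i + 2 \<le> n \<Longrightarrow> ([i, Suc i, i], [Suc i, i, Suc i]) \<in> braid_moves n"
  unfolding braid_moves_def by auto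

abbreviation comm_equiv :: "nat \<Rightarrow> nat list \<Rightarrow> nat list \<Rightarrow> bool" where
  "comm_equiv n \<equiv> (comm_step n)\<^sup>*\<^sup>*"

text \<open>
  Equivalence under commutations and braid moves. It preserves the length, and it is the relation
  that connects the reduced words of one element.
\<close>

definition braid_equiv :: "nat \<Rightarrow> nat list \<Rightarrow> nat list \<Rightarrow> bool" where
  "braid_equiv n = (\<lambda>u v. comm_step n u v \<or> braid_step n u v)\<^sup>*\<^sup>*"

lemma braid_equiv_refl [simp]: "braid_equiv n u u"
  by (simp add: braid_equiv_def)

lemma braid_equiv_trans [trans]: "braid_equiv n u v \<Longrightarrow> braid_equiv n v w \<Longrightarrow> braid_equiv n u w"
  unfolding braid_equiv_def by (rule rtranclp_trans)

lemma braid_step_braid_equiv: "braid_step n u v \<Longrightarrow> braid_equiv n u v"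
  unfolding braid_equiv_def by blast

lemma braid_equiv_induct [consumes 1, case_names base comm braid]:
  assumes "braid_equiv n u v" "P u"
    and "\<And>v w. braid_equiv n u v \<Longrightarrow> comm_step n v w \<Longrightarrow> P v \<Longrightarrow> P w"
    and "\<And>v w. braid_equiv n u v \<Longrightarrow> braid_step n v w \<Longrightarrow> P v \<Longrightarrow> P w"
  shows "P v"
  using assms(1)[unfolded braid_equiv_def]
  by (induction rule: rtranclp_induct) (use assms in \<open>auto simp: braid_equiv_def\<close>)

lemma comm_step_sym: "comm_step n u v \<Longrightarrow> comm_step n v u"
  unfolding comm_step_def by blast

lemma braid_step_sym: "braid_step n u v \<Longrightarrow> braid_step n v u"
  unfolding braid_step_def by blast

lemma comm_step_context: "comm_step n u v \<Longrightarrow> comm_step n (x @ u @ y) (x @ v @ y)"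
  unfolding comm_step_def by (metis append_assoc)

lemma braid_step_context: "braid_step n u v \<Longrightarrow> braid_step n (x @ u @ y) (x @ v @ y)"
  unfolding braid_step_def by (metis append_assoc)

lemma rtranclp_context:
  assumes "\<And>u v. R u v \<Longrightarrow> R (x @ u @ y) (x @ v @ y)" "R\<^sup>*\<^sup>* u v"
  shows "R\<^sup>*\<^sup>* (x @ u @ y) (x @ v @ y)"
  using assms(2) by (induction) (auto intro: rtranclp.rtrancl_into_rtrancl assms(1))

lemma comm_equiv_context: "comm_equiv n u v \<Longrightarrow> comm_equiv n (x @ u @ y) (x @ v @ y)"
  by (rule rtranclp_context) (auto intro: comm_step_context)

lemma braid_equiv_context: "braid_equiv n u v \<Longrightarrow> braid_equiv n (x @ u @ y) (x @ v @ y)"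
  unfolding braid_equiv_def by (rule rtranclp_context) (auto intro: comm_step_context braid_step_context)

lemma comm_equiv_sym: "comm_equiv n u v \<Longrightarrow> comm_equiv n v u"
  by (metis comm_step_sym sympD sympI symp_rtranclp)

lemma braid_equiv_sym: "braid_equiv n u v \<Longrightarrow> braid_equiv n v u"
  unfolding braid_equiv_def by (rule sympD[OF symp_rtranclp]) (auto intro!: sympI intro: comm_step_sym braid_step_sym)

lemma comm_equiv_imp_braid_equiv: "comm_equiv n u v \<Longrightarrow> braid_equiv n u v"
  unfolding braid_equiv_def by (rule rtranclp_mono[THEN predicate2D, rotated]) auto

lemma braid_equiv_length: "braid_equiv n u v \<Longrightarrow> length v = length u"
  by (induction rule: braid_equiv_induct) (auto simp: comm_step_def braid_step_def braid_moves_def)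

lemma comm_equiv_past:
  assumes "i \<in> {1..n}" "set w \<subseteq> {1..n}" "\<And>x. x \<in> set w \<Longrightarrow> x + 1 < i \<or> i + 1 < x"
  shows "comm_equiv n (w @ [i]) ([i] @ w)"
  using assms(2,3)
proof (induction w)
  case (Cons x w)
  have "comm_equiv n ([x] @ (w @ [i]) @ []) ([x] @ ([i] @ w) @ [])"
    using Cons by (intro comm_equiv_context) auto
  moreover have "comm_step n [x, i] [i, x]"
    unfolding comm_step_def using Cons.prems assms(1)
    by (intro exI[of _ "[]"] exI[of _ x] exI[of _ i]) auto
  then have "comm_equiv n ([] @ [x, i] @ w) ([] @ [i, x] @ w)"
    by (intro comm_equiv_context) auto
  ultimately show ?case by simp
qed simp

lemma comm_equiv_past_word:
  assumes "set v \<subseteq> {1..n}" "set w \<subseteq> {1..n}"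
    and "\<And>x y. x \<in> set w \<Longrightarrow> y \<in> set v \<Longrightarrow> x + 1 < y \<or> y + 1 < x"
  shows "comm_equiv n (w @ v) (v @ w)"
  using assms(1,3)
proof (induction v)
  case (Cons y v)
  have "comm_equiv n ([] @ (w @ [y]) @ v) ([] @ ([y] @ w) @ v)"
    using Cons assms(2) by (intro comm_equiv_context comm_equiv_past) auto
  moreover have "comm_equiv n ([y] @ (w @ v) @ []) ([y] @ (v @ w) @ [])"
    using Cons by (intro comm_equiv_context) auto
  ultimately show ?case by simp
qed simp

lemma comm_step_over: "comm_step n u v \<Longrightarrow> set u \<subseteq> {1..n} \<Longrightarrow> set v \<subseteq> {1..n}"
  by (auto simp: comm_step_def)

lemma braid_step_over: "braid_step n u v \<Longrightarrow> set u \<subseteq> {1..n} \<Longrightarrow> set v \<subseteq> {1..n}"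
  by (auto simp: braid_step_def braid_moves_def split: if_splits)

lemma braid_equiv_over: "braid_equiv n u v \<Longrightarrow> set u \<subseteq> {1..n} \<Longrightarrow> set v \<subseteq> {1..n}"
  by (induction rule: braid_equiv_induct) (blast dest: comm_step_over braid_step_over)+

text \<open>
  The case \<open>b = 1\<close> is the defining relation; the general case follows because
  \<open>s t\<^sup>b\<^sup>+\<^sup>1 s = (s t\<^sup>b s)(s t s)\<close> with \<open>s = s\<^sub>n\<^sub>-\<^sub>1\<close>, \<open>t = s\<^sub>n\<close>, and \<open>t\<close> commutes with both factors.
\<close>

lemma elt_equiv_sandwich:
  assumes "n \<ge> 2"
  defines "s \<equiv> n - 1"
  shows "elt_equiv d n ([n] @ [s] @ replicate b n @ [s]) ([s] @ replicate b n @ [s] @ [n])"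
proof (induction b)
  have R: "set w \<subseteq> {s, n} \<Longrightarrow> elt_equiv d n w w" for w
    using assms by (intro elt_equiv_refl) auto
  have ss: "elt_equiv d n [s, s] []"
    using assms by (intro elt_equiv_rel) (auto simp: refl_relations_def)
  {
    case 0
    have "elt_equiv d n ([n] @ [s, s]) ([n] @ [])"
      by (intro elt_equiv_append ss R) auto
    moreover have "elt_equiv d n ([] @ [n]) ([s, s] @ [n])"
      by (intro elt_equiv_sym[OF elt_equiv_append] ss R) auto
    ultimately have "elt_equiv d n [n, s, s] [s, s, n]"
      using elt_equiv_trans[of d n "[n, s, s]" "[n]" "[s, s, n]"] by simp
    then show ?case by simp
  next
    case (Suc b)
    let ?u = "[s] @ replicate b n"
    have split: "elt_equiv d n (?u @ [s, s] @ [n, s]) (?u @ [] @ [n, s])"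
      by (intro elt_equiv_append ss R) auto
    have "elt_equiv d n ([n] @ (?u @ [s, s] @ [n, s])) ([n] @ (?u @ [] @ [n, s]))"
      by (rule elt_equiv_append[OF R split]) auto
    then have 1: "elt_equiv d n ([n] @ ?u @ [n, s]) (([n] @ ?u @ [s]) @ [s, n, s])"
      by (simp add: elt_equiv_sym)
    have 2: "elt_equiv d n (([n] @ ?u @ [s]) @ [s, n, s]) ((?u @ [s] @ [n]) @ [s, n, s])"
      by (rule elt_equiv_append[OF _ R]) (use Suc in auto)
    have "elt_equiv d n [n, s, n, s] [s, n, s, n]"
      unfolding s_def by (intro elt_equiv_rel) (auto simp: refl_relations_def)
    then have "elt_equiv d n ((?u @ [s]) @ [n, s, n, s]) ((?u @ [s]) @ [s, n, s, n])"
      by (intro elt_equiv_append R) auto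
    then have 3: "elt_equiv d n ((?u @ [s] @ [n]) @ [s, n, s]) ((?u @ [s, s] @ [n, s]) @ [n])"
      by simp
    have 4: "elt_equiv d n ((?u @ [s, s] @ [n, s]) @ [n]) ((?u @ [] @ [n, s]) @ [n])"
      by (rule elt_equiv_append[OF split R]) auto
    have "elt_equiv d n ([n] @ ?u @ [n, s]) ((?u @ [] @ [n, s]) @ [n])"
      using elt_equiv_trans[OF 1 elt_equiv_trans[OF 2 elt_equiv_trans[OF 3 4]]] .
    then show ?case by (simp flip: replicate_append_same)
  }
qed

lemma elt_equiv_braid4:
  assumes "n \<ge> 2"
  shows "elt_equiv d n (replicate a n @ [n - 1] @ replicate b n @ [n - 1])
                 ([n - 1] @ replicate b n @ [n - 1] @ replicate a n)"
proof (induction a)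
  case 0
  show ?case using assms by (simp, intro elt_equiv_refl) auto
next
  case (Suc a)
  let ?z = "[n - 1] @ replicate b n @ [n - 1]"
  have "elt_equiv d n (([n]) @ (replicate a n @ ?z)) ([n] @ (?z @ replicate a n))"
    using elt_equiv_append[OF elt_equiv_refl[of "[n]"] Suc] assms by simp
  moreover have "elt_equiv d n (([n] @ ?z) @ replicate a n) ((?z @ [n]) @ replicate a n)"
    by (rule elt_equiv_append[OF _ elt_equiv_refl]) (use elt_equiv_sandwich[OF assms, of d b] assms in auto)
  ultimately have "elt_equiv d n ([n] @ (replicate a n @ ?z)) ((?z @ [n]) @ replicate a n)"
    using elt_equiv_trans[of d n _ "[n] @ ?z @ replicate a n"] by simp
  then show ?case by simp
qed

lemma comm_step_elt_equiv:
  assumes "comm_step n u v" "set u \<subseteq> {1..n}"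
  shows "elt_equiv d n u v"
proof -
  obtain x y i j where *: "i \<in> {1..n}" "j \<in> {1..n}" "j + 1 < i \<or> i + 1 < j"
      "u = x @ [i, j] @ y" "v = x @ [j, i] @ y"
    using assms(1) unfolding comm_step_def by blast
  have r: "elt_equiv d n [i, j] [j, i]" if "j + 1 < i" "i \<le> n" "1 \<le> j" for i j
    using that by (intro elt_equiv_rel) (auto simp: refl_relations_def)
  have "elt_equiv d n [i, j] [j, i]"
    using * r[of j i] r[of i j] elt_equiv_sym by auto
  then show ?thesis
    unfolding *(4,5) using assms(2) * by (intro elt_equiv_context) auto
qed

lemma braid_moves_elt_equiv:
  assumes "n \<ge> 2" "(l, r) \<in> braid_moves n"
  shows "elt_equiv d n l r"
  using assms(2) unfolding braid_moves_def
proof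
  assume "(l, r) \<in> {([i, i + 1, i], [i + 1, i, i + 1]) | i. 1 \<le> i \<and> i + 2 \<le> n}"
  then show ?thesis
    by (intro elt_equiv_sym[OF elt_equiv_rel]) (auto simp: refl_relations_def)
qed (use elt_equiv_braid4[OF assms(1)] in blast)

lemma braid_step_elt_equiv:
  assumes "n \<ge> 2" "braid_step n u v" "set u \<subseteq> {1..n}"
  shows "elt_equiv d n u v"
proof -
  obtain x l r y where *: "(l, r) \<in> braid_moves n \<or> (r, l) \<in> braid_moves n"
      "u = x @ l @ y" "v = x @ r @ y"
    using assms(2) unfolding braid_step_def by blast
  have "elt_equiv d n l r"
    using *(1) braid_moves_elt_equiv[OF assms(1)] elt_equiv_sym by blast
  then show ?thesis unfolding *(2,3) using assms(3) *(2) by (intro elt_equiv_context) auto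
qed

lemma braid_equiv_elt_equiv:
  assumes "n \<ge> 2" "braid_equiv n u v" "set u \<subseteq> {1..n}"
  shows "elt_equiv d n u v"
  using assms(2)
proof (induction rule: braid_equiv_induct)
  case base
  then show ?case using assms(3) by (rule elt_equiv_refl)
next
  case (comm v w)
  then show ?case
    using braid_equiv_over[OF comm(1) assms(3)] comm_step_elt_equiv elt_equiv_trans by blast
next
  case (braid v w)
  then show ?case
    using braid_equiv_over[OF braid(1) assms(3)] braid_step_elt_equiv[OF assms(1)] elt_equiv_trans by blast
qed

section \<open>Rewriting to canonical words\<close>

text \<open>
  Either the two words are linked by length-preserving moves, or the second one is shorter. A reduced
  word can only reduce in the first way, so this single relation yields both the existence of
  canonical words and the connectedness of the reduced words.
\<close>

definition reduces :: "nat \<Rightarrow> nat \<Rightarrow> nat list \<Rightarrow> nat list \<Rightarrow> bool" where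
  "reduces d n u v \<longleftrightarrow> elt_equiv d n u v \<and> (braid_equiv n u v \<or> length v < length u)"

lemma reduces_refl: "set u \<subseteq> {1..n} \<Longrightarrow> reduces d n u u"
  by (simp add: reduces_def elt_equiv_refl)

lemma reduces_length: "reduces d n u v \<Longrightarrow> length v \<le> length u"
  using braid_equiv_length unfolding reduces_def by fastforce

lemma reduces_trans [trans]:
  assumes "reduces d n u v" "reduces d n v w"
  shows "reduces d n u w"
proof -
  have "elt_equiv d n u w"
    using assms elt_equiv_trans unfolding reduces_def by blast
  moreover have "braid_equiv n u w \<or> length w < length u"
  proof (cases "braid_equiv n u v \<and> braid_equiv n v w")
    case True
    then show ?thesis using braid_equiv_trans by blast
  next
    case False
    then have "length v < length u \<or> length w < length v"
      using assms unfolding reduces_def by blast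
    then show ?thesis
      using assms[THEN reduces_length] by linarith
  qed
  ultimately show ?thesis unfolding reduces_def ..
qed

lemma reduces_context:
  assumes "reduces d n u v" "set x \<subseteq> {1..n}" "set y \<subseteq> {1..n}"
  shows "reduces d n (x @ u @ y) (x @ v @ y)"
  using assms braid_equiv_context elt_equiv_context unfolding reduces_def by auto

lemma braid_equiv_reduces: "n \<ge> 2 \<Longrightarrow> set u \<subseteq> {1..n} \<Longrightarrow> braid_equiv n u v \<Longrightarrow> reduces d n u v"
  by (simp add: reduces_def braid_equiv_elt_equiv)

lemma comm_equiv_reduces: "n \<ge> 2 \<Longrightarrow> set u \<subseteq> {1..n} \<Longrightarrow> comm_equiv n u v \<Longrightarrow> reduces d n u v"
  by (intro braid_equiv_reduces comm_equiv_imp_braid_equiv)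

lemma reduces_square: "1 \<le> i \<Longrightarrow> i < n \<Longrightarrow> reduces d n [i, i] []"
  unfolding reduces_def by (auto simp: refl_relations_def intro!: elt_equiv_rel)

lemma reduces_power: "d > 0 \<Longrightarrow> reduces d n (replicate d n) []"
  unfolding reduces_def by (auto simp: refl_relations_def intro!: elt_equiv_rel)

lemma set_desc_word [simp]: "set (desc_word i j) = {j..i}"
  by (auto simp: desc_word_def)

lemma desc_word_empty [simp]: "i < j \<Longrightarrow> desc_word i j = []"
  by (simp add: desc_word_def)

lemma desc_word_snoc: "j \<le> i \<Longrightarrow> desc_word i j = desc_word i (Suc j) @ [j]"
  by (simp add: desc_word_def upt_conv_Cons del: upt_Suc)

lemma desc_word_Cons: "j \<le> Suc i \<Longrightarrow> desc_word (Suc i) j = Suc i # desc_word i j"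
  by (simp add: desc_word_def)

lemma desc_word_Cons': "j \<le> i \<Longrightarrow> 1 \<le> i \<Longrightarrow> desc_word i j = i # desc_word (i - 1) j"
  using desc_word_Cons[of j "i - 1"] by simp

lemma desc_word_split:
  assumes "j \<le> Suc m" "m \<le> i"
  shows "desc_word i j = desc_word i (Suc m) @ desc_word m j"
proof -
  have "[j..<Suc i] = [j..<Suc m] @ [Suc m..<Suc i]"
    using assms upt_add_eq_append[of j "Suc m" "i - m"] by (simp del: upt_Suc)
  then show ?thesis by (simp add: desc_word_def del: upt_Suc)
qed

text \<open>
  The letter \<open>i\<close> slides right until it meets \<open>i + 1, i\<close>, is turned into \<open>i + 1\<close> by one braid move, and
  slides on.
\<close>

lemma desc_word_shift:
  assumes "1 \<le> j" "j \<le> i" "i < M" "M < n"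
  shows "braid_equiv n ([i] @ desc_word M j) (desc_word M j @ [Suc i])"
proof -
  let ?A = "desc_word M (Suc (Suc i))" and ?B = "desc_word (i - 1) j"
  have D: "desc_word M j = ?A @ [Suc i, i] @ ?B"
    using assms desc_word_split[of j "Suc i" M] desc_word_Cons[of j i] desc_word_Cons[of j "i - 1"]
    by simp
  have "comm_equiv n ([] @ ([i] @ ?A) @ [Suc i, i] @ ?B) ([] @ (?A @ [i]) @ [Suc i, i] @ ?B)"
    using assms by (intro comm_equiv_context comm_equiv_sym[OF comm_equiv_past]) auto
  then have 1: "braid_equiv n ([i] @ desc_word M j) (?A @ [i, Suc i, i] @ ?B)"
    unfolding D using comm_equiv_imp_braid_equiv by simp
  have "braid_step n [i, Suc i, i] [Suc i, i, Suc i]"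
    using assms by (intro braid_moves_step braid3_move) auto
  then have 2: "braid_equiv n (?A @ [i, Suc i, i] @ ?B) (?A @ [Suc i, i, Suc i] @ ?B)"
    by (intro braid_equiv_context braid_step_braid_equiv)
  have "comm_equiv n ((?A @ [Suc i, i]) @ ([Suc i] @ ?B) @ []) ((?A @ [Suc i, i]) @ (?B @ [Suc i]) @ [])"
    using assms by (intro comm_equiv_context comm_equiv_sym[OF comm_equiv_past]) auto
  then have 3: "braid_equiv n (?A @ [Suc i, i, Suc i] @ ?B) (desc_word M j @ [Suc i])"
    unfolding D using comm_equiv_imp_braid_equiv by simp
  from 1 2 3 show ?thesis by (meson braid_equiv_trans)
qed

text \<open>
  Each letter of the first run passes through the second one and is raised by one.
\<close>

lemma desc_word_exchange:
  assumes "1 \<le> i" "i \<le> y" "y \<le> M" "M < n"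
  shows "braid_equiv n (desc_word (M - 1) y @ desc_word M i) (desc_word M i @ desc_word M (Suc y))"
  using assms(3,2)
proof (induction y rule: inc_induct)
  case base
  then show ?case using assms by (cases M) auto
next
  case (step y)
  have a: "desc_word (M - 1) y = desc_word (M - 1) (Suc y) @ [y]"
    using step by (intro desc_word_snoc) auto
  have b: "desc_word M (Suc y) = desc_word M (Suc (Suc y)) @ [Suc y]"
    using step by (intro desc_word_snoc) auto
  have "braid_equiv n (desc_word (M - 1) (Suc y) @ ([y] @ desc_word M i) @ [])
              (desc_word (M - 1) (Suc y) @ (desc_word M i @ [Suc y]) @ [])"
    using step assms by (intro braid_equiv_context desc_word_shift) auto
  also have "desc_word (M - 1) (Suc y) @ (desc_word M i @ [Suc y]) @ []
      = [] @ (desc_word (M - 1) (Suc y) @ desc_word M i) @ [Suc y]"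
    by simp
  also have "braid_equiv n \<dots> ([] @ (desc_word M i @ desc_word M (Suc (Suc y))) @ [Suc y])"
    using step by (intro braid_equiv_context) auto
  finally show ?case using a b by simp
qed

text \<open>
  Two blocks ending at neighbouring indices correspond to two neighbouring coloured positions. Swapping
  the positions exchanges the exponents and releases one letter \<open>n - 1\<close> to the left.
\<close>

lemma suffix_block_swap:
  assumes "n \<ge> 2" "1 \<le> i" "i < n" "1 \<le> a" "1 \<le> b"
  shows "braid_equiv n (suffix_block n a i @ suffix_block n b (Suc i) @ [i])
               ([n - 1] @ suffix_block n b i @ suffix_block n a (Suc i))"
proof -
  let ?s = "n - 1"
  let ?D = "desc_word (?s - 1) i"
  have si: "desc_word ?s i = [?s] @ ?D"
    using assms desc_word_Cons'[of i ?s] by simp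
  have past: "comm_equiv n (?D @ replicate k n) (replicate k n @ ?D)" for k
    using assms by (intro comm_equiv_past_word) auto
  have "suffix_block n b (Suc i) @ [i] = replicate b n @ desc_word ?s i"
    unfolding suffix_block_def using assms desc_word_snoc[of i ?s] by simp
  then have "suffix_block n a i @ suffix_block n b (Suc i) @ [i]
      = (replicate a n @ [?s]) @ (?D @ replicate b n) @ desc_word ?s i"
    by (simp add: suffix_block_def si del: One_nat_def)
  also have "braid_equiv n \<dots> ((replicate a n @ [?s]) @ (replicate b n @ ?D) @ desc_word ?s i)"
    by (rule braid_equiv_context[OF comm_equiv_imp_braid_equiv[OF past]])
  also have "(replicate a n @ [?s]) @ (replicate b n @ ?D) @ desc_word ?s i
      = (replicate a n @ [?s] @ replicate b n) @ (?D @ desc_word ?s i) @ []"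
    by simp
  also have "braid_equiv n \<dots> ((replicate a n @ [?s] @ replicate b n) @ (desc_word ?s i @ desc_word ?s (Suc i)) @ [])"
    by (rule braid_equiv_context[OF desc_word_exchange]) (use assms in auto)
  also have "(replicate a n @ [?s] @ replicate b n) @ (desc_word ?s i @ desc_word ?s (Suc i)) @ []
      = [] @ (replicate a n @ [?s] @ replicate b n @ [?s]) @ (?D @ desc_word ?s (Suc i))"
    by (simp add: si del: One_nat_def)
  also have "braid_equiv n \<dots> ([] @ ([?s] @ replicate b n @ [?s] @ replicate a n) @ (?D @ desc_word ?s (Suc i)))"
  proof (rule braid_equiv_context)
    have "braid_step n (replicate a n @ [?s] @ replicate b n @ [?s])
                       ([?s] @ replicate b n @ [?s] @ replicate a n)"
      using assms(4,5) by (intro braid_moves_step braid4_move)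
    then show "braid_equiv n (replicate a n @ [?s] @ replicate b n @ [?s])
                     ([?s] @ replicate b n @ [?s] @ replicate a n)"
      by (rule braid_step_braid_equiv)
  qed
  also have "[] @ ([?s] @ replicate b n @ [?s] @ replicate a n) @ (?D @ desc_word ?s (Suc i))
      = ([?s] @ replicate b n @ [?s]) @ (replicate a n @ ?D) @ desc_word ?s (Suc i)"
    by simp
  also have "braid_equiv n \<dots> (([?s] @ replicate b n @ [?s]) @ (?D @ replicate a n) @ desc_word ?s (Suc i))"
    by (rule braid_equiv_context[OF comm_equiv_imp_braid_equiv[OF comm_equiv_sym[OF past]]])
  also have "\<dots> = [?s] @ suffix_block n b i @ suffix_block n a (Suc i)"
    by (simp add: suffix_block_def si del: One_nat_def)
  finally show ?thesis .
qed

lemma prefix_words_0 [simp]: "prefix_words 0 = {[]}"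
  by (auto simp: prefix_words_def)

lemma prefix_words_Suc:
  "prefix_words (Suc m) = {w @ desc_word m j | w j. w \<in> prefix_words m \<and> 1 \<le> j \<and> j \<le> Suc m}"
proof (intro equalityI subsetI)
  fix w assume "w \<in> prefix_words (Suc m)"
  then obtain i where w: "w = concat (map (\<lambda>p. desc_word p (i p)) [1..<Suc m])"
      and i: "\<forall>p. 1 \<le> p \<and> p < Suc m \<longrightarrow> 1 \<le> i p \<and> i p \<le> p + 1"
    unfolding prefix_words_def by blast
  let ?w = "concat (map (\<lambda>p. desc_word p (i p)) [1..<m])"
  have "?w \<in> prefix_words m"
    unfolding prefix_words_def using i by fastforce
  \<comment> \<open>For \<open>m = 0\<close> there is no run to split off, and \<open>desc_word 0 1\<close> is empty.\<close>
  moreover have "w = ?w @ desc_word m (if m = 0 then 1 else i m)"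
    unfolding w by (cases "m = 0") simp_all
  moreover have "1 \<le> (if m = 0 then 1 else i m) \<and> (if m = 0 then 1 else i m) \<le> Suc m"
    using i by simp
  ultimately show "w \<in> {w @ desc_word m j | w j. w \<in> prefix_words m \<and> 1 \<le> j \<and> j \<le> Suc m}"
    by blast
next
  fix w assume "w \<in> {w @ desc_word m j | w j. w \<in> prefix_words m \<and> 1 \<le> j \<and> j \<le> Suc m}"
  then obtain v j where w: "w = v @ desc_word m j" "v \<in> prefix_words m" "1 \<le> j" "j \<le> Suc m"
    by blast
  then obtain i where v: "v = concat (map (\<lambda>p. desc_word p (i p)) [1..<m])"
      and i: "\<forall>p. 1 \<le> p \<and> p < m \<longrightarrow> 1 \<le> i p \<and> i p \<le> p + 1"
    unfolding prefix_words_def by blast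
  let ?i = "i(m := j)"
  have v': "v = concat (map (\<lambda>p. desc_word p (?i p)) [1..<m])"
    unfolding v by (intro arg_cong[of _ _ concat] map_cong) auto
  have "w = concat (map (\<lambda>p. desc_word p (?i p)) [1..<Suc m])"
    unfolding w(1) v' using w(3,4) by (cases "m = 0") (simp_all del: One_nat_def)
  moreover have "\<forall>p. 1 \<le> p \<and> p < Suc m \<longrightarrow> 1 \<le> ?i p \<and> ?i p \<le> p + 1"
    using i w(3,4) by auto
  ultimately show "w \<in> prefix_words (Suc m)"
    unfolding prefix_words_def by blast
qed

lemma prefix_words_snocI:
  "w \<in> prefix_words m \<Longrightarrow> 1 \<le> j \<Longrightarrow> j \<le> Suc m \<Longrightarrow> w @ desc_word m j \<in> prefix_words (Suc m)"
  unfolding prefix_words_Suc by blast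

lemma set_prefix_word: "w \<in> prefix_words m \<Longrightarrow> set w \<subseteq> {1..<m}"
proof (induction m arbitrary: w)
  case (Suc m)
  then obtain v j where "w = v @ desc_word m j" "v \<in> prefix_words m" "1 \<le> j"
    unfolding prefix_words_Suc by blast
  with Suc.IH[of v] show ?case by fastforce
qed simp

text \<open>
  The appended letter meets the last run \<open>m, \<dots>, j\<close>. It cancels the end of the run, extends it, or
  passes through it, possibly lowered by one, to the shorter prefix on the left.
\<close>

lemma prefix_word_times_letter:
  assumes "n \<ge> 2"
  shows "m \<le> n \<Longrightarrow> w \<in> prefix_words m \<Longrightarrow> 1 \<le> i \<Longrightarrow> i < m \<Longrightarrow>
    \<exists>w' \<in> prefix_words m. reduces d n (w @ [i]) w'"
proof (induction m arbitrary: w i)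
  case (Suc m)
  then obtain v j where w: "w = v @ desc_word m j" "v \<in> prefix_words m" "1 \<le> j" "j \<le> Suc m"
    unfolding prefix_words_Suc by blast
  have v: "set v \<subseteq> {1..n}"
    using set_prefix_word[OF w(2)] Suc.prems by auto
  have i: "i \<in> {1..n}" "m < n" "i \<le> m" using Suc.prems by auto
  consider "i = j" | "Suc i = j" | "Suc i < j" | "j < i" by linarith
  then show ?case
  proof cases
    case 1
    have D: "desc_word m j = desc_word m (Suc j) @ [j]"
      using 1 i by (intro desc_word_snoc) auto
    have "reduces d n ((v @ desc_word m (Suc j)) @ [i, i] @ []) ((v @ desc_word m (Suc j)) @ [] @ [])"
      using i v w(3) by (intro reduces_context reduces_square) auto
    moreover have "v @ desc_word m (Suc j) \<in> prefix_words (Suc m)"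
      using w 1 i by (intro prefix_words_snocI) auto
    ultimately show ?thesis using D w(1) 1 by force
  next
    case 2
    have "w @ [i] = v @ desc_word m i"
      using 2 i desc_word_snoc[of i m] w(1) by simp
    moreover have "v @ desc_word m i \<in> prefix_words (Suc m)"
      using w i by (intro prefix_words_snocI) auto
    moreover have "set (v @ desc_word m i) \<subseteq> {1..n}"
      using v i by auto
    ultimately show ?thesis using reduces_refl by metis
  next
    case 3
    have "comm_equiv n (desc_word m j @ [i]) ([i] @ desc_word m j)"
      using 3 i w(3) by (intro comm_equiv_past) auto
    then have "reduces d n (v @ (desc_word m j @ [i]) @ []) (v @ ([i] @ desc_word m j) @ [])"
      using v i w(3) assms by (intro reduces_context comm_equiv_reduces) auto
    moreover have "i < m" using 3 w(4) by linarith
    then obtain v' where v': "v' \<in> prefix_words m" "reduces d n (v @ [i]) v'"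
      using Suc.IH[of v i] w(2) Suc.prems by auto
    then have "reduces d n ([] @ (v @ [i]) @ desc_word m j) ([] @ v' @ desc_word m j)"
      using w(3) i by (intro reduces_context) auto
    ultimately have "reduces d n (w @ [i]) (v' @ desc_word m j)"
      using reduces_trans w(1) by auto
    then show ?thesis using prefix_words_snocI[OF v'(1) w(3,4)] by blast
  next
    case 4
    have "braid_equiv n (desc_word m j @ [i]) ([i - 1] @ desc_word m j)"
      using desc_word_shift[of j "i - 1" m n] 4 i w(3) braid_equiv_sym by force
    then have "reduces d n (v @ (desc_word m j @ [i]) @ []) (v @ ([i - 1] @ desc_word m j) @ [])"
      using v i w(3) assms by (intro reduces_context braid_equiv_reduces) auto
    moreover have "1 \<le> i - 1" "i - 1 < m" using 4 w(3) i by linarith+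
    then obtain v' where v': "v' \<in> prefix_words m" "reduces d n (v @ [i - 1]) v'"
      using Suc.IH[of v "i - 1"] w(2) Suc.prems by auto
    then have "reduces d n ([] @ (v @ [i - 1]) @ desc_word m j) ([] @ v' @ desc_word m j)"
      using w(3) i by (intro reduces_context) auto
    ultimately have "reduces d n (w @ [i]) (v' @ desc_word m j)"
      using reduces_trans w(1) by auto
    then show ?thesis using prefix_words_snocI[OF v'(1) w(3,4)] by blast
  qed
qed simp

lemma suffix_data_Nil [simp]: "suffix_data d n []"
  by (simp add: suffix_data_def)

lemma suffix_data_Cons:
  "suffix_data d n ((k, j) # ps) \<longleftrightarrow>
     1 \<le> k \<and> k < d \<and> 1 \<le> j \<and> j \<le> n \<and> suffix_data d n ps \<and> (\<forall>q \<in> set ps. j < snd q)"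
  by (auto simp: suffix_data_def)

lemma suffix_word_Nil [simp]: "suffix_word n [] = []"
  by (simp add: suffix_word_def)

lemma suffix_word_Cons [simp]:
  "suffix_word n ((k, j) # ps) = suffix_block n k j @ suffix_word n ps"
  by (simp add: suffix_word_def)

lemma set_suffix_block: "j \<le> n \<Longrightarrow> set (suffix_block n k j) \<subseteq> {j..n}"
  by (auto simp: suffix_block_def)

lemma set_suffix_word:
  "suffix_data d n ps \<Longrightarrow> \<forall>q \<in> set ps. L < snd q \<Longrightarrow> set (suffix_word n ps) \<subseteq> {Suc L..n}"
proof (induction ps)
  case (Cons p ps)
  obtain k j where p: "p = (k, j)" by force
  with Cons show ?case using set_suffix_block[of j n k] by (fastforce simp: suffix_data_Cons)
qed simp

lemma suffix_data_pos: "suffix_data d n ps \<Longrightarrow> \<forall>q \<in> set ps. 0 < snd q"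
  by (fastforce simp: suffix_data_def)

lemma set_suffix_word_over: "suffix_data d n ps \<Longrightarrow> set (suffix_word n ps) \<subseteq> {1..n}"
  using set_suffix_word[of d n ps 0] suffix_data_pos[of d n ps] by (simp del: One_nat_def) simp

lemma suffix_word_past:
  assumes "suffix_data d n ps" "\<forall>q \<in> set ps. Suc i < snd q" "1 \<le> i" "i \<le> n"
  shows "comm_equiv n (suffix_word n ps @ [i]) ([i] @ suffix_word n ps)"
  using assms set_suffix_word[OF assms(1,2)] by (intro comm_equiv_past) auto

lemma suffix_block_past:
  assumes "1 \<le> j" "j \<le> i" "Suc i < n"
  shows "braid_equiv n (suffix_block n k j @ [Suc i]) ([i] @ suffix_block n k j)"
proof -
  have "braid_equiv n (desc_word (n - 1) j @ [Suc i]) ([i] @ desc_word (n - 1) j)"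
    using assms by (intro braid_equiv_sym[OF desc_word_shift]) auto
  then have 1: "braid_equiv n (replicate k n @ (desc_word (n - 1) j @ [Suc i]) @ [])
      (replicate k n @ ([i] @ desc_word (n - 1) j) @ [])"
    by (rule braid_equiv_context)
  have "comm_equiv n (replicate k n @ [i]) ([i] @ replicate k n)"
    using assms by (intro comm_equiv_past) auto
  then have 2: "braid_equiv n ([] @ (replicate k n @ [i]) @ desc_word (n - 1) j)
      ([] @ ([i] @ replicate k n) @ desc_word (n - 1) j)"
    by (intro braid_equiv_context comm_equiv_imp_braid_equiv)
  from 1 2 show ?thesis
    unfolding suffix_block_def using braid_equiv_trans by auto
qed

lemma suffix_block_snoc:
  "1 \<le> i \<Longrightarrow> i < n \<Longrightarrow> suffix_block n k (Suc i) @ [i] = suffix_block n k i"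
  unfolding suffix_block_def using desc_word_snoc[of i "n - 1"] by simp

text \<open>
  A suffix records which positions are coloured, and the letter \<open>i\<close> swaps the positions \<open>i\<close> and
  \<open>i + 1\<close>. If exactly one of them is coloured, its block changes its end; otherwise the
  letter leaves the suffix on the left as some other letter \<open>m\<close>. The lower bound \<open>L\<close> is
  needed when the induction puts the first block back in front.
\<close>

lemma suffix_word_times_letter:
  assumes "n \<ge> 2"
  shows "suffix_data d n ps \<Longrightarrow> \<forall>q \<in> set ps. L < snd q \<Longrightarrow> L < i \<Longrightarrow> i < n \<Longrightarrow>
    \<exists>ps'. suffix_data d n ps' \<and> (\<forall>q \<in> set ps'. L < snd q) \<and>
      (reduces d n (suffix_word n ps @ [i]) (suffix_word n ps') \<or>
       (\<exists>m. L < m \<and> m < n \<and> reduces d n (suffix_word n ps @ [i]) ([m] @ suffix_word n ps')))"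
proof (induction ps arbitrary: L)
  case Nil
  then have "reduces d n [i] [i]" by (intro reduces_refl) auto
  with Nil show ?case by (intro exI[of _ "[]"]) auto
next
  case (Cons p ps)
  obtain k j where p: "p = (k, j)" by force
  have d: "suffix_data d n ps" "\<forall>q \<in> set ps. j < snd q" "1 \<le> k" "k < d" "1 \<le> j" "j \<le> n"
      "suffix_data d n (p # ps)"
    using Cons.prems(1) by (auto simp: p suffix_data_Cons)
  have L: "L < j" "\<forall>q \<in> set ps. L < snd q" using Cons.prems p by auto
  let ?B = "suffix_block n k"
  have B: "set (?B x) \<subseteq> {1..n}" if "1 \<le> x" "x \<le> n" for x
    using set_suffix_block[OF that(2)] that by fastforce
  have S: "set (suffix_word n ps) \<subseteq> {1..n}"
    using set_suffix_word_over[OF d(1)] .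
  have i: "1 \<le> i" "i \<in> {1..n}" using Cons.prems by auto
  consider "Suc i < j" | "Suc i = j" | "i = j" "\<forall>q \<in> set ps. Suc j < snd q"
      | k2 ps2 where "i = j" "ps = (k2, Suc j) # ps2" | "j < i"
  proof -
    have "i = j \<Longrightarrow> \<not> (\<forall>q \<in> set ps. Suc j < snd q) \<Longrightarrow> \<exists>k2 ps2. ps = (k2, Suc j) # ps2"
      using d(1,2) by (cases ps) (fastforce simp: suffix_data_Cons)+
    then show thesis using that by (meson linorder_less_linear not_less_eq less_antisym)
  qed
  then show ?case
  proof cases
    case 1
    have "comm_equiv n (suffix_word n (p # ps) @ [i]) ([i] @ suffix_word n (p # ps))"
      using 1 d Cons.prems i p by (intro suffix_word_past) fastforce+
    then have "reduces d n (suffix_word n (p # ps) @ [i]) ([i] @ suffix_word n (p # ps))"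
      using assms set_suffix_word_over[OF d(7)] i by (intro comm_equiv_reduces) auto
    then show ?thesis using Cons.prems by (intro exI[of _ "p # ps"]) auto
  next
    case 2
    have "comm_equiv n (suffix_word n ps @ [i]) ([i] @ suffix_word n ps)"
      using 2 d i by (intro suffix_word_past) auto
    then have "reduces d n (?B j @ (suffix_word n ps @ [i]) @ []) (?B j @ ([i] @ suffix_word n ps) @ [])"
      using assms S i B[of j] d by (intro reduces_context comm_equiv_reduces) auto
    also have "?B j @ ([i] @ suffix_word n ps) @ [] = ?B i @ suffix_word n ps"
      using suffix_block_snoc[of i n k] 2 i Cons.prems(4) by (simp flip: append_assoc)
    finally have "reduces d n (suffix_word n (p # ps) @ [i]) (suffix_word n ((k, i) # ps))"
      using p by simp
    moreover have "suffix_data d n ((k, i) # ps)"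
      using 2 d i by (auto simp: suffix_data_Cons)
    ultimately show ?thesis using Cons.prems by (intro exI[of _ "(k, i) # ps"]) auto
  next
    case 3
    have "comm_equiv n (suffix_word n ps @ [i]) ([i] @ suffix_word n ps)"
      using 3 d i by (intro suffix_word_past) auto
    then have "reduces d n (?B j @ (suffix_word n ps @ [i]) @ []) (?B j @ ([i] @ suffix_word n ps) @ [])"
      using assms S i B[of j] d by (intro reduces_context comm_equiv_reduces) auto
    also have "?B j @ ([i] @ suffix_word n ps) @ [] = ?B (Suc j) @ [i, i] @ suffix_word n ps"
      using suffix_block_snoc[of i n k] 3 Cons.prems(4) i by (simp flip: append_assoc)
    also have "reduces d n \<dots> (?B (Suc j) @ [] @ suffix_word n ps)"
      using 3 i Cons.prems(4) S B[of "Suc j"] by (intro reduces_context reduces_square) auto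
    finally have "reduces d n (suffix_word n (p # ps) @ [i]) (suffix_word n ((k, Suc j) # ps))"
      using p by simp
    moreover have "suffix_data d n ((k, Suc j) # ps)"
      using 3 d Cons.prems(4) by (auto simp: suffix_data_Cons)
    ultimately show ?thesis using Cons.prems L by (intro exI[of _ "(k, Suc j) # ps"]) auto
  next
    case 4
    let ?ps' = "(k2, j) # (k, Suc j) # ps2"
    have d2: "suffix_data d n ps2" "\<forall>q \<in> set ps2. Suc j < snd q" "1 \<le> k2" "k2 < d" "Suc j \<le> n"
      using d(1) 4(2) by (auto simp: suffix_data_Cons)
    have S2: "set (suffix_word n ps2) \<subseteq> {1..n}"
      using set_suffix_word_over[OF d2(1)] .
    have B2: "set (suffix_block n k2 (Suc j)) \<subseteq> {1..n}"
      using set_suffix_block[OF d2(5)] by fastforce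
    have "comm_equiv n (suffix_word n ps2 @ [i]) ([i] @ suffix_word n ps2)"
      using 4 d2 i by (intro suffix_word_past) auto
    then have "reduces d n ((?B j @ suffix_block n k2 (Suc j)) @ (suffix_word n ps2 @ [i]) @ [])
        ((?B j @ suffix_block n k2 (Suc j)) @ ([i] @ suffix_word n ps2) @ [])"
      using assms S2 i B[of j] B2 d by (intro reduces_context comm_equiv_reduces) auto
    also have "(?B j @ suffix_block n k2 (Suc j)) @ ([i] @ suffix_word n ps2) @ []
        = [] @ (?B j @ suffix_block n k2 (Suc j) @ [i]) @ suffix_word n ps2"
      by simp
    also have "reduces d n \<dots> ([] @ ([n - 1] @ suffix_block n k2 j @ ?B (Suc j)) @ suffix_word n ps2)"
    proof -
      have "braid_equiv n (?B j @ suffix_block n k2 (Suc j) @ [i])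
          ([n - 1] @ suffix_block n k2 j @ ?B (Suc j))"
        unfolding 4(1) using 4 d d2 Cons.prems(4) assms by (intro suffix_block_swap) auto
      then show ?thesis
        using assms S2 i B[of j] B2 d by (intro reduces_context braid_equiv_reduces) auto
    qed
    finally have "reduces d n (suffix_word n (p # ps) @ [i]) ([n - 1] @ suffix_word n ?ps')"
      using p 4 by simp
    moreover have "suffix_data d n ?ps'"
      using d d2 by (auto simp: suffix_data_Cons)
    moreover have "\<forall>q \<in> set ?ps'. L < snd q"
      using d2 L by auto
    moreover have "L < n - 1" "n - 1 < n"
      using L 4 Cons.prems by linarith+
    ultimately show ?thesis by blast
  next
    case 5
    obtain ps' where ps': "suffix_data d n ps'" "\<forall>q \<in> set ps'. j < snd q"
      "reduces d n (suffix_word n ps @ [i]) (suffix_word n ps') \<or>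
       (\<exists>m. j < m \<and> m < n \<and> reduces d n (suffix_word n ps @ [i]) ([m] @ suffix_word n ps'))"
      using Cons.IH[OF d(1,2) 5 Cons.prems(4)] by blast
    have data: "suffix_data d n ((k, j) # ps')" "\<forall>q \<in> set ((k, j) # ps'). L < snd q"
      using d ps' L by (auto simp: suffix_data_Cons)
    from ps'(3) show ?thesis
    proof
      assume "reduces d n (suffix_word n ps @ [i]) (suffix_word n ps')"
      then have "reduces d n (?B j @ (suffix_word n ps @ [i]) @ []) (?B j @ suffix_word n ps' @ [])"
        using B[of j] d by (intro reduces_context) auto
      with data p show ?thesis by (intro exI[of _ "(k, j) # ps'"]) simp
    next
      assume "\<exists>m. j < m \<and> m < n \<and> reduces d n (suffix_word n ps @ [i]) ([m] @ suffix_word n ps')"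
      then obtain m where m: "j < m" "m < n"
          "reduces d n (suffix_word n ps @ [i]) ([m] @ suffix_word n ps')"
        by blast
      have "reduces d n (?B j @ (suffix_word n ps @ [i]) @ []) (?B j @ ([m] @ suffix_word n ps') @ [])"
        using B[of j] d m by (intro reduces_context) auto
      also have "?B j @ ([m] @ suffix_word n ps') @ [] = [] @ (?B j @ [m]) @ suffix_word n ps'"
        by simp
      also have "reduces d n \<dots> ([] @ ([m - 1] @ ?B j) @ suffix_word n ps')"
      proof -
        have "braid_equiv n (?B j @ [m]) ([m - 1] @ ?B j)"
          using suffix_block_past[of j "m - 1" n k] m d by auto
        then show ?thesis
          using assms set_suffix_word_over[OF ps'(1)] B[of j] d m
          by (intro reduces_context braid_equiv_reduces) auto
      qed
      finally have "reduces d n (suffix_word n (p # ps) @ [i]) ([m - 1] @ suffix_word n ((k, j) # ps'))"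
        using p by simp
      moreover have "L < m - 1" "m - 1 < n" using m L by linarith+
      ultimately show ?thesis using data by blast
    qed
  qed
qed

text \<open>
  The letter \<open>n\<close> raises the exponent at position \<open>n\<close> modulo \<open>d\<close>.
\<close>

lemma suffix_word_times_last:
  assumes "n \<ge> 2" "d > 0"
  shows "suffix_data d n ps \<Longrightarrow> \<forall>q \<in> set ps. L < snd q \<Longrightarrow> L < n \<Longrightarrow>
    \<exists>ps'. suffix_data d n ps' \<and> (\<forall>q \<in> set ps'. L < snd q) \<and>
      reduces d n (suffix_word n ps @ [n]) (suffix_word n ps')"
proof (induction ps arbitrary: L)
  case Nil
  have r: "reduces d n [n] [n]" using assms by (intro reduces_refl) auto
  show ?case
  proof (cases "d = 1")
    case True
    \<comment> \<open>For \<open>d = 1\<close> the letter \<open>n\<close> is trivial, and the exponent 1 is not available.\<close>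
    then show ?thesis using reduces_power[of d n] by (intro exI[of _ "[]"]) auto
  next
    case False
    then show ?thesis using r Nil assms
      by (intro exI[of _ "[(1, n)]"]) (auto simp: suffix_data_Cons suffix_block_def)
  qed
next
  case (Cons p ps)
  obtain k j where p: "p = (k, j)" by force
  have d: "suffix_data d n ps" "\<forall>q \<in> set ps. j < snd q" "1 \<le> k" "k < d" "1 \<le> j" "j \<le> n"
    using Cons.prems(1) by (auto simp: p suffix_data_Cons)
  show ?case
  proof (cases "j = n")
    case True
    with d have ps: "ps = []"
      by (cases ps) (auto simp: suffix_data_def)
    have w: "suffix_word n (p # ps) @ [n] = replicate (Suc k) n"
      using assms by (simp add: ps p True suffix_block_def replicate_append_same)
    show ?thesis
    proof (cases "Suc k = d")
      case True
      then show ?thesis unfolding w using assms reduces_power[of d n] by (intro exI[of _ "[]"]) auto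
    next
      case False
      have "set (replicate (Suc k) n) \<subseteq> {1..n}" using assms by auto
      then have "reduces d n (replicate (Suc k) n) (replicate (Suc k) n)" by (rule reduces_refl)
      then show ?thesis unfolding w using False d True Cons.prems assms
        by (intro exI[of _ "[(Suc k, n)]"]) (auto simp: suffix_data_Cons suffix_block_def)
    qed
  next
    case False
    then obtain ps' where ps': "suffix_data d n ps'" "\<forall>q \<in> set ps'. j < snd q"
        "reduces d n (suffix_word n ps @ [n]) (suffix_word n ps')"
      using Cons.IH[of j] d by auto
    have "set (suffix_block n k j) \<subseteq> {1..n}"
      using set_suffix_block[OF d(6), of k] d(5) by fastforce
    then have "reduces d n (suffix_block n k j @ (suffix_word n ps @ [n]) @ [])
        (suffix_block n k j @ suffix_word n ps' @ [])"
      using ps' by (intro reduces_context) auto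
    then show ?thesis using ps' d p Cons.prems
      by (intro exI[of _ "(k, j) # ps'"]) (auto simp: suffix_data_Cons)
  qed
qed

lemma canonical_words_over: "w \<in> canonical_words d n \<Longrightarrow> set w \<subseteq> {1..n}"
  unfolding canonical_words_def using set_prefix_word set_suffix_word_over by fastforce

lemma reduces_to_canonical:
  assumes "n \<ge> 2" "d > 0" "set v \<subseteq> {1..n}"
  shows "\<exists>w \<in> canonical_words d n. reduces d n v w"
  using assms(3)
proof (induction v rule: rev_induct)
  case Nil
  have "[] \<in> prefix_words m" for m
    by (induction m) (use prefix_words_snocI[of "[]"] in fastforce)+
  then have "[] \<in> canonical_words d n"
    unfolding canonical_words_def mem_Collect_eq by (intro exI[of _ "[]"]) auto
  then show ?case by (auto intro!: reduces_refl bexI[of _ "[]"])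
next
  case (snoc i v)
  then obtain p ps where w: "p \<in> prefix_words n" "suffix_data d n ps" "reduces d n v (p @ suffix_word n ps)"
    unfolding canonical_words_def by auto
  have p: "set p \<subseteq> {1..n}" using set_prefix_word[OF w(1)] by auto
  have i: "1 \<le> i" "i \<le> n" using snoc.prems by auto
  have L: "\<forall>q \<in> set ps. 0 < snd q" using w(2) by (rule suffix_data_pos)
  have "reduces d n ([] @ v @ [i]) ([] @ (p @ suffix_word n ps) @ [i])"
    using w i by (intro reduces_context) auto
  then have 1: "reduces d n (v @ [i]) (p @ (suffix_word n ps @ [i]) @ [])" by simp
  have 2: "reduces d n (p @ (suffix_word n ps @ [i]) @ []) (p @ u @ [])"
    if "reduces d n (suffix_word n ps @ [i]) u" for u
    using that p by (intro reduces_context) auto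
  show ?case
  proof (cases "\<exists>ps'. suffix_data d n ps' \<and> reduces d n (suffix_word n ps @ [i]) (suffix_word n ps')")
    case True
    then show ?thesis
      using reduces_trans[OF 1 2] w(1) unfolding canonical_words_def by fastforce
  next
    case False
    then have "i \<noteq> n"
      using suffix_word_times_last[OF assms(1,2) w(2) L] assms(1) by fastforce
    with False obtain ps' m where ps': "suffix_data d n ps'" "0 < m" "m < n"
        "reduces d n (suffix_word n ps @ [i]) ([m] @ suffix_word n ps')"
      using suffix_word_times_letter[OF assms(1) w(2) L, of i] i by force
    obtain p' where p': "p' \<in> prefix_words n" "reduces d n (p @ [m]) p'"
      using prefix_word_times_letter[OF assms(1) order_refl w(1), of m d] ps' by auto
    then have "reduces d n ([] @ (p @ [m]) @ suffix_word n ps') ([] @ p' @ suffix_word n ps')"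
      using set_suffix_word_over[OF ps'(1)] by (intro reduces_context) auto
    then have "reduces d n (v @ [i]) (p' @ suffix_word n ps')"
      using reduces_trans[OF reduces_trans[OF 1 2[OF ps'(4)]]] by simp
    then show ?thesis
      using p'(1) ps'(1) unfolding canonical_words_def by blast
  qed
qed

section \<open>Uniqueness of canonical words\<close>

text \<open>
  Words act from the right on arrangements of coloured values: \<open>i < n\<close> swaps the positions \<open>i\<close> and
  \<open>i + 1\<close>, and \<open>n\<close> raises the colour at position \<open>n\<close>. This is the monomial matrix
  representation in one-line notation, and it separates the canonical words.
\<close>

definition act_letter :: "nat \<Rightarrow> nat \<Rightarrow> nat \<times> bool \<Rightarrow> (nat \<Rightarrow> nat \<times> nat) \<Rightarrow> nat \<Rightarrow> nat \<times> nat" where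
  "act_letter d n = (\<lambda>(x, b) f.
     if x = n then f(n := (fst (f n), (snd (f n) + (if b then 1 else d - 1)) mod d))
     else f \<circ> transpose x (Suc x))"

definition act :: "nat \<Rightarrow> nat \<Rightarrow> nat signed_word \<Rightarrow> (nat \<Rightarrow> nat \<times> nat) \<Rightarrow> nat \<Rightarrow> nat \<times> nat" where
  "act d n u = fold (act_letter d n) u"

text \<open>
  The relation \<open>s\<^sub>n\<^sup>d = 1\<close> holds for the action only on colours that are already reduced modulo \<open>d\<close>.
\<close>

definition coloured :: "nat \<Rightarrow> (nat \<Rightarrow> nat \<times> nat) \<Rightarrow> bool" where
  "coloured d f \<longleftrightarrow> (\<forall>x. snd (f x) < d)"

lemma act_Nil [simp]: "act d n [] f = f"
  by (simp add: act_def)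

lemma act_Cons [simp]: "act d n (a # u) f = act d n u (act_letter d n a f)"
  by (simp add: act_def)

lemma act_append [simp]: "act d n (u @ v) f = act d n v (act d n u f)"
  by (simp add: act_def)

lemma pos_word_Cons [simp]: "pos_word (x # w) = (x, True) # pos_word w"
  by (simp add: pos_word_def)

lemma coloured_act_letter: "d > 0 \<Longrightarrow> coloured d f \<Longrightarrow> coloured d (act_letter d n a f)"
  by (auto simp: coloured_def act_letter_def split: prod.splits)

lemma coloured_act: "d > 0 \<Longrightarrow> coloured d f \<Longrightarrow> coloured d (act d n u f)"
  by (induction u arbitrary: f) (auto intro: coloured_act_letter)

lemma act_power:
  "d > 0 \<Longrightarrow> coloured d f \<Longrightarrow>
   act d n (pos_word (replicate k n)) f = f(n := (fst (f n), (snd (f n) + k) mod d))"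
proof (induction k arbitrary: f)
  case 0
  then show ?case by (auto simp: coloured_def)
next
  case (Suc k)
  then show ?case
    using coloured_act_letter[OF Suc.prems, of n "(n, True)"]
    by (auto simp: act_letter_def mod_simps)
qed

lemma act_relation:
  assumes "n \<ge> 2" "d > 0" "(u, v) \<in> refl_relations d n" "coloured d f"
  shows "act d n (pos_word u) f = act d n (pos_word v) f"
  using assms(3) unfolding refl_relations_def
proof (elim UnE)
  assume "(u, v) \<in> {(replicate d n, [])}"
  then show ?thesis using act_power[OF assms(2,4), of n d] assms(4)
    by (auto simp: coloured_def)
qed (use assms in \<open>auto simp: act_letter_def fun_eq_iff transpose_def\<close>)

lemma act_cong:
  assumes "n \<ge> 2" "d > 0" "pres_cong {1..n} (signed_relations d n) u v" "coloured d f"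
  shows "act d n u f = act d n v f"
  using assms(3,4)
proof (induction arbitrary: f rule: pres_cong.induct)
  case (append u u' v v')
  then show ?case using coloured_act[OF assms(2)] by simp
next
  case (cancel x b)
  let ?c = "snd (f n)"
  have c: "?c < d" using cancel by (simp add: coloured_def)
  have "((?c + 1) mod d + (d - 1)) mod d = (?c + 1 + (d - 1)) mod d"
    by (rule mod_add_left_eq)
  then have 1: "((?c + 1) mod d + (d - 1)) mod d = ?c" using c by simp
  have "((?c + (d - 1)) mod d + 1) mod d = (?c + (d - 1) + 1) mod d"
    by (rule mod_add_left_eq)
  then have 2: "((?c + (d - 1)) mod d + 1) mod d = ?c" using c by simp
  show ?case using 1 2
    by (cases b) (simp_all add: act_letter_def fun_eq_iff del: One_nat_def add_Suc_right)
next
  case (rel u v)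
  then show ?case using act_relation[OF assms(1,2)] by (auto simp: signed_relations_def)
qed auto

text \<open>
  A descending run moves the entry at position \<open>M + 1\<close> to position \<open>j\<close> and shifts the entries in between
  to the right.
\<close>

lemma act_desc_word:
  assumes "1 \<le> j" "M < n"
  shows "j \<le> Suc M \<Longrightarrow> act d n (pos_word (desc_word M j)) f =
    (\<lambda>x. if x < j \<or> Suc M < x then f x else if x = j then f (Suc M) else f (x - 1))"
  using assms(2)
proof (induction M arbitrary: f)
  case 0
  then show ?case using assms(1) by (auto simp: fun_eq_iff not_less le_Suc_eq)
next
  case (Suc M)
  show ?case
  proof (cases "j = Suc (Suc M)")
    case True
    then show ?thesis by (auto simp: fun_eq_iff)
  next
    case False
    with Suc.prems have "desc_word (Suc M) j = Suc M # desc_word M j"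
      by (intro desc_word_Cons) auto
    with Suc False assms(1) show ?thesis
      by (auto simp: fun_eq_iff act_letter_def transpose_def)
  qed
qed

lemma act_suffix_block:
  assumes "1 \<le> j" "j \<le> n" "1 \<le> k" "k < d" "coloured d f" "snd (f n) = 0"
  shows "act d n (pos_word (suffix_block n k j)) f =
    (\<lambda>x. if x < j \<or> n < x then f x else if x = j then (fst (f n), k) else f (x - 1))"
proof -
  have "j \<le> Suc (n - 1)" "n - 1 < n" "d > 0" using assms by linarith+
  then show ?thesis using assms
    by (auto simp: suffix_block_def act_power act_desc_word[OF assms(1)] fun_eq_iff)
qed

text \<open>
  The blocks colour the positions from left to right, and a later block only disturbs positions to
  the right of the earlier ones. Hence the final colours are exactly the exponents of the suffix.
\<close>

lemma act_suffix_word: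
  assumes "suffix_data d n ps" "\<forall>q \<in> set ps. L < snd q" "d > 0" "coloured d f"
    and "\<forall>x. L < x \<and> x \<le> n \<longrightarrow> snd (f x) = 0"
  shows "(\<forall>x \<le> L. act d n (pos_word (suffix_word n ps)) f x = f x) \<and>
    (\<forall>x k. L < x \<and> x \<le> n \<and> k > 0 \<longrightarrow>
       ((k, x) \<in> set ps \<longleftrightarrow> snd (act d n (pos_word (suffix_word n ps)) f x) = k))"
  using assms
proof (induction ps arbitrary: f L)
  case Nil
  then show ?case by auto
next
  case (Cons p ps)
  obtain k j where p: "p = (k, j)" by force
  have d: "suffix_data d n ps" "\<forall>q \<in> set ps. j < snd q" "1 \<le> k" "k < d" "1 \<le> j" "j \<le> n" "L < j"
    using Cons.prems(1,2) by (auto simp: p suffix_data_Cons)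
  let ?g = "act d n (pos_word (suffix_block n k j)) f"
  have g: "?g = (\<lambda>x. if x < j \<or> n < x then f x else if x = j then (fst (f n), k) else f (x - 1))"
    using Cons.prems d by (intro act_suffix_block) auto
  have z: "\<forall>x. j < x \<and> x \<le> n \<longrightarrow> snd (?g x) = 0"
  proof (intro allI impI)
    fix x assume x: "j < x \<and> x \<le> n"
    then have "L < x - 1 \<and> x - 1 \<le> n" using d(7) by linarith
    then show "snd (?g x) = 0" unfolding g using Cons.prems(5) x by auto
  qed
  let ?h = "act d n (pos_word (suffix_word n ps)) ?g"
  have IH: "\<forall>x \<le> j. ?h x = ?g x"
    "\<forall>x k. j < x \<and> x \<le> n \<and> k > 0 \<longrightarrow> ((k, x) \<in> set ps \<longleftrightarrow> snd (?h x) = k)"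
    using Cons.IH[OF d(1,2) \<open>d > 0\<close> coloured_act[OF \<open>d > 0\<close> Cons.prems(4)] z] by auto
  have h: "act d n (pos_word (suffix_word n (p # ps))) f = ?h" by (simp add: p)
  have "?h x = f x" if "x \<le> L" for x
    using IH(1) that d(7) by (simp add: g)
  moreover have "(k', x) \<in> set (p # ps) \<longleftrightarrow> snd (?h x) = k'" if x: "L < x" "x \<le> n" "k' > 0" for x k'
  proof (cases "j < x")
    case True
    then show ?thesis using IH(2) x p by auto
  next
    case False
    then have "(k', x) \<notin> set ps" using d(2) by fastforce
    moreover have "?h x = ?g x" using False IH(1) by simp
    moreover have "snd (?g x) = (if x = j then k else 0)"
      using False x Cons.prems(5) d(6) by (auto simp: g)
    ultimately show ?thesis using x p by auto
  qed
  ultimately show ?case unfolding h by blast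
qed

lemma act_prefix:
  assumes "set w \<subseteq> {1..<m}" "m \<le> n"
  shows "\<exists>\<pi>. inj \<pi> \<and> (\<forall>x > m. \<pi> x = x) \<and> act d n (pos_word w) f = f \<circ> \<pi>"
  using assms(1)
proof (induction w arbitrary: f)
  case Nil
  show ?case by (intro exI[of _ id]) auto
next
  case (Cons i w)
  let ?t = "transpose i (Suc i)"
  obtain \<pi> where \<pi>: "inj \<pi>" "\<forall>x > m. \<pi> x = x" "act d n (pos_word w) (f \<circ> ?t) = (f \<circ> ?t) \<circ> \<pi>"
    using Cons by fastforce
  have "act d n (pos_word (i # w)) f = f \<circ> (?t \<circ> \<pi>)"
    using Cons.prems assms(2) \<pi>(3) by (auto simp: act_letter_def o_assoc)
  moreover have "inj (?t \<circ> \<pi>)" using \<pi>(1) by (intro inj_compose) auto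
  moreover have "\<forall>x > m. (?t \<circ> \<pi>) x = x"
    using \<pi>(2) Cons.prems by (auto simp: transpose_def)
  ultimately show ?case by blast
qed

lemma elt_equiv_cancel_right:
  assumes "elt_equiv d n (u @ w) (v @ w)" "set u \<subseteq> {1..n}" "set v \<subseteq> {1..n}" "set w \<subseteq> {1..n}"
  shows "elt_equiv d n u v"
  unfolding elt_equiv_def
proof (rule pres_cong_cancel_right)
  show "pres_cong {1..n} (signed_relations d n) (pos_word u @ pos_word w) (pos_word v @ pos_word w)"
    using assms(1) by (simp add: elt_equiv_def)
qed (simp_all only: set_pos_word assms)

text \<open>
  The last run carries the value \<open>m + 1\<close> to the position at which the run ends; so the action determines the
  last run, which is then cancelled.
\<close>

lemma prefix_word_unique:
  assumes "n \<ge> 2" "d > 0"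
  shows "m \<le> n \<Longrightarrow> v \<in> prefix_words m \<Longrightarrow> w \<in> prefix_words m \<Longrightarrow> elt_equiv d n v w \<Longrightarrow> v = w"
proof (induction m arbitrary: v w)
  case (Suc m)
  let ?f = "\<lambda>x::nat. (x, 0::nat)"
  have col: "coloured d ?f" using assms by (simp add: coloured_def)
  have fact: "act d n (pos_word (u @ desc_word m j)) ?f j = (Suc m, 0)"
      and ran: "set u \<subseteq> {1..n}"
    if u: "u \<in> prefix_words m" "1 \<le> j" "j \<le> Suc m" for u j
  proof -
    obtain \<pi> where \<pi>: "\<forall>x > m. \<pi> x = x" "act d n (pos_word u) ?f = ?f \<circ> \<pi>"
      using act_prefix[OF set_prefix_word[OF u(1)], of n d ?f] Suc.prems by auto
    then show "act d n (pos_word (u @ desc_word m j)) ?f j = (Suc m, 0)"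
      using that Suc.prems(1) by (simp add: act_desc_word)
    show "set u \<subseteq> {1..n}"
      using set_prefix_word[OF that(1)] Suc.prems(1) by auto
  qed
  obtain v' j where v: "v = v' @ desc_word m j" "v' \<in> prefix_words m" "1 \<le> j" "j \<le> Suc m"
    using Suc.prems(2) unfolding prefix_words_Suc by blast
  obtain w' i where w: "w = w' @ desc_word m i" "w' \<in> prefix_words m" "1 \<le> i" "i \<le> Suc m"
    using Suc.prems(3) unfolding prefix_words_Suc by blast
  have eq: "act d n (pos_word v) ?f = act d n (pos_word w) ?f"
    using act_cong[OF assms _ col] Suc.prems(4) unfolding elt_equiv_def by blast
  obtain \<pi> where \<pi>: "inj \<pi>" "act d n (pos_word v) ?f = ?f \<circ> \<pi>"
    using act_prefix[OF set_prefix_word[OF Suc.prems(2)] Suc.prems(1)] by blast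
  have "(?f \<circ> \<pi>) j = (?f \<circ> \<pi>) i"
    using fact[OF v(2-4)] fact[OF w(2-4)] eq \<pi>(2) v(1) w(1) by metis
  then have ji: "j = i" using \<pi>(1) by (auto dest: injD)
  have "elt_equiv d n v' w'"
  proof (rule elt_equiv_cancel_right)
    show "elt_equiv d n (v' @ desc_word m j) (w' @ desc_word m j)"
      using Suc.prems(4) v(1) w(1) ji by simp
  qed (use ran v w Suc.prems(1) in auto)
  then have "v' = w'" using Suc.IH v(2) w(2) Suc.prems(1) by auto
  with v w ji show ?case by simp
qed simp

text \<open>
  The colours determine the suffix; after cancelling it, the prefixes are congruent.
\<close>

lemma canonical_unique:
  assumes "n \<ge> 2" "d > 0" "p \<in> prefix_words n" "p' \<in> prefix_words n"
    and "suffix_data d n ps" "suffix_data d n ps'"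
    and "elt_equiv d n (p @ suffix_word n ps) (p' @ suffix_word n ps')"
  shows "p = p' \<and> ps = ps'"
proof -
  let ?f = "\<lambda>x::nat. (x, 0::nat)"
  have col: "coloured d ?f" using assms by (simp add: coloured_def)
  define g where "g = act d n (pos_word (p @ suffix_word n ps)) ?f"
  have S: "(k, x) \<in> set qs \<longleftrightarrow>
      1 \<le> x \<and> x \<le> n \<and> k > 0 \<and> snd (act d n (pos_word (q @ suffix_word n qs)) ?f x) = k"
    if q: "q \<in> prefix_words n" "suffix_data d n qs" for q qs k x
  proof -
    obtain \<pi> where \<pi>: "act d n (pos_word q) ?f = ?f \<circ> \<pi>"
      using act_prefix[OF set_prefix_word[OF q(1)] order_refl] by blast
    have "\<forall>x k. 0 < x \<and> x \<le> n \<and> k > 0 \<longrightarrow>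
       ((k, x) \<in> set qs \<longleftrightarrow> snd (act d n (pos_word (suffix_word n qs)) (?f \<circ> \<pi>) x) = k)"
      using act_suffix_word[OF q(2) suffix_data_pos[OF q(2)] assms(2), of "?f \<circ> \<pi>"] assms(2)
      by (simp add: coloured_def)
    moreover have "(k, x) \<in> set qs \<Longrightarrow> 1 \<le> x \<and> x \<le> n \<and> k > 0"
      using q(2) by (fastforce simp: suffix_data_def)
    moreover have "act d n (pos_word (q @ suffix_word n qs)) ?f
        = act d n (pos_word (suffix_word n qs)) (?f \<circ> \<pi>)"
      using \<pi> by simp
    ultimately show ?thesis by (metis less_eq_Suc_le One_nat_def)
  qed
  have g': "g = act d n (pos_word (p' @ suffix_word n ps')) ?f"
    unfolding g_def using act_cong[OF assms(1,2) _ col] assms(7) unfolding elt_equiv_def by blast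
  have "set ps = set ps'"
    using S[OF assms(3,5), folded g_def] S[OF assms(4,6), folded g'] by auto
  moreover have "sorted_wrt (<) (map snd ps)" "sorted_wrt (<) (map snd ps')"
    using assms(5,6) by (auto simp: suffix_data_def)
  ultimately have ps: "ps = ps'"
    by (intro map_sorted_distinct_set_unique[of snd])
       (auto simp: strict_sorted_iff distinct_map)
  have "elt_equiv d n p p'"
  proof (rule elt_equiv_cancel_right)
    show "elt_equiv d n (p @ suffix_word n ps) (p' @ suffix_word n ps)" using assms(7) ps by simp
  qed (use set_prefix_word[OF assms(3)] set_prefix_word[OF assms(4)] set_suffix_word_over[OF assms(5)]
       in auto)
  then show ?thesis
    using prefix_word_unique[OF assms(1,2) order_refl assms(3,4)] ps by simp
qed

section \<open>Full commutativity of canonical words\<close>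

text \<open>
  The subword on the letters \<open>i\<close> and \<open>i + 1\<close>. These two letters do not commute, so it is an invariant of the
  commutation class.
\<close>

definition proj :: "nat \<Rightarrow> nat list \<Rightarrow> nat list" where
  "proj i = filter (\<lambda>x. x = i \<or> x = Suc i)"

lemma proj_Nil [simp]: "proj i [] = []"
  by (simp add: proj_def)

lemma proj_append [simp]: "proj i (u @ v) = proj i u @ proj i v"
  by (simp add: proj_def)

lemma proj_Cons: "proj i (x # v) = (if x = i \<or> x = Suc i then x # proj i v else proj i v)"
  by (simp add: proj_def)

lemma proj_replicate [simp]:
  "proj i (replicate k x) = (if x = i \<or> x = Suc i then replicate k x else [])"
  by (auto simp: proj_def)

lemma comm_step_proj: "comm_step n u v \<Longrightarrow> proj i u = proj i v"
  by (auto simp: comm_step_def proj_Cons)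

lemma comm_equiv_proj: "comm_equiv n u v \<Longrightarrow> proj i u = proj i v"
  by (induction rule: rtranclp_induct) (auto dest: comm_step_proj)

lemma braid_moves_proj: "(l, r) \<in> braid_moves n \<Longrightarrow> n \<ge> 2 \<Longrightarrow> \<exists>i. proj i l \<noteq> proj i r"
  unfolding braid_moves_def
proof (elim UnE)
  assume "n \<ge> 2" "(l, r) \<in> {(replicate a n @ [n - 1] @ replicate b n @ [n - 1],
       [n - 1] @ replicate b n @ [n - 1] @ replicate a n) | a b. 1 \<le> a \<and> 1 \<le> b}"
  then obtain a b where "l = replicate a n @ [n - 1] @ replicate b n @ [n - 1]"
      "r = [n - 1] @ replicate b n @ [n - 1] @ replicate a n" "Suc (n - 1) = n" "1 \<le> a"
    by auto
  then show ?thesis by (intro exI[of _ "n - 1"]) (cases a; simp add: proj_Cons)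
qed (auto simp: proj_Cons)

lemma braid_step_not_comm_equiv:
  assumes "braid_step n u v" "n \<ge> 2"
  shows "\<not> comm_equiv n u v"
proof -
  obtain x l r y where *: "(l, r) \<in> braid_moves n \<or> (r, l) \<in> braid_moves n"
      "u = x @ l @ y" "v = x @ r @ y"
    using assms(1) unfolding braid_step_def by blast
  then obtain i where "proj i l \<noteq> proj i r"
    using braid_moves_proj assms(2) by metis
  then have "proj i u \<noteq> proj i v" using * by simp
  then show ?thesis using comm_equiv_proj by blast
qed

text \<open>
  This is what full commutativity amounts to for canonical words.
\<close>

definition rigid :: "nat \<Rightarrow> nat list \<Rightarrow> bool" where
  "rigid n w \<longleftrightarrow> (\<forall>u v. comm_equiv n w u \<longrightarrow> \<not> braid_step n u v)"

lemma canonical_words_elt_equiv_unique: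
  assumes "n \<ge> 2" "d > 0" "v \<in> canonical_words d n" "w \<in> canonical_words d n" "elt_equiv d n v w"
  shows "v = w"
  using assms canonical_unique[OF assms(1,2)] unfolding canonical_words_def by blast

lemma reduced_word_reduces:
  assumes "n \<ge> 2" "d > 0" "w \<in> canonical_words d n" "set v \<subseteq> {1..n}" "elt_equiv d n v w"
  shows "reduces d n v w"
proof -
  obtain w' where w': "w' \<in> canonical_words d n" "reduces d n v w'"
    using reduces_to_canonical[OF assms(1,2,4)] by blast
  then have "elt_equiv d n w' w"
    using assms(5) elt_equiv_sym elt_equiv_trans unfolding reduces_def by blast
  then show ?thesis
    using canonical_words_elt_equiv_unique[OF assms(1,2) w'(1) assms(3)] w'(2) by simp
qed

text \<open>
  Every word reduces to a canonical word of the same element, and there is only one; a word that is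
  not longer must be linked to it by moves.
\<close>

lemma reduced_words_canonical:
  assumes "n \<ge> 2" "d > 0" "w \<in> canonical_words d n"
  shows "reduced_words d n (word_elt d n w) = {v. braid_equiv n w v}"
proof -
  have w: "set w \<subseteq> {1..n}" using canonical_words_over[OF assms(3)] .
  have le: "length w \<le> length v \<and> (length v \<le> length w \<longrightarrow> braid_equiv n w v)"
    if "set v \<subseteq> {1..n}" "word_elt d n v = word_elt d n w" for v
  proof -
    have "reduces d n v w"
      using that word_elt_eq_iff[OF that(1)] by (intro reduced_word_reduces[OF assms]) auto
    then show ?thesis
      using reduces_length braid_equiv_sym unfolding reduces_def by (meson not_less)
  qed
  show ?thesis
  proof (intro equalityI subsetI)
    fix v assume "v \<in> reduced_words d n (word_elt d n w)"
    then show "v \<in> {v. braid_equiv n w v}"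
      using le[of v] w by (auto simp: reduced_words_def lists_eq_set simp del: One_nat_def)
  next
    fix v assume v: "v \<in> {v. braid_equiv n w v}"
    then have "set v \<subseteq> {1..n}" "word_elt d n w = word_elt d n v" "length v = length w"
      using braid_equiv_over[of n w v] w braid_equiv_elt_equiv[OF assms(1)] word_elt_eq_iff[OF w] braid_equiv_length by blast+
    with le show "v \<in> reduced_words d n (word_elt d n w)"
      by (auto simp: reduced_words_def lists_eq_set simp del: One_nat_def)
  qed
qed

lemma fully_commutative_iff_rigid:
  assumes "n \<ge> 2" "d > 0" "w \<in> canonical_words d n"
  shows "fully_commutative d n (word_elt d n w) \<longleftrightarrow> rigid n w"
proof
  assume fc: "fully_commutative d n (word_elt d n w)"
  show "rigid n w"
    unfolding rigid_def
  proof (intro allI impI notI)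
    fix u v assume uv: "comm_equiv n w u" "braid_step n u v"
    then have "braid_equiv n w v" using comm_equiv_imp_braid_equiv braid_step_braid_equiv braid_equiv_trans by blast
    then have "comm_equiv n w v"
      using fc unfolding fully_commutative_def reduced_words_canonical[OF assms] by simp
    then have "comm_equiv n u v" using comm_equiv_sym[OF uv(1)] by (rule rtranclp_trans[rotated])
    then show False using braid_step_not_comm_equiv[OF uv(2) assms(1)] by blast
  qed
next
  assume rigid: "rigid n w"
  have "comm_equiv n w v" if "braid_equiv n w v" for v
    using that
  proof (induction rule: braid_equiv_induct)
    case (comm v u)
    then show ?case by (meson rtranclp.rtrancl_into_rtrancl)
  next
    case (braid v u)
    then show ?case using rigid unfolding rigid_def by blast
  qed simp
  then show "fully_commutative d n (word_elt d n w)"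
    unfolding fully_commutative_def reduced_words_canonical[OF assms]
    using comm_equiv_sym by (simp, meson rtranclp_trans)
qed

section \<open>The subgroup \<open>G(d,r,n)\<close>\<close>

text \<open>
  The exponent sum of \<open>s\<^sub>n\<close>. Modulo \<open>r\<close> it is a homomorphism, since \<open>r\<close> divides \<open>d\<close>.
\<close>

definition exponent_of :: "nat \<Rightarrow> nat signed_word \<Rightarrow> int" where
  "exponent_of n u = (\<Sum>(x, b) \<leftarrow> u. if x = n then if b then 1 else -1 else 0)"

lemma exponent_of_Nil [simp]: "exponent_of n [] = 0"
  by (simp add: exponent_of_def)

lemma exponent_of_append [simp]: "exponent_of n (u @ v) = exponent_of n u + exponent_of n v"
  by (simp add: exponent_of_def)

lemma exponent_of_pos_word [simp]: "exponent_of n (pos_word w) = int (count_list w n)"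
  by (induction w) (auto simp: exponent_of_def)

lemma exponent_of_inv_word [simp]: "exponent_of n (inv_word u) = - exponent_of n u"
  by (induction u) (auto simp: exponent_of_def inv_word_def)

lemma count_list_replicate: "count_list (replicate k x) y = (if x = y then k else 0)"
  by (induction k) auto

lemma exponent_of_cong:
  assumes "pres_cong {1..n} (signed_relations d n) u v" "r dvd d"
  shows "int r dvd exponent_of n u - exponent_of n v"
  using assms(1)
proof (induction rule: pres_cong.induct)
  case (sym u v)
  then show ?case using dvd_diff_commute by blast
next
  case (trans u v w)
  from dvd_add[OF trans.IH] show ?case by simp
next
  case (append u u' v v')
  from dvd_add[OF append.IH] show ?case by (simp add: algebra_simps)
next
  case (cancel x b)
  then show ?case by (simp add: exponent_of_def)
next
  case (rel u v)
  then obtain a b where ab: "(a, b) \<in> refl_relations d n" "u = pos_word a" "v = pos_word b"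
    by (auto simp: signed_relations_def)
  then have "int r dvd int (count_list a n) - int (count_list b n)"
    using assms(2) by (auto simp: refl_relations_def count_list_replicate)
  with ab show ?case by simp
qed simp

text \<open>
  Put \<open>S\<^sub>k = T\<^sup>-\<^sup>k S T\<^sup>k\<close>. The braid relation gives \<open>S\<^sub>2 = S\<^sub>1 S\<^sub>0 S\<^sub>1\<close>, and conjugating by powers of \<open>T\<close> gives
  \<open>S\<^sub>k\<^sub>+\<^sub>2 = S\<^sub>k\<^sub>+\<^sub>1 S\<^sub>k S\<^sub>k\<^sub>+\<^sub>1\<close>.
\<close>

lemma (in group) conj_power_mem:
  assumes H: "subgroup H G" and S: "S \<in> carrier G" and T: "T \<in> carrier G"
    and SH: "S \<in> H" and A: "inv T \<otimes> S \<otimes> T \<in> H"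
    and SS: "S \<otimes> S = \<one>" and braid: "T \<otimes> S \<otimes> T \<otimes> S = S \<otimes> T \<otimes> S \<otimes> T"
  shows "inv (T [^] (k::nat)) \<otimes> S \<otimes> T [^] k \<in> H"
proof -
  define cj where "cj a x = inv a \<otimes> x \<otimes> a" for a x
  have [simp]: "a \<otimes> (inv a \<otimes> y) = y" "inv a \<otimes> (a \<otimes> y) = y"
    if "a \<in> carrier G" "y \<in> carrier G" for a y
    using that by (simp_all flip: m_assoc)
  have cj_closed [simp]: "cj a x \<in> carrier G" if "a \<in> carrier G" "x \<in> carrier G" for a x
    using that by (simp add: cj_def)
  have cj_mult: "cj a (x \<otimes> y) = cj a x \<otimes> cj a y"
    if "a \<in> carrier G" "x \<in> carrier G" "y \<in> carrier G" for a x y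
    using that by (simp add: cj_def m_assoc)
  have cj_cj: "cj a (cj b x) = cj (b \<otimes> a) x"
    if "a \<in> carrier G" "b \<in> carrier G" "x \<in> carrier G" for a b x
    using that by (simp add: cj_def m_assoc inv_mult_group)
  have "T \<otimes> (S \<otimes> T \<otimes> S) = (S \<otimes> T \<otimes> S) \<otimes> T"
    using braid S T by (simp add: m_assoc)
  then have "inv T \<otimes> (T \<otimes> (S \<otimes> T \<otimes> S)) \<otimes> inv T = inv T \<otimes> ((S \<otimes> T \<otimes> S) \<otimes> T) \<otimes> inv T"
    by simp
  then have comm: "(S \<otimes> T \<otimes> S) \<otimes> inv T = inv T \<otimes> (S \<otimes> T \<otimes> S)"
    using S T by (simp add: m_assoc)
  \<comment> \<open>The identity \<open>S\<^sub>1 S\<^sub>0 S\<^sub>1 = S\<^sub>2\<close>, using that \<open>T\<close> commutes with \<open>S T S\<close>.\<close>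
  have "cj T S \<otimes> S \<otimes> cj T S = inv T \<otimes> ((S \<otimes> T \<otimes> S) \<otimes> inv T) \<otimes> (S \<otimes> T)"
    using S T by (simp add: cj_def m_assoc)
  also have "\<dots> = inv T \<otimes> (inv T \<otimes> (S \<otimes> (T \<otimes> ((S \<otimes> S) \<otimes> T))))"
    unfolding comm using S T by (simp add: m_assoc)
  also have "\<dots> = cj T (cj T S)"
    unfolding SS using S T by (simp add: cj_def m_assoc)
  finally have base: "cj T (cj T S) = cj T S \<otimes> S \<otimes> cj T S" ..
  have step: "cj (T [^] Suc (Suc k)) S
      = cj (T [^] Suc k) S \<otimes> cj (T [^] k) S \<otimes> cj (T [^] Suc k) S" for k :: nat
  proof -
    have s: "cj (T [^] Suc k) x = cj (T [^] k) (cj T x)" if "x \<in> carrier G" for k x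
      unfolding nat_pow_Suc2[OF T] using that T by (simp add: cj_cj)
    have "cj (T [^] Suc (Suc k)) S = cj (T [^] k) (cj T (cj T S))"
      using S T by (simp only: s cj_closed)
    then show ?thesis using S T by (simp only: base cj_mult s cj_closed m_closed nat_pow_closed)
  qed
  have "cj (T [^] k) S \<in> H \<and> cj (T [^] Suc k) S \<in> H"
  proof (induction k)
    case 0
    then show ?case using S T SH A by (simp add: cj_def)
  next
    case (Suc k)
    then show ?case using subgroup.m_closed[OF H] by (simp only: step)
  qed
  then show ?thesis by (simp add: cj_def)
qed

lemma word_elt_power:
  assumes "n \<ge> 2"
  shows "word_elt d n [n] [^]\<^bsub>Gd1 d n\<^esub> k = word_elt d n (replicate k n)"
proof -
  interpret G: group "Gd1 d n" using assms by (rule group_Gd1)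
  show ?thesis
  proof (induction k)
    case 0
    then show ?case by (simp add: word_elt_Nil)
  next
    case (Suc k)
    have "set (replicate k n) \<subseteq> {1..n}" "set [n] \<subseteq> {1..n}" using assms by auto
    with Suc show ?case
      by (simp add: word_elt_mult[OF assms] replicate_append_same)
  qed
qed

definition Gdr_generators :: "nat \<Rightarrow> nat \<Rightarrow> nat \<Rightarrow> nat list set" where
  "Gdr_generators d r n = {[i] | i. 1 \<le> i \<and> i < n} \<union> {replicate (d - 1) n @ [n - 1, n], replicate r n}"

lemma Gdr_eq_generate: "Gdr d r n = generate (Gd1 d n) (word_elt d n ` Gdr_generators d r n)"
  by (simp add: Gdr_def Gdr_generators_def)

lemma Gdr_generators_over: "n \<ge> 2 \<Longrightarrow> w \<in> Gdr_generators d r n \<Longrightarrow> set w \<subseteq> {1..n}"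
  by (auto simp: Gdr_generators_def)

lemma subgroup_Gdr: "n \<ge> 2 \<Longrightarrow> subgroup (Gdr d r n) (Gd1 d n)"
  unfolding Gdr_eq_generate
  using Gdr_generators_over word_elt_carrier
  by (intro group.generate_is_subgroup[OF group_Gd1]) blast+

lemma Gdr_exponent:
  assumes "n \<ge> 2" "d > 0" "r dvd d" "g \<in> Gdr d r n"
  shows "\<exists>u. set u \<subseteq> {1..n} \<times> UNIV \<and> g = pres_class {1..n} (signed_relations d n) u
    \<and> int r dvd exponent_of n u"
proof -
  interpret G: group "Gd1 d n" using assms(1) by (rule group_Gd1)
  let ?cls = "pres_class {1..n} (signed_relations d n)"
  have mult: "?cls u \<otimes>\<^bsub>Gd1 d n\<^esub> ?cls v = ?cls (u @ v)"
    if "set u \<subseteq> {1..n} \<times> UNIV" "set v \<subseteq> {1..n} \<times> UNIV" for u v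
    unfolding Gd1_def using relators_over_signed[OF assms(1)] that by (rule presented_group_mult)
  have gen: "set (pos_word w) \<subseteq> {1..n} \<times> UNIV \<and> int r dvd exponent_of n (pos_word w)"
    if "w \<in> Gdr_generators d r n" for w
    using that assms Gdr_generators_over[OF assms(1) that]
    by (auto simp: set_pos_word Gdr_generators_def count_list_replicate simp del: One_nat_def)
  have inverse: "inv\<^bsub>Gd1 d n\<^esub> (?cls u) = ?cls (inv_word u)" if u: "set u \<subseteq> {1..n} \<times> UNIV" for u
  proof (rule G.inv_equality)
    show "?cls (inv_word u) \<otimes>\<^bsub>Gd1 d n\<^esub> ?cls u = \<one>\<^bsub>Gd1 d n\<^esub>"
      unfolding mult[OF set_inv_word[OF u] u] unfolding Gd1_def presented_group_one
      using u set_inv_word[OF u] pres_cong_inv_left[OF u] by (subst pres_class_eq_iff) auto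
  qed (use u set_inv_word[OF u] in \<open>auto simp: Gd1_def presented_group_carrier\<close>)
  show ?thesis
    using assms(4) unfolding Gdr_eq_generate
  proof (induction rule: generate.induct)
    case one
    show ?case by (intro exI[of _ "[]"]) (simp add: Gd1_def presented_group_one)
  next
    case (incl h)
    then show ?case using gen unfolding word_elt_def by blast
  next
    case (inv h)
    then obtain w where w: "w \<in> Gdr_generators d r n" "h = ?cls (pos_word w)"
      unfolding word_elt_def by blast
    note g = gen[OF w(1)]
    have "inv\<^bsub>Gd1 d n\<^esub> h = ?cls (inv_word (pos_word w))"
      unfolding w(2) by (rule inverse) (use g in blast)
    with g show ?case
      by (intro exI[of _ "inv_word (pos_word w)"]) (auto simp: set_inv_word simp del: One_nat_def)
  next
    case (eng h1 h2)
    then obtain u v where "set u \<subseteq> {1..n} \<times> UNIV" "h1 = ?cls u" "int r dvd exponent_of n u"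
        "set v \<subseteq> {1..n} \<times> UNIV" "h2 = ?cls v" "int r dvd exponent_of n v"
      by blast
    then show ?case by (intro exI[of _ "u @ v"]) (simp add: mult del: One_nat_def)
  qed
qed

text \<open>
  For \<open>i = n - 1\<close> the generator \<open>s\<^sub>n\<^sup>d\<^sup>-\<^sup>1 s\<^sub>n\<^sub>-\<^sub>1 s\<^sub>n\<close> starts the recursion for the conjugates; the other letters
  commute with \<open>s\<^sub>n\<close>.
\<close>

lemma conj_letter_mem_Gdr:
  assumes "n \<ge> 2" "d > 0" "1 \<le> i" "i < n"
  defines "T \<equiv> word_elt d n [n]"
  shows "inv\<^bsub>Gd1 d n\<^esub> (T [^]\<^bsub>Gd1 d n\<^esub> k) \<otimes>\<^bsub>Gd1 d n\<^esub> word_elt d n [i]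
    \<otimes>\<^bsub>Gd1 d n\<^esub> T [^]\<^bsub>Gd1 d n\<^esub> (k::nat) \<in> Gdr d r n"
proof -
  interpret G: group "Gd1 d n" using assms(1) by (rule group_Gd1)
  note mult = word_elt_mult[OF assms(1)]
  let ?S = "word_elt d n [i]"
  have S: "?S \<in> carrier (Gd1 d n)" and T: "T \<in> carrier (Gd1 d n)"
    unfolding T_def using assms by (auto intro!: word_elt_carrier)
  have SH: "?S \<in> Gdr d r n"
    unfolding Gdr_eq_generate using assms by (intro generate.incl) (auto simp: Gdr_generators_def)
  have over: "set [i] \<subseteq> {1..n}" "set [n] \<subseteq> {1..n}" "set [n - 1] \<subseteq> {1..n}"
      "set (replicate k n) \<subseteq> {1..n}" for k
    using assms by auto
  show ?thesis
  proof (cases "i = n - 1")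
    case True
    have ss: "?S \<otimes>\<^bsub>Gd1 d n\<^esub> ?S = \<one>\<^bsub>Gd1 d n\<^esub>"
    proof -
      have "elt_equiv d n [i, i] []"
        using assms by (intro elt_equiv_rel) (auto simp: refl_relations_def)
      then have "word_elt d n [i, i] = word_elt d n []"
        using over(1) by (subst word_elt_eq_iff) auto
      then show ?thesis using over(1) by (simp add: mult word_elt_Nil)
    qed
    have braid: "T \<otimes>\<^bsub>Gd1 d n\<^esub> ?S \<otimes>\<^bsub>Gd1 d n\<^esub> T \<otimes>\<^bsub>Gd1 d n\<^esub> ?S
        = ?S \<otimes>\<^bsub>Gd1 d n\<^esub> T \<otimes>\<^bsub>Gd1 d n\<^esub> ?S \<otimes>\<^bsub>Gd1 d n\<^esub> T"
    proof -
      have "elt_equiv d n [n, i, n, i] [i, n, i, n]"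
        unfolding True by (intro elt_equiv_rel) (auto simp: refl_relations_def)
      then have "word_elt d n [n, i, n, i] = word_elt d n [i, n, i, n]"
        using over(1,2) by (subst word_elt_eq_iff) auto
      then show ?thesis unfolding T_def using over(1,2) by (simp add: mult)
    qed
    have "word_elt d n (replicate (d - 1) n) = inv\<^bsub>Gd1 d n\<^esub> T"
    proof (rule G.inv_equality[symmetric])
      have "replicate (d - 1) n @ [n] = replicate d n"
        using assms(2) by (metis Suc_diff_1 replicate_Suc replicate_append_same)
      moreover have "elt_equiv d n (replicate d n) []"
        by (intro elt_equiv_rel) (auto simp: refl_relations_def)
      then have "word_elt d n (replicate d n) = word_elt d n []"
        using over(4) by (subst word_elt_eq_iff) auto
      ultimately show "word_elt d n (replicate (d - 1) n) \<otimes>\<^bsub>Gd1 d n\<^esub> T = \<one>\<^bsub>Gd1 d n\<^esub>"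
        unfolding T_def mult[OF over(4,2)] by (simp add: word_elt_Nil)
    qed (use T word_elt_carrier over(4) in auto)
    moreover have "word_elt d n (replicate (d - 1) n @ [n - 1, n]) \<in> Gdr d r n"
      unfolding Gdr_eq_generate by (intro generate.incl) (auto simp: Gdr_generators_def)
    moreover have "word_elt d n (replicate (d - 1) n @ [n - 1, n])
        = word_elt d n (replicate (d - 1) n) \<otimes>\<^bsub>Gd1 d n\<^esub> ?S \<otimes>\<^bsub>Gd1 d n\<^esub> T"
      unfolding T_def True using over(2,3) over(4)[of "d - 1"] by (simp add: mult)
    ultimately have "inv\<^bsub>Gd1 d n\<^esub> T \<otimes>\<^bsub>Gd1 d n\<^esub> ?S \<otimes>\<^bsub>Gd1 d n\<^esub> T \<in> Gdr d r n" by simp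
    then show ?thesis
      by (intro G.conj_power_mem[OF subgroup_Gdr[OF assms(1)] S T SH _ ss braid])
  next
    case False
    have "word_elt d n ([i] @ replicate k n) = word_elt d n (replicate k n @ [i])"
    proof -
      have "comm_equiv n (replicate k n @ [i]) ([i] @ replicate k n)"
        using assms False by (intro comm_equiv_past) auto
      then have "elt_equiv d n (replicate k n @ [i]) ([i] @ replicate k n)"
        using over(1,4) by (intro braid_equiv_elt_equiv[OF assms(1)] comm_equiv_imp_braid_equiv) auto
      then show ?thesis using over(1,4) by (subst eq_commute, subst word_elt_eq_iff) auto
    qed
    then have "?S \<otimes>\<^bsub>Gd1 d n\<^esub> T [^]\<^bsub>Gd1 d n\<^esub> k = T [^]\<^bsub>Gd1 d n\<^esub> k \<otimes>\<^bsub>Gd1 d n\<^esub> ?S"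
      unfolding T_def using over(1,4) by (simp add: word_elt_power[OF assms(1)] mult)
    then have "inv\<^bsub>Gd1 d n\<^esub> (T [^]\<^bsub>Gd1 d n\<^esub> k) \<otimes>\<^bsub>Gd1 d n\<^esub> ?S \<otimes>\<^bsub>Gd1 d n\<^esub> T [^]\<^bsub>Gd1 d n\<^esub> k = ?S"
      using S T by (simp add: G.m_assoc) (simp flip: G.m_assoc)
    then show ?thesis using SH by simp
  qed
qed

text \<open>
  All conjugates \<open>t\<^sup>-\<^sup>k s\<^sub>i t\<^sup>k\<close> with \<open>i < n\<close> lie in the subgroup. So the letters \<open>t = s\<^sub>n\<close> of a word can be
  collected in front modulo the subgroup, and the resulting power of \<open>t\<close> lies in it when its exponent is a
  multiple of \<open>r\<close>.
\<close>

lemma word_elt_mem_Gdr: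
  assumes "n \<ge> 2" "d > 0" "r dvd d" "set w \<subseteq> {1..n}"
  shows "word_elt d n w \<in> Gdr d r n \<longleftrightarrow> r dvd count_list w n"
proof
  assume "word_elt d n w \<in> Gdr d r n"
  then obtain u where u: "word_elt d n w = pres_class {1..n} (signed_relations d n) u"
      "int r dvd exponent_of n u"
    using Gdr_exponent[OF assms(1-3)] by blast
  then have "pres_cong {1..n} (signed_relations d n) (pos_word w) u"
    unfolding word_elt_def using assms(4) by (subst (asm) pres_class_eq_iff) (auto simp: set_pos_word)
  then have "int r dvd exponent_of n (pos_word w) - exponent_of n u"
    using assms(3) by (rule exponent_of_cong)
  from dvd_add[OF this u(2)] show "r dvd count_list w n" by simp
next
  assume r: "r dvd count_list w n"
  interpret G: group "Gd1 d n" using assms(1) by (rule group_Gd1)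
  interpret H: subgroup "Gdr d r n" "Gd1 d n" using assms(1) by (rule subgroup_Gdr)
  note mult = word_elt_mult[OF assms(1)]
  define T where "T = word_elt d n [n]"
  define P where "P k = T [^]\<^bsub>Gd1 d n\<^esub> k" for k :: nat
  have T: "T \<in> carrier (Gd1 d n)"
    unfolding T_def using assms(1) by (auto intro!: word_elt_carrier)
  have P [simp]: "P k \<in> carrier (Gd1 d n)" for k
    unfolding P_def using T by simp
  have P0: "P 0 = \<one>\<^bsub>Gd1 d n\<^esub>"
    by (simp add: P_def)
  have cancel: "P k \<otimes>\<^bsub>Gd1 d n\<^esub> (inv\<^bsub>Gd1 d n\<^esub> (P k) \<otimes>\<^bsub>Gd1 d n\<^esub> y) = y"
    if "y \<in> carrier (Gd1 d n)" for k y
    using that by (simp flip: G.m_assoc)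
  have "inv\<^bsub>Gd1 d n\<^esub> (P (k + count_list w n)) \<otimes>\<^bsub>Gd1 d n\<^esub> word_elt d n w \<otimes>\<^bsub>Gd1 d n\<^esub> P k \<in> Gdr d r n" for k
    using assms(4)
  proof (induction w)
    case Nil
    then show ?case by (simp add: word_elt_Nil)
  next
    case (Cons i w)
    have i: "set [i] \<subseteq> {1..n}" "set w \<subseteq> {1..n}" using Cons.prems by auto
    let ?S = "word_elt d n [i]" and ?W = "word_elt d n w"
    have c: "?S \<in> carrier (Gd1 d n)" "?W \<in> carrier (Gd1 d n)"
      using i by (auto intro!: word_elt_carrier)
    have W: "word_elt d n (i # w) = ?S \<otimes>\<^bsub>Gd1 d n\<^esub> ?W"
      using mult[OF i] by simp
    have IH: "inv\<^bsub>Gd1 d n\<^esub> (P (k + count_list w n)) \<otimes>\<^bsub>Gd1 d n\<^esub> ?W \<otimes>\<^bsub>Gd1 d n\<^esub> P k \<in> Gdr d r n"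
      using Cons by simp
    show ?case
    proof (cases "i = n")
      case True
      have "P (k + count_list (i # w) n) = T \<otimes>\<^bsub>Gd1 d n\<^esub> P (k + count_list w n)"
        using True G.nat_pow_Suc2[OF T, of "k + count_list w n"] unfolding P_def by simp
      moreover have "inv\<^bsub>Gd1 d n\<^esub> T \<otimes>\<^bsub>Gd1 d n\<^esub> (T \<otimes>\<^bsub>Gd1 d n\<^esub> ?W) = ?W"
        using T c by (simp flip: G.m_assoc)
      moreover have "word_elt d n (i # w) = T \<otimes>\<^bsub>Gd1 d n\<^esub> ?W"
        using W True by (simp add: T_def)
      ultimately have "inv\<^bsub>Gd1 d n\<^esub> (P (k + count_list (i # w) n)) \<otimes>\<^bsub>Gd1 d n\<^esub> word_elt d n (i # w)
          = inv\<^bsub>Gd1 d n\<^esub> (P (k + count_list w n)) \<otimes>\<^bsub>Gd1 d n\<^esub> ?W"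
        using T c by (simp add: G.inv_mult_group G.m_assoc)
      then show ?thesis using IH by simp
    next
      case False
      let ?Q = "P (k + count_list w n)"
      have "inv\<^bsub>Gd1 d n\<^esub> ?Q \<otimes>\<^bsub>Gd1 d n\<^esub> ?S \<otimes>\<^bsub>Gd1 d n\<^esub> ?Q \<in> Gdr d r n"
        unfolding P_def T_def using i False assms(1,2) by (intro conj_letter_mem_Gdr) auto
      from H.m_closed[OF this IH]
      have "inv\<^bsub>Gd1 d n\<^esub> ?Q \<otimes>\<^bsub>Gd1 d n\<^esub> word_elt d n (i # w) \<otimes>\<^bsub>Gd1 d n\<^esub> P k \<in> Gdr d r n"
        unfolding W using c by (simp add: G.m_assoc cancel)
      then show ?thesis using False by simp
    qed
  qed
  from this[of 0] have 1: "inv\<^bsub>Gd1 d n\<^esub> (P (count_list w n)) \<otimes>\<^bsub>Gd1 d n\<^esub> word_elt d n w \<in> Gdr d r n"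
    using word_elt_carrier[OF assms(4), of d] P0 by simp
  have "P r = word_elt d n (replicate r n)"
    unfolding P_def T_def by (rule word_elt_power[OF assms(1)])
  then have Pr: "P r \<in> Gdr d r n"
    unfolding Gdr_eq_generate by (auto intro!: generate.incl simp: Gdr_generators_def)
  have "P (r * q) \<in> Gdr d r n" for q
  proof (induction q)
    case 0
    then show ?case by (simp add: P_def)
  next
    case (Suc q)
    have "P (r * Suc q) = P r \<otimes>\<^bsub>Gd1 d n\<^esub> P (r * q)"
      unfolding P_def using T by (simp add: G.nat_pow_mult)
    then show ?case using H.m_closed[OF Pr Suc] by simp
  qed
  then have 2: "P (count_list w n) \<in> Gdr d r n"
    using r by (auto simp: dvd_def)
  show "word_elt d n w \<in> Gdr d r n"
    using H.m_closed[OF 2 1] cancel[OF word_elt_carrier[OF assms(4)]] by simp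
qed

section \<open>Fully commutative prefixes\<close>

text \<open>
  Prefixes of the symmetric group on \<open>m\<close> points whose nonempty runs have strictly increasing
  last letters, all at most \<open>k\<close>. For \<open>k \<ge> m - 1\<close> the bound \<open>k\<close> is vacuous; these are all the fully
  commutative prefixes.
\<close>

fun fc_prefixes :: "nat \<Rightarrow> nat \<Rightarrow> nat list set" where
  "fc_prefixes 0 k = {[]}"
| "fc_prefixes (Suc m) k = fc_prefixes m k \<union> {w @ desc_word m j | w j. 1 \<le> j \<and> j \<le> min k m \<and> w \<in> fc_prefixes m (j - 1)}"

text \<open>
  The prefixes of \<open>fc_prefixes m (j - 1)\<close>, together with those obtained from some
  \<open>fc_prefixes x (j - 1)\<close> with \<open>j \<le> x < m\<close> by appending the letters \<open>x, x + 1, \<dots>, m - 1\<close>.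
\<close>

fun one_block_prefixes :: "nat \<Rightarrow> nat \<Rightarrow> nat list set" where
  "one_block_prefixes 0 j = {[]}"
| "one_block_prefixes (Suc m) j = fc_prefixes (Suc m) (j - 1) \<union> (if j \<le> m then (\<lambda>w. w @ [m]) ` one_block_prefixes m j else {})"

text \<open>
  The prefixes that make a fully commutative word with the given suffix.
\<close>

fun good_prefixes :: "nat \<Rightarrow> (nat \<times> nat) list \<Rightarrow> nat list set" where
  "good_prefixes n [] = fc_prefixes n n"
| "good_prefixes n [(t, j)] = one_block_prefixes n j"
| "good_prefixes n ((t, j) # _ # _) = fc_prefixes n (j - 1)"

lemma suffix_cases:
  obtains "ps = []" | t j where "ps = [(t, j)]" | t j u l qs where "ps = (t, j) # (u, l) # qs"
  by (metis list.exhaust surj_pair)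

lemma Nil_in_fc_prefixes [simp]: "[] \<in> fc_prefixes m k"
  by (induction m) auto

lemma prefix_words_mono_Suc: "w \<in> prefix_words m \<Longrightarrow> w \<in> prefix_words (Suc m)"
  using prefix_words_snocI[of w m "Suc m"] by simp

lemma fc_prefixes_prefix_words: "w \<in> fc_prefixes m k \<Longrightarrow> w \<in> prefix_words m"
proof (induction m arbitrary: w k)
  case (Suc m)
  from Suc.prems consider "w \<in> fc_prefixes m k"
    | v j where "w = v @ desc_word m j" "1 \<le> j" "j \<le> m" "v \<in> fc_prefixes m (j - 1)"
    by auto
  then show ?case
    using Suc.IH prefix_words_mono_Suc prefix_words_snocI by cases (blast, force)
qed simp

lemma set_fc_prefixes: "w \<in> fc_prefixes m k \<Longrightarrow> set w \<subseteq> {1..<m}"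
  using fc_prefixes_prefix_words set_prefix_word by blast

lemma fc_prefixes_mono: "k \<le> l \<Longrightarrow> fc_prefixes m k \<subseteq> fc_prefixes m l"
  by (induction m) (auto, use le_trans in blast)

lemma fc_prefixes_stable: "m \<le> Suc k \<Longrightarrow> fc_prefixes m k = fc_prefixes m m"
proof (induction m arbitrary: k)
  case (Suc m)
  have "fc_prefixes m k = fc_prefixes m m" "fc_prefixes m (Suc m) = fc_prefixes m m"
    using Suc.IH[of k] Suc.IH[of "Suc m"] Suc.prems by auto
  moreover have "min k m = min (Suc m) m" using Suc.prems by simp
  ultimately show ?case unfolding fc_prefixes.simps by simp
qed simp

lemma last_desc_word: "j \<le> M \<Longrightarrow> last (desc_word M j) = j"
  by (simp add: desc_word_snoc)

lemma desc_word_nonempty: "j \<le> M \<Longrightarrow> desc_word M j \<noteq> []"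
  by (simp add: desc_word_snoc)

lemma last_fc_prefixes: "w \<in> fc_prefixes m k \<Longrightarrow> w \<noteq> [] \<Longrightarrow> last w \<le> k"
proof (induction m)
  case (Suc m)
  then show ?case by (auto simp: last_desc_word desc_word_nonempty)
qed simp

lemma fc_prefixes_of_last:
  "w \<in> fc_prefixes m l \<Longrightarrow> w = [] \<or> last w \<le> k \<Longrightarrow> w \<in> fc_prefixes m k"
  by (induction m) (auto simp: last_desc_word desc_word_nonempty)

lemma one_block_prefixes_subset:
  assumes "1 \<le> j"
  shows "w \<in> one_block_prefixes m j \<Longrightarrow> w \<in> fc_prefixes m m"
proof (induction m arbitrary: w)
  case (Suc m)
  show ?case
  proof (cases "w \<in> fc_prefixes (Suc m) (j - 1)")
    case True
    have "w \<noteq> [] \<Longrightarrow> last w \<le> Suc m"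
      using set_fc_prefixes[OF True] last_in_set[of w] by fastforce
    then show ?thesis using fc_prefixes_of_last[OF True] by blast
  next
    case False
    then obtain v where v: "w = v @ [m]" "j \<le> m" "v \<in> one_block_prefixes m j"
      using Suc.prems by (auto split: if_splits)
    then have "v \<in> fc_prefixes m (m - 1)"
      using Suc.IH[of v] fc_prefixes_stable[of m "m - 1"] by simp
    moreover have "desc_word m m = [m]" by (simp add: desc_word_snoc)
    ultimately show ?thesis using v(1,2) assms
      by (simp, intro disjI2 exI[of _ v] exI[of _ m]) auto
  qed
qed simp

lemma one_block_prefixes_cases:
  assumes "w \<in> one_block_prefixes m j" "1 \<le> j" "j \<le> m"
  obtains "w \<in> fc_prefixes m (j - 1)"
    | x v where "j \<le> x" "x < m" "v \<in> fc_prefixes x (j - 1)" "w = v @ [x..<m]"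
proof -
  have "w \<in> fc_prefixes m (j - 1) \<or> (\<exists>x v. j \<le> x \<and> x < m \<and> v \<in> fc_prefixes x (j - 1) \<and> w = v @ [x..<m])"
    using assms(1,3)
  proof (induction m arbitrary: w)
    case (Suc m)
    show ?case
    proof (cases "w \<in> fc_prefixes (Suc m) (j - 1)")
      case False
      then obtain v where v: "w = v @ [m]" "j \<le> m" "v \<in> one_block_prefixes m j"
        using Suc.prems by (auto split: if_splits)
      from Suc.IH[OF v(3,2)] show ?thesis
      proof
        assume "v \<in> fc_prefixes m (j - 1)"
        then show ?thesis using v by (intro disjI2 exI[of _ m] exI[of _ v]) auto
      next
        assume "\<exists>x v'. j \<le> x \<and> x < m \<and> v' \<in> fc_prefixes x (j - 1) \<and> v = v' @ [x..<m]"
        then obtain x v' where "j \<le> x" "x < m" "v' \<in> fc_prefixes x (j - 1)" "v = v' @ [x..<m]" by blast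
        then show ?thesis using v by (intro disjI2 exI[of _ x] exI[of _ v']) auto
      qed
    qed simp
  qed (use assms(2) in simp)
  then show ?thesis using that by blast
qed

lemma not_rigid_braid: "braid_step n w v \<Longrightarrow> \<not> rigid n w"
  unfolding rigid_def by blast

lemma not_rigid_comm_equiv: "comm_equiv n w u \<Longrightarrow> \<not> rigid n u \<Longrightarrow> \<not> rigid n w"
  unfolding rigid_def by (meson rtranclp_trans)

lemma not_rigid_context: "\<not> rigid n w \<Longrightarrow> \<not> rigid n (x @ w @ y)"
  unfolding rigid_def using comm_equiv_context braid_step_context by blast

text \<open>
  The letter \<open>i\<close> slides right until the factor \<open>i, i + 1, i\<close> appears.
\<close>

lemma not_rigid_desc_word:
  assumes "1 \<le> j" "j \<le> i" "i < M" "M < n"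
  shows "\<not> rigid n ([i] @ desc_word M j)"
proof -
  let ?A = "desc_word M (Suc (Suc i))" and ?B = "desc_word (i - 1) j"
  have D: "desc_word M j = ?A @ [Suc i, i] @ ?B"
    using assms desc_word_split[of j "Suc i" M] desc_word_Cons[of j i] desc_word_Cons[of j "i - 1"]
    by simp
  have "comm_equiv n ([] @ ([i] @ ?A) @ [Suc i, i] @ ?B) ([] @ (?A @ [i]) @ [Suc i, i] @ ?B)"
    using assms by (intro comm_equiv_context comm_equiv_sym[OF comm_equiv_past]) auto
  then have "comm_equiv n ([i] @ desc_word M j) (?A @ [i, Suc i, i] @ ?B)"
    unfolding D by simp
  moreover have "\<not> rigid n [i, Suc i, i]"
    by (rule not_rigid_braid[OF braid_moves_step[OF braid3_move]]) (use assms in auto)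
  ultimately show ?thesis using not_rigid_comm_equiv not_rigid_context by blast
qed

lemma not_rigid_suffix_block:
  assumes "1 \<le> j" "j \<le> i" "Suc i < n"
  shows "\<not> rigid n ([i] @ suffix_block n t j)"
proof -
  have "comm_equiv n ([] @ ([i] @ replicate t n) @ desc_word (n - 1) j)
      ([] @ (replicate t n @ [i]) @ desc_word (n - 1) j)"
    using assms by (intro comm_equiv_context comm_equiv_sym[OF comm_equiv_past]) auto
  then have "comm_equiv n ([i] @ suffix_block n t j) (replicate t n @ ([i] @ desc_word (n - 1) j) @ [])"
    by (simp add: suffix_block_def)
  moreover have "\<not> rigid n ([i] @ desc_word (n - 1) j)"
    using assms by (intro not_rigid_desc_word) auto
  ultimately show ?thesis using not_rigid_comm_equiv not_rigid_context by blast
qed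

text \<open>
  If the prefix ends in \<open>n - 1\<close>, then \<open>s\<^sub>n\<^sub>-\<^sub>1\<close> meets the first block as \<open>s\<^sub>n\<^sub>-\<^sub>1 s\<^sub>n\<^sup>t s\<^sub>n\<^sub>-\<^sub>1\<close>, which is harmless; the power of
  \<open>s\<^sub>n\<close> in the second block, which can be moved next to it, makes it one side of a braid move.
\<close>

lemma not_rigid_two_blocks:
  assumes "1 \<le> j" "j < n" "1 \<le> t" "1 \<le> u"
  shows "\<not> rigid n ([n - 1] @ suffix_block n t j @ replicate u n)"
proof -
  let ?D = "desc_word (n - 1 - 1) j"
  have D: "desc_word (n - 1) j = [n - 1] @ ?D"
    using assms desc_word_Cons'[of j "n - 1"] by simp
  have "comm_equiv n (([n - 1] @ replicate t n @ [n - 1]) @ (?D @ replicate u n) @ [])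
      (([n - 1] @ replicate t n @ [n - 1]) @ (replicate u n @ ?D) @ [])"
    using assms by (intro comm_equiv_context comm_equiv_past_word) auto
  then have "comm_equiv n ([n - 1] @ suffix_block n t j @ replicate u n)
      ([] @ ([n - 1] @ replicate t n @ [n - 1] @ replicate u n) @ ?D)"
    by (simp add: suffix_block_def D del: One_nat_def)
  moreover have "\<not> rigid n ([n - 1] @ replicate t n @ [n - 1] @ replicate u n)"
    by (rule not_rigid_braid[OF braid_step_sym[OF braid_moves_step[OF braid4_move[OF assms(4,3)]]]])
  ultimately show ?thesis using not_rigid_comm_equiv not_rigid_context by blast
qed

text \<open>
  If a run ends at or below the end \<open>i\<close> of the nonempty run before it, then it starts above \<open>i\<close> and contains
  \<open>i + 1, i\<close>, so it forms a braid with that end.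
\<close>

lemma not_rigid_prefix:
  "w \<in> prefix_words m \<Longrightarrow> m \<le> n \<Longrightarrow> w \<notin> fc_prefixes m m \<Longrightarrow> \<not> rigid n w"
proof (induction m arbitrary: w)
  case (Suc m)
  then obtain v j where w: "w = v @ desc_word m j" "v \<in> prefix_words m" "1 \<le> j" "j \<le> Suc m"
    unfolding prefix_words_Suc by blast
  show ?case
  proof (cases "v \<in> fc_prefixes m m")
    case False
    then have "\<not> rigid n v" using Suc.IH w(2) Suc.prems(2) by simp
    then show ?thesis using not_rigid_context[of n v "[]" "desc_word m j"] w(1) by simp
  next
    case True
    have "j \<noteq> Suc m" using Suc.prems(3) True w(1) fc_prefixes_stable[of m "Suc m"] by auto
    then have j: "j \<le> m" using w(4) by simp
    have "v \<notin> fc_prefixes m (j - 1)"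
      using Suc.prems(3) w(1,3) j by auto
    then have v: "v \<noteq> [] \<and> \<not> last v \<le> j - 1" using fc_prefixes_of_last[OF True, of "j - 1"] by blast
    then have "last v \<in> set v" by simp
    then have "last v < m" using set_prefix_word[OF w(2)] by auto
    then have "\<not> rigid n ([last v] @ desc_word m j)"
      using v w(3) Suc.prems(2) by (intro not_rigid_desc_word) auto
    then have "\<not> rigid n (butlast v @ ([last v] @ desc_word m j) @ [])"
      by (rule not_rigid_context)
    moreover have "w = butlast v @ ([last v] @ desc_word m j) @ []"
      using v w(1) by (simp flip: append_assoc)
    ultimately show ?thesis by simp
  qed
qed simp

text \<open>
  Outside the allowed set some run ends in a letter \<open>i \<ge> j\<close> with \<open>i < m - 1\<close>, and no later run ends in
  \<open>i + 1\<close>. The later runs then commute with \<open>i\<close>, which can therefore be moved to the end.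
\<close>

lemma not_one_block_prefixes_descent:
  assumes "1 \<le> j"
  shows "w \<in> fc_prefixes m m \<Longrightarrow> j \<le> m \<Longrightarrow> m \<le> n \<Longrightarrow> w \<notin> one_block_prefixes m j \<Longrightarrow>
    \<exists>v i. comm_equiv n w (v @ [i]) \<and> j \<le> i \<and> Suc i < m"
proof (induction m arbitrary: w)
  case (Suc m)
  have "w \<notin> fc_prefixes (Suc m) (j - 1)" using Suc.prems(4) by auto
  then have "\<not> (w = [] \<or> last w \<le> j - 1)"
    using fc_prefixes_of_last[OF Suc.prems(1)] by blast
  then have w: "w \<noteq> []" "j \<le> last w" using assms by auto
  have "last w \<le> m" using set_fc_prefixes[OF Suc.prems(1)] last_in_set[OF w(1)] by auto
  show ?case
  proof (cases "last w = m")
    case False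
    then have "comm_equiv n w (butlast w @ [last w]) \<and> j \<le> last w \<and> Suc (last w) < Suc m"
      using w \<open>last w \<le> m\<close> by simp
    then show ?thesis by blast
  next
    case True
    have "w \<notin> fc_prefixes m (Suc m)"
    proof
      assume "w \<in> fc_prefixes m (Suc m)"
      then have "last w \<in> {1..<m}" using set_fc_prefixes last_in_set[OF w(1)] by blast
      then show False using True by simp
    qed
    then obtain v l where v: "w = v @ desc_word m l" "1 \<le> l" "l \<le> m" "v \<in> fc_prefixes m (l - 1)"
      using Suc.prems(1) by auto
    then have l: "l = m" using True by (simp add: last_desc_word desc_word_nonempty)
    have wv: "w = v @ [m]" using v(1) l by (simp add: desc_word_snoc)
    have "v \<in> fc_prefixes m m" using v(4) fc_prefixes_mono[of "l - 1" m m] l by auto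
    moreover have "j \<le> m" using w(2) True by simp
    moreover have "v \<notin> one_block_prefixes m j" using Suc.prems(4) wv \<open>j \<le> m\<close> by auto
    ultimately obtain v' i where v': "comm_equiv n v (v' @ [i])" "j \<le> i" "Suc i < m"
      using Suc.IH[of v] Suc.prems(3) by auto
    have "comm_equiv n ([] @ v @ [m]) ([] @ (v' @ [i]) @ [m])"
      using v'(1) by (rule comm_equiv_context)
    moreover have "comm_equiv n (v' @ ([i] @ [m]) @ []) (v' @ ([m] @ [i]) @ [])"
      using v' assms Suc.prems(3) by (intro comm_equiv_context comm_equiv_past) auto
    ultimately have "comm_equiv n w ((v' @ [m]) @ [i])"
      unfolding wv using rtranclp_trans by simp
    then show ?thesis using v' by (meson less_SucI)
  qed
qed (use assms in simp)

text \<open>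
  If the prefix is not good, one of its run ends can be moved next to the suffix and meets a block
  that still contains this letter.
\<close>

lemma rigid_imp_good_prefix:
  assumes "p \<in> prefix_words n" "suffix_data d n ps" "rigid n (p @ suffix_word n ps)"
  shows "p \<in> good_prefixes n ps"
proof -
  have p: "p \<in> fc_prefixes n n"
    using not_rigid_prefix[OF assms(1) order_refl] not_rigid_context[of n p "[]"] assms(3) by auto
  show ?thesis
  proof (cases ps rule: suffix_cases)
    case 1
    then show ?thesis using p by simp
  next
    case (2 t j)
    have j: "1 \<le> j" "j \<le> n" using assms(2) 2 by (auto simp: suffix_data_def)
    show ?thesis
    proof (rule ccontr)
      assume "p \<notin> good_prefixes n ps"
      then obtain v i where v: "comm_equiv n p (v @ [i])" "j \<le> i" "Suc i < n"
        using not_one_block_prefixes_descent[OF j(1) p j(2) order_refl] 2 by auto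
      have "comm_equiv n ([] @ p @ suffix_block n t j) ([] @ (v @ [i]) @ suffix_block n t j)"
        using v(1) by (rule comm_equiv_context)
      then have "comm_equiv n (p @ suffix_word n ps) (v @ ([i] @ suffix_block n t j) @ [])"
        using 2 by simp
      moreover have "\<not> rigid n (v @ ([i] @ suffix_block n t j) @ [])"
        by (rule not_rigid_context[OF not_rigid_suffix_block]) (use v j in auto)
      ultimately show False using assms(3) not_rigid_comm_equiv by blast
    qed
  next
    case (3 t j u l qs)
    have d: "1 \<le> j" "1 \<le> t" "1 \<le> u" "j < n"
      using assms(2) 3 by (auto simp: suffix_data_def)
    show ?thesis
    proof (rule ccontr)
      assume "p \<notin> good_prefixes n ps"
      then have "p \<notin> fc_prefixes n (j - 1)" using 3 by simp
      then have "\<not> (p = [] \<or> last p \<le> j - 1)" using fc_prefixes_of_last[OF p] by blast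
      then have l: "p \<noteq> []" "j \<le> last p" using d by auto
      have "last p < n" using set_fc_prefixes[OF p] last_in_set[OF l(1)] by auto
      have bad: "\<not> rigid n ([last p] @ suffix_block n t j @ replicate u n)"
      proof (cases "last p = n - 1")
        case True
        then show ?thesis using not_rigid_two_blocks[of j n t u] d by simp
      next
        case False
        then have "\<not> rigid n ([] @ ([last p] @ suffix_block n t j) @ replicate u n)"
          by (intro not_rigid_context not_rigid_suffix_block) (use \<open>last p < n\<close> l d in auto)
        then show ?thesis by simp
      qed
      have "p @ suffix_word n ps = butlast p @ ([last p] @ suffix_block n t j @ replicate u n)
          @ desc_word (n - 1) l @ suffix_word n qs"
        using l(1) 3 by (simp add: suffix_block_def[of n u])
      then show False using not_rigid_context[OF bad] assms(3) by simp
    qed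
  qed
qed

text \<open>
  Between two letters \<open>i + 1\<close> there is always a letter \<open>i\<close>.
\<close>

definition low_separated :: "nat \<Rightarrow> nat list \<Rightarrow> bool" where
  "low_separated i w \<longleftrightarrow> successively (\<lambda>x y. \<not> (x = Suc i \<and> y = Suc i)) (proj i w)"

text \<open>
  Between two letters \<open>i\<close> there is always a letter \<open>i + 1\<close>.
\<close>

definition high_separated :: "nat \<Rightarrow> nat list \<Rightarrow> bool" where
  "high_separated i w \<longleftrightarrow> successively (\<lambda>x y. \<not> (x = i \<and> y = i)) (proj i w)"

text \<open>
  Whether a further letter \<open>i + 1\<close> may follow without violating \<open>low_separated\<close>.
\<close>

definition low_ended :: "nat \<Rightarrow> nat list \<Rightarrow> bool" where
  "low_ended i w \<longleftrightarrow> proj i w = [] \<or> last (proj i w) \<noteq> Suc i"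

lemma low_separated_append: "low_separated i (u @ v) \<longleftrightarrow> low_separated i u \<and> low_separated i v \<and>
    (low_ended i u \<or> proj i v = [] \<or> hd (proj i v) \<noteq> Suc i)"
  by (auto simp: low_separated_def low_ended_def successively_append_iff)

lemma high_separated_append: "high_separated i (u @ v) \<longleftrightarrow> high_separated i u \<and> high_separated i v \<and>
    (proj i u = [] \<or> proj i v = [] \<or> last (proj i u) \<noteq> i \<or> hd (proj i v) \<noteq> i)"
  by (auto simp: high_separated_def successively_append_iff)

lemma proj_desc_word:
  "proj i (desc_word M j) =
     (if j \<le> Suc i \<and> Suc i \<le> M then [Suc i] else []) @ (if j \<le> i \<and> i \<le> M then [i] else [])"
proof (induction M)
  case 0
  then show ?case by (auto simp: desc_word_def proj_Cons)
next
  case (Suc M)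
  show ?case
  proof (cases "j \<le> Suc M")
    case True
    then show ?thesis using Suc by (auto simp: desc_word_Cons proj_Cons)
  qed auto
qed

lemma proj_eq_Nil: "i \<notin> set w \<Longrightarrow> Suc i \<notin> set w \<Longrightarrow> proj i w = []"
  unfolding proj_def by (auto simp: filter_empty_conv)

lemma proj_suffix_block:
  "Suc i < n \<Longrightarrow> proj i (suffix_block n k j) = proj i (desc_word (n - 1) j)"
  by (simp add: suffix_block_def)

text \<open>
  A run containing \<open>i + 1\<close> either continues with \<open>i\<close> or ends in \<open>i + 1\<close>, and in the latter case all later runs
  end, hence stay, above \<open>i + 1\<close>.
\<close>

lemma low_separated_fc_prefixes: "w \<in> fc_prefixes m k \<Longrightarrow> low_separated i w \<and> (k \<le> i \<longrightarrow> low_ended i w)"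
proof (induction m arbitrary: w k)
  case 0
  then show ?case by (simp add: low_separated_def low_ended_def)
next
  case (Suc m)
  from Suc.prems consider "w \<in> fc_prefixes m k"
    | v j where "w = v @ desc_word m j" "1 \<le> j" "j \<le> k" "j \<le> m" "v \<in> fc_prefixes m (j - 1)"
    by auto
  then show ?case
  proof cases
    case 2
    have v: "low_separated i v" "j - 1 \<le> i \<longrightarrow> low_ended i v" using Suc.IH[OF 2(5)] by auto
    show ?thesis unfolding 2(1) low_separated_append
      using v 2(2-4) by (auto simp: low_separated_def low_ended_def proj_desc_word)
  qed (use Suc.IH in blast)
qed

lemma low_separated_suffix_word:
  assumes "Suc i < n"
  shows "suffix_data d n ps \<Longrightarrow> \<forall>q \<in> set ps. L < snd q \<Longrightarrow> low_separated i w \<Longrightarrow>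
    (L \<le> i \<longrightarrow> low_ended i w) \<Longrightarrow> low_separated i (w @ suffix_word n ps)"
proof (induction ps arbitrary: w L)
  case (Cons p ps)
  obtain k j where p: "p = (k, j)" by force
  have d: "suffix_data d n ps" "\<forall>q \<in> set ps. j < snd q" "L < j"
    using Cons.prems(1,2) by (auto simp: p suffix_data_Cons)
  let ?w = "w @ suffix_block n k j"
  have 1: "low_separated i ?w" unfolding low_separated_append
    using Cons.prems(3,4) d(3) by (auto simp: low_separated_def proj_suffix_block[OF assms] proj_desc_word)
  have 2: "j \<le> i \<longrightarrow> low_ended i ?w"
    using Cons.prems(4) d(3) by (auto simp: low_ended_def proj_suffix_block[OF assms] proj_desc_word)
  have "low_separated i (?w @ suffix_word n ps)"
    using Cons.IH[OF d(1,2) 1 2] .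
  then show ?case by (simp add: p)
qed simp

text \<open>
  Only the run with index \<open>i\<close> can start with the letter \<open>i\<close>, and no run before it contains \<open>i\<close>. In every other run
  the letter \<open>i\<close> is preceded by \<open>i + 1\<close>.
\<close>

lemma high_separated_prefix: "w \<in> prefix_words m \<Longrightarrow> high_separated i w"
proof (induction m arbitrary: w)
  case 0
  then show ?case by (simp add: high_separated_def)
next
  case (Suc m)
  then obtain v j where w: "w = v @ desc_word m j" "v \<in> prefix_words m"
    unfolding prefix_words_Suc by blast
  have "i = m \<Longrightarrow> proj i v = []"
    using set_prefix_word[OF w(2)] by (intro proj_eq_Nil) auto
  then show ?case unfolding w(1) high_separated_append
    using Suc.IH[OF w(2)] by (cases "i = m") (auto simp: high_separated_def proj_desc_word)
qed

lemma successively_replicate: "P x x \<Longrightarrow> successively P (replicate k x)"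
proof (induction k)
  case (Suc k)
  then show ?case by (cases k) auto
qed simp

lemma high_separated_suffix_block:
  assumes "i < n" "1 \<le> k"
  shows "high_separated i (suffix_block n k j) \<and>
    (proj i (suffix_block n k j) = [] \<or> hd (proj i (suffix_block n k j)) \<noteq> i)"
proof (cases "Suc i < n")
  case True
  then show ?thesis by (auto simp: high_separated_def proj_suffix_block proj_desc_word)
next
  case False
  then have "n = Suc i" using assms(1) by simp
  then show ?thesis using assms(2)
    by (auto simp: high_separated_def suffix_block_def proj_desc_word successively_append_iff
        successively_replicate hd_append)
qed

lemma high_separated_suffix_word:
  assumes "i < n"
  shows "suffix_data d n ps \<Longrightarrow> high_separated i w \<Longrightarrow> high_separated i (w @ suffix_word n ps)"
proof (induction ps arbitrary: w)
  case (Cons p ps)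
  obtain k j where p: "p = (k, j)" by force
  have d: "suffix_data d n ps" "1 \<le> k"
    using Cons.prems(1) by (auto simp: p suffix_data_Cons)
  have "high_separated i (w @ suffix_block n k j)"
    using Cons.prems(2) high_separated_suffix_block[OF assms d(2), of j] by (auto simp: high_separated_append)
  from Cons.IH[OF d(1) this] show ?case by (simp add: p)
qed simp

text \<open>
  A braid \<open>i, i + 1, i\<close> has two letters \<open>i\<close> without \<open>i - 1\<close> in between, a braid \<open>i + 1, i, i + 1\<close> has two letters
  \<open>i + 1\<close> without \<open>i + 2\<close> in between, and the moves with powers of \<open>s\<^sub>n\<close> have two letters \<open>n - 1\<close> without
  \<open>n - 2\<close> in between. The alternatives in the first and third assumption allow for the chains
  \<open>s\<^sub>x \<dots> s\<^sub>n\<^sub>-\<^sub>1 s\<^sub>n\<^sup>t s\<^sub>n\<^sub>-\<^sub>1 \<dots>\<close>, where such pairs occur but the subword on the other side excludes the braid.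
\<close>

lemma rigidI:
  assumes "n \<ge> 3"
    and 1: "\<And>i. Suc (Suc i) < n \<Longrightarrow> low_separated i w \<or> proj (Suc i) w = [Suc i, Suc (Suc i), Suc (Suc i), Suc i]"
    and 2: "\<And>i. i < n \<Longrightarrow> high_separated i w"
    and 3: "low_separated (n - 2) w \<or> (\<exists>k. proj (n - 1) w = [n - 1] @ replicate k n @ [n - 1])"
  shows "rigid n w"
  unfolding rigid_def
proof (intro allI impI notI)
  fix u v assume "comm_equiv n w u" "braid_step n u v"
  then have proj: "proj i u = proj i w" for i using comm_equiv_proj by metis
  obtain x l r y where *: "(l, r) \<in> braid_moves n \<or> (r, l) \<in> braid_moves n" "u = x @ l @ y"
    using \<open>braid_step n u v\<close> unfolding braid_step_def by blast
  have low: "high_separated i l" if "i < n" for i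
    using 2[OF that] proj unfolding high_separated_def *(2) by (metis proj_append successively_append_iff)
  have up: "low_separated i w \<Longrightarrow> low_separated i l" for i
    using proj unfolding low_separated_def *(2) by (metis proj_append successively_append_iff)
  consider i where "1 \<le> i" "i + 2 \<le> n" "l = [i, i + 1, i]"
    | i where "1 \<le> i" "i + 2 \<le> n" "l = [i + 1, i, i + 1]"
    | a b where "1 \<le> a" "1 \<le> b"
        "l = replicate a n @ [n - 1] @ replicate b n @ [n - 1] \<or>
         l = [n - 1] @ replicate b n @ [n - 1] @ replicate a n"
    using *(1) unfolding braid_moves_def by blast
  then show False
  proof cases
    case (1 i)
    then obtain h where h: "i = Suc h" by (cases i) auto
    have "\<not> low_separated h l" unfolding 1(3) h by (simp add: low_separated_def proj_Cons)
    then have "proj i w = [i, Suc i, Suc i, i]"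
      using assms(2)[of h] up 1(2) h by auto
    then have "proj i x @ [i, Suc i, i] @ proj i y = [i, Suc i, Suc i, i]"
      using proj[of i] unfolding *(2) 1(3) by (simp add: proj_Cons)
    then show False
      by (cases "proj i x" rule: list.exhaust; cases "proj i y" rule: rev_cases)
         (auto simp: append_eq_Cons_conv Cons_eq_append_conv)
  next
    case (2 i)
    have "\<not> high_separated (Suc i) l" unfolding 2(3) by (simp add: high_separated_def proj_Cons)
    then show False using low[of "Suc i"] 2(2) by simp
  next
    case (3 a b)
    have n: "Suc (n - 2) = n - 1" "Suc (n - 1) = n" using assms(1) by auto
    have "proj (n - 2) l = [n - 1, n - 1]"
      using 3(3) n by (auto simp: proj_Cons)
    then have "\<not> low_separated (n - 2) l" by (simp add: low_separated_def n)
    then obtain k where k: "proj (n - 1) w = [n - 1] @ replicate k n @ [n - 1]"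
      using assms(4) up by blast
    have pl: "proj (n - 1) l = l"
      using 3(3) n by (auto simp: proj_Cons)
    have xly: "proj (n - 1) x @ l @ proj (n - 1) y = [n - 1] @ replicate k n @ [n - 1]"
      using proj[of "n - 1"] k pl unfolding *(2) by simp
    obtain p q where "l = p @ [n, n - 1, n] @ q"
    proof -
      obtain a' b' where "a = Suc a'" "b = Suc b'" using 3(1,2) by (metis not_one_le_zero old.nat.exhaust)
      then have ab: "replicate a n = replicate a' n @ [n]" "replicate b n = [n] @ replicate b' n"
          "replicate a n = [n] @ replicate a' n" "replicate b n = replicate b' n @ [n]"
        by (simp_all add: replicate_append_same)
      from 3(3) show thesis
      proof
        assume "l = replicate a n @ [n - 1] @ replicate b n @ [n - 1]"
        then show thesis using that[of "replicate a' n" "replicate b' n @ [n - 1]"] ab(1,2) by simp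
      next
        assume "l = [n - 1] @ replicate b n @ [n - 1] @ replicate a n"
        then show thesis using that[of "[n - 1] @ replicate b' n" "replicate a' n"] ab(3,4) by simp
      qed
    qed
    then have eq: "(proj (n - 1) x @ p) @ [n, n - 1, n] @ (q @ proj (n - 1) y)
        = [n - 1] @ replicate k n @ [n - 1]"
      using xly by simp
    obtain X Y where XY: "X @ [n, n - 1, n] @ Y = [n - 1] @ replicate k n @ [n - 1]"
      using eq by blast
    have ne: "n \<noteq> n - 1" using assms(1) by simp
    \<comment> \<open>Such a word would contain the factor \<open>n, n - 1, n\<close> strictly inside, but its inner letters are all \<open>n\<close>.\<close>
    obtain X' where X': "X = (n - 1) # X'" using XY ne by (cases X) auto
    obtain Y' where Y': "Y = Y' @ [n - 1]" using XY ne by (cases Y rule: rev_cases) auto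
    have "X' @ [n, n - 1, n] @ Y' = replicate k n" using XY X' Y' by simp
    then have "n - 1 \<in> set (replicate k n)" by (metis in_set_conv_decomp append_Cons append_Nil append_assoc)
    then show False using ne by simp
  qed
qed

text \<open>
  If all runs of the prefix end below the first block, then two letters \<open>i + 1\<close> are always separated
  by a letter \<open>i\<close>. The only other case is a single block behind a chain, where the relevant two-letter
  subwords are known exactly.
\<close>

lemma good_prefix_imp_rigid:
  assumes "n \<ge> 3" "suffix_data d n ps" "p \<in> good_prefixes n ps"
  shows "rigid n (p @ suffix_word n ps)"
proof -
  have low: "high_separated i (w @ suffix_word n ps)" if "w \<in> fc_prefixes n n" "i < n" for w i
    using high_separated_suffix_word[OF that(2) assms(2) high_separated_prefix[OF fc_prefixes_prefix_words[OF that(1)]]] .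
  have main: "rigid n (p @ suffix_word n ps)"
    if w: "p \<in> fc_prefixes n k" "\<forall>q \<in> set ps. k < snd q" for k
  proof (rule rigidI[OF assms(1)])
    have up: "low_separated i (p @ suffix_word n ps)" if "Suc i < n" for i
      using low_separated_suffix_word[OF that assms(2) w(2)] low_separated_fc_prefixes[OF w(1)] by blast
    then show "low_separated i (p @ suffix_word n ps) \<or> proj (Suc i) (p @ suffix_word n ps)
        = [Suc i, Suc (Suc i), Suc (Suc i), Suc i]" if "Suc (Suc i) < n" for i
      using that by simp
    show "low_separated (n - 2) (p @ suffix_word n ps) \<or>
        (\<exists>k. proj (n - 1) (p @ suffix_word n ps) = [n - 1] @ replicate k n @ [n - 1])"
      using up[of "n - 2"] assms(1) by simp
    have "p \<noteq> [] \<Longrightarrow> last p \<le> n"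
      using set_fc_prefixes[OF w(1)] last_in_set[of p] by fastforce
    then have "p \<in> fc_prefixes n n" using fc_prefixes_of_last[OF w(1)] by blast
    then show "high_separated i (p @ suffix_word n ps)" if "i < n" for i
      using low that by blast
  qed
  show ?thesis
  proof (cases ps rule: suffix_cases)
    case 1
    then show ?thesis using main[of n] assms(3) by simp
  next
    case (3 t j u l qs)
    then have "\<forall>q \<in> set ps. j - 1 < snd q" "p \<in> fc_prefixes n (j - 1)"
      using assms(2,3) by (auto simp: suffix_data_Cons intro: less_imp_diff_less)
    then show ?thesis using main by blast
  next
    case (2 t j)
    have j: "1 \<le> j" "j \<le> n" using assms(2) 2 by (auto simp: suffix_data_Cons)
    have p: "p \<in> one_block_prefixes n j" using assms(3) 2 by simp
    from p j show ?thesis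
    proof (cases rule: one_block_prefixes_cases)
      case 1
      then show ?thesis using main[of "j - 1"] 2 j by auto
    next
      case (2 x v)
      have ps: "suffix_word n ps = suffix_block n t j"
        using \<open>ps = [(t, j)]\<close> by simp
      let ?W = "p @ suffix_word n ps"
      have W: "?W = v @ [x..<n] @ replicate t n @ desc_word (n - 1) j"
        unfolding ps 2(4) by (simp add: suffix_block_def)
      have v: "set v \<subseteq> {1..<x}" using set_fc_prefixes[OF 2(3)] .
      have upt: "proj i [x..<n] = (if x \<le> i then [i] else []) @ (if x \<le> Suc i \<and> Suc i < n then [Suc i] else [])"
        if "i < n" for i
      proof -
        have "proj i [x..<y] = (if x \<le> i \<and> i < y then [i] else []) @ (if x \<le> Suc i \<and> Suc i < y then [Suc i] else [])" for y
          by (induction y) (auto simp: proj_Cons)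
        then show ?thesis using that by simp
      qed
      show ?thesis
      proof (rule rigidI[OF assms(1)])
        fix i assume i: "Suc (Suc i) < n"
        show "low_separated i ?W \<or> proj (Suc i) ?W = [Suc i, Suc (Suc i), Suc (Suc i), Suc i]"
        proof (cases "x \<le> Suc i")
          case True
          have "proj (Suc i) v = []" using v True by (intro proj_eq_Nil) auto
          then have "proj (Suc i) ?W = [Suc i, Suc (Suc i), Suc (Suc i), Suc i]"
            unfolding W using True i 2(1) upt[of "Suc i"] by (simp add: proj_desc_word)
          then show ?thesis ..
        next
          case False
          have "low_separated i (v @ suffix_word n ps)"
            using low_separated_suffix_word[OF _ assms(2), of i "j - 1" v] low_separated_fc_prefixes[OF 2(3)] i j \<open>ps = [(t, j)]\<close>
            by auto
          moreover have "proj i [x..<n] = []" using False i upt[of i] by simp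
          then have "proj i ?W = proj i (v @ suffix_word n ps)"
            unfolding W unfolding ps by (simp add: suffix_block_def)
          ultimately show ?thesis by (simp add: low_separated_def)
        qed
      next
        have n: "Suc (n - 1) = n" using assms(1) by simp
        have "\<forall>y \<in> set v. y < n - 1" using v 2(2) by fastforce
        then have "proj (n - 1) v = []" using n by (intro proj_eq_Nil) auto
        then have "proj (n - 1) ?W = [n - 1] @ replicate t n @ [n - 1]"
          unfolding W using 2(1,2) n upt[of "n - 1"] by (simp add: proj_desc_word del: One_nat_def) linarith
        then show "low_separated (n - 2) ?W \<or> (\<exists>k. proj (n - 1) ?W = [n - 1] @ replicate k n @ [n - 1])"
          by blast
      next
        show "high_separated i ?W" if "i < n" for i
          using low[OF one_block_prefixes_subset[OF j(1) p] that] .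
      qed
    qed
  qed
qed

lemma good_prefixes_prefix_words:
  assumes "suffix_data d n ps" "p \<in> good_prefixes n ps"
  shows "p \<in> prefix_words n"
proof -
  show ?thesis
  proof (cases ps rule: suffix_cases)
    case (2 t j)
    then have "p \<in> fc_prefixes n n" using assms by (intro one_block_prefixes_subset[of j]) (auto simp: suffix_data_Cons)
    then show ?thesis by (rule fc_prefixes_prefix_words)
  qed (use assms(2) in \<open>auto intro: fc_prefixes_prefix_words\<close>)
qed

section \<open>Catalan triangle numbers count fully commutative prefixes\<close>

lemma catalan_triangle_0: "catalan_triangle n 0 = 1"
proof -
  have "fact (n + 1) = fact n * (real n + 1)" by (simp add: algebra_simps)
  then show ?thesis by (simp add: catalan_triangle_def)
qed

lemma catalan_triangle_Suc_Suc:
  assumes "k < m"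
  shows "catalan_triangle (Suc m) (Suc k) = catalan_triangle (Suc m) k + catalan_triangle m (Suc k)"
proof -
  define F :: real where "F = fact (m + k + 1)"
  have 1: "fact (Suc m + Suc k) = (real m + real k + 2) * F"
      "fact (Suc m + k) = F" "fact (m + Suc k) = F"
    by (simp_all add: F_def algebra_simps)
  have 2: "fact (Suc m + 1) = (real m + 2) * (fact (m + 1) :: real)"
      "fact (Suc k) = (real k + 1) * (fact k :: real)"
    by (simp_all add: algebra_simps)
  define G H :: real where "G = fact (m + 1)" and "H = fact k"
  have pos: "G > 0" "H > 0" by (simp_all add: G_def H_def)
  have "(real m + real k + 2) * F * (real m - real k + 1) / ((real k + 1) * H * ((real m + 2) * G))
      = F * (real m - real k + 2) / (H * ((real m + 2) * G))
        + F * (real m - real k) / ((real k + 1) * H * G)"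
    using pos by (simp add: divide_simps) (simp add: algebra_simps)
  then show ?thesis
    unfolding catalan_triangle_def 1 2 by (simp add: G_def H_def algebra_simps)
qed

lemma catalan_triangle_diagonal:
  "catalan_triangle (Suc m) (Suc m) = catalan_triangle (Suc m) m"
proof -
  define F G H :: real where "F = fact (Suc m + m)" and "G = fact (Suc m + 1)" and "H = fact m"
  have 1: "fact (Suc m + Suc m) = (2 * real m + 2) * F" "fact (Suc m) = (real m + 1) * H"
    by (simp_all add: F_def H_def algebra_simps)
  have pos: "G > 0" "H > 0" by (simp_all add: G_def H_def del: fact_Suc)
  show ?thesis
    unfolding catalan_triangle_def 1 F_def[symmetric] G_def[symmetric] H_def[symmetric]
    using pos by (simp add: divide_simps)
qed

lemma catalan_eq_triangle: "catalan n = catalan_triangle n n"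
proof -
  have "catalan n = fact (2 * n) / (fact n * ((real n + 1) * fact n))"
    by (simp add: catalan_def binomial_fact)
  also have "(real n + 1) * fact n = fact (n + 1)" by (simp add: algebra_simps)
  finally show ?thesis by (simp add: catalan_triangle_def mult_2 del: fact_Suc)
qed

lemma fc_prefixes_Suc_eq_UN:
  "fc_prefixes (Suc m) k = fc_prefixes m k \<union> (\<Union>j \<in> {1..min k m}. (\<lambda>w. w @ desc_word m j) ` fc_prefixes m (j - 1))"
proof -
  have "{w @ desc_word m j | w j. 1 \<le> j \<and> j \<le> min k m \<and> w \<in> fc_prefixes m (j - 1)}
      = (\<Union>j \<in> {1..min k m}. (\<lambda>w. w @ desc_word m j) ` fc_prefixes m (j - 1))"
    (is "?A = ?B")
  proof (intro equalityI subsetI)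
    fix x assume "x \<in> ?A"
    then obtain w j where "x = w @ desc_word m j" "1 \<le> j" "j \<le> min k m" "w \<in> fc_prefixes m (j - 1)"
      by blast
    then show "x \<in> ?B" by (intro UN_I[of j] image_eqI[of _ _ w]) simp_all
  next
    fix x assume "x \<in> ?B"
    then obtain j w where "j \<in> {1..min k m}" "x = w @ desc_word m j" "w \<in> fc_prefixes m (j - 1)"
      by blast
    then show "x \<in> ?A" by (intro CollectI exI[of _ w] exI[of _ j]) simp
  qed
  then show ?thesis by (simp only: fc_prefixes.simps)
qed

lemma finite_fc_prefixes [simp]: "finite (fc_prefixes m k)"
  by (induction m arbitrary: k) (simp_all add: fc_prefixes_Suc_eq_UN del: fc_prefixes.simps(2))

lemma card_fc_prefixes_Suc:
  "card (fc_prefixes (Suc m) k) = card (fc_prefixes m k) + (\<Sum>j=1..min k m. card (fc_prefixes m (j - 1)))"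
proof -
  let ?U = "\<lambda>j. (\<lambda>w. w @ desc_word m j) ` fc_prefixes m (j - 1)"
  note eq = fc_prefixes_Suc_eq_UN[of m k]
  have "w \<notin> fc_prefixes m k" if "j \<in> {1..min k m}" "w \<in> ?U j" for w j
  proof
    assume "w \<in> fc_prefixes m k"
    then have "m \<notin> set w" using set_fc_prefixes by fastforce
    then show False using that by auto
  qed
  then have disj: "fc_prefixes m k \<inter> (\<Union>j \<in> {1..min k m}. ?U j) = {}" by blast
  have "card (\<Union>j \<in> {1..min k m}. ?U j) = (\<Sum>j \<in> {1..min k m}. card (?U j))"
  proof (rule card_UN_disjoint)
    show "\<forall>i\<in>{1..min k m}. \<forall>j\<in>{1..min k m}. i \<noteq> j \<longrightarrow> ?U i \<inter> ?U j = {}"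
    proof (intro ballI impI)
      fix i j assume ij: "i \<in> {1..min k m}" "j \<in> {1..min k m}" "i \<noteq> j"
      have last: "last w = l" if "w \<in> ?U l" "l \<in> {1..min k m}" for w l
        using that by (auto simp: last_desc_word desc_word_nonempty)
      show "?U i \<inter> ?U j = {}"
      proof (rule equals0I)
        fix w assume "w \<in> ?U i \<inter> ?U j"
        then show False using last[of w i] last[of w j] ij by simp
      qed
    qed
  qed auto
  also have "\<dots> = (\<Sum>j=1..min k m. card (fc_prefixes m (j - 1)))"
    by (intro sum.cong card_image) (auto intro!: inj_onI)
  finally show ?thesis
    unfolding eq using disj by (subst card_Un_disjoint) auto
qed

text \<open>
  Comparing the recursions for \<open>k + 1\<close> and \<open>k\<close>, the two sums over the end of the last run differ in one term, and
  what remains is the recursion of the Catalan triangle.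
\<close>

lemma card_fc_prefixes: "k \<le> m \<Longrightarrow> real (card (fc_prefixes m k)) = catalan_triangle m k"
proof (induction m arbitrary: k)
  case 0
  then show ?case by (simp add: catalan_triangle_0)
next
  case (Suc m)
  note outer = Suc.IH
  from Suc.prems show ?case
  proof (induction k)
    case 0
    have "card (fc_prefixes (Suc m) 0) = card (fc_prefixes m 0)" using card_fc_prefixes_Suc[of m 0] by simp
    then show ?case using outer[of 0] by (simp add: catalan_triangle_0)
  next
    case (Suc k)
    show ?case
    proof (cases "k < m")
      case True
      have m: "min (Suc k) m = Suc k" "min k m = k" using True by auto
      have "card (fc_prefixes (Suc m) (Suc k)) + card (fc_prefixes m k)
          = card (fc_prefixes (Suc m) k) + card (fc_prefixes m (Suc k)) + card (fc_prefixes m k)"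
        unfolding card_fc_prefixes_Suc m by simp
      then have "real (card (fc_prefixes (Suc m) (Suc k))) = real (card (fc_prefixes (Suc m) k)) + real (card (fc_prefixes m (Suc k)))"
        by linarith
      then show ?thesis
        using Suc.IH outer[of "Suc k"] True by (simp add: catalan_triangle_Suc_Suc)
    next
      case False
      then have "k = m" using Suc.prems by simp
      then show ?thesis
        using Suc.IH fc_prefixes_stable[of "Suc m" m] by (simp add: catalan_triangle_diagonal)
    qed
  qed
qed

text \<open>
  Removing a final letter \<open>m\<close> gives the same recursion as for \<open>fc_prefixes\<close>. At \<open>j = m\<close> the two entries
  \<open>C(m,m) = C(m,m-1)\<close> agree.
\<close>

lemma card_one_block_prefixes:
  "1 \<le> j \<Longrightarrow> j \<le> m \<Longrightarrow> finite (one_block_prefixes m j) \<and> real (card (one_block_prefixes m j)) = catalan_triangle m j"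
proof (induction m)
  case (Suc m)
  show ?case
  proof (cases "j \<le> m")
    case False
    then have "j = Suc m" using Suc.prems by simp
    then show ?thesis
      using card_fc_prefixes[of m "Suc m"] finite_fc_prefixes[of "Suc m" m]
      by (simp add: catalan_triangle_diagonal del: fc_prefixes.simps)
  next
    case True
    then have IH: "finite (one_block_prefixes m j)" "real (card (one_block_prefixes m j)) = catalan_triangle m j"
      using Suc.IH Suc.prems by auto
    have eq: "one_block_prefixes (Suc m) j = fc_prefixes (Suc m) (j - 1) \<union> (\<lambda>w. w @ [m]) ` one_block_prefixes m j"
      using True by simp
    have "w @ [m] \<notin> fc_prefixes (Suc m) (j - 1)" for w
    proof
      assume "w @ [m] \<in> fc_prefixes (Suc m) (j - 1)"
      from last_fc_prefixes[OF this] have "m \<le> j - 1" by simp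
      then show False using True Suc.prems by simp
    qed
    then have "fc_prefixes (Suc m) (j - 1) \<inter> (\<lambda>w. w @ [m]) ` one_block_prefixes m j = {}" by blast
    then have "card (one_block_prefixes (Suc m) j) = card (fc_prefixes (Suc m) (j - 1)) + card (one_block_prefixes m j)"
      unfolding eq using IH(1) finite_fc_prefixes[of "Suc m" "j - 1"]
      by (subst card_Un_disjoint) (auto simp: card_image inj_on_def simp del: fc_prefixes.simps)
    moreover have "real (card (fc_prefixes (Suc m) (j - 1))) = catalan_triangle (Suc m) (j - 1)"
      using True by (intro card_fc_prefixes) simp
    moreover have "catalan_triangle (Suc m) j
        = catalan_triangle (Suc m) (j - 1) + catalan_triangle m j"
      using catalan_triangle_Suc_Suc[of "j - 1" m] True Suc.prems by simp
    moreover have "finite (one_block_prefixes (Suc m) j)"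
      unfolding eq using IH(1) finite_fc_prefixes[of "Suc m" "j - 1"] by blast
    ultimately show ?thesis using IH(2) by simp
  qed
qed simp

section \<open>Packets\<close>

text \<open>
  The exception for \<open>j = n\<close> is due to \<open>s\<^sub>n\<^sup>t\<close> and \<open>s\<^sub>n\<^sup>t s\<^sub>n\<^sub>-\<^sub>1\<close> sharing a packet.
\<close>

fun packet_index :: "nat \<Rightarrow> (nat \<times> nat) list \<Rightarrow> nat" where
  "packet_index n [] = n"
| "packet_index n [(t, j)] = (if j = n then n - 1 else j)"
| "packet_index n ((t, j) # _ # _) = j - 1"

lemma card_good_prefixes:
  assumes "n \<ge> 1" "suffix_data d n ps"
  shows "finite (good_prefixes n ps) \<and>
    real (card (good_prefixes n ps)) = catalan_triangle n (packet_index n ps)"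
proof (cases ps rule: suffix_cases)
  case 1
  then show ?thesis using card_fc_prefixes[of n n] by simp
next
  case (2 t j)
  then have j: "1 \<le> j" "j \<le> n" using assms(2) by (auto simp: suffix_data_Cons)
  have "catalan_triangle n (n - 1) = catalan_triangle n n"
    using catalan_triangle_diagonal[of "n - 1"] assms(1) by simp
  then show ?thesis using card_one_block_prefixes[OF j] 2 by auto
next
  case (3 t j u l qs)
  then have "j - 1 \<le> n" using assms(2) by (auto simp: suffix_data_Cons)
  then show ?thesis using card_fc_prefixes[of "j - 1" n] 3 by simp
qed

lemma packet_index_le:
  assumes "suffix_data d n ps"
  shows "packet_index n ps \<le> n"
  using assms by (cases ps rule: suffix_cases) (auto simp: suffix_data_Cons)

lemma long_suffixes_eq:
  "long_suffixes d n m = suffix_word n ` {ps. suffix_data d n ps \<and> (\<exists>t q qs. ps = (t, m) # q # qs)}"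
proof -
  have "(\<exists>t ps. s = suffix_word n ((t, m) # ps) \<and> ps \<noteq> [] \<and> suffix_data d n ((t, m) # ps)) \<longleftrightarrow>
      (\<exists>ps. s = suffix_word n ps \<and> suffix_data d n ps \<and> (\<exists>t q qs. ps = (t, m) # q # qs))" for s
    by (metis list.exhaust list.distinct(1))
  then show ?thesis unfolding long_suffixes_def image_def by blast
qed

lemma single_suffixes_eq:
  assumes "1 \<le> j" "j \<le> n"
  shows "{suffix_block n t j | t. 1 \<le> t \<and> t < d} = suffix_word n ` {ps. suffix_data d n ps \<and> (\<exists>t. ps = [(t, j)])}"
proof -
  have "suffix_data d n ps \<and> (\<exists>t. ps = [(t, j)]) \<longleftrightarrow> (\<exists>t. 1 \<le> t \<and> t < d \<and> ps = [(t, j)])" for ps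
    using assms by (auto simp: suffix_data_Cons)
  then have "suffix_word n ` {ps. suffix_data d n ps \<and> (\<exists>t. ps = [(t, j)])}
      = suffix_word n ` {ps. \<exists>t. 1 \<le> t \<and> t < d \<and> ps = [(t, j)]}"
    by simp
  also have "\<dots> = {suffix_block n t j | t. 1 \<le> t \<and> t < d}"
    by (auto simp: image_def)
  finally show ?thesis ..
qed

lemma packet_index_iff:
  assumes "n \<ge> 2" "suffix_data d n ps"
  shows "packet_index n ps = k \<longleftrightarrow>
     (if k = 0 then \<exists>t q qs. ps = (t, 1) # q # qs
      else if k + 2 \<le> n then (\<exists>t. ps = [(t, k)]) \<or> (\<exists>t q qs. ps = (t, k + 1) # q # qs)
      else if k + 1 = n then (\<exists>t. ps = [(t, n - 1)]) \<or> (\<exists>t. ps = [(t, n)])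
      else k = n \<and> ps = [])"
  using assms by (cases ps rule: suffix_cases) (auto simp: suffix_data_Cons)

lemma packet_labels_eq:
  assumes "n \<ge> 2"
  shows "packet_labels d n k = suffix_word n ` {ps. suffix_data d n ps \<and> packet_index n ps = k}"
proof -
  let ?E = "{ps. suffix_data d n ps \<and> packet_index n ps = k}"
  note iff = packet_index_iff[OF assms, of d _ k]
  consider "k = 0" | "0 < k" "k + 2 \<le> n" | "k + 1 = n" | "k = n" | "k > n" by linarith
  then show ?thesis
  proof cases
    case 1
    then have "?E = {ps. suffix_data d n ps \<and> (\<exists>t q qs. ps = (t, 1) # q # qs)}"
      using iff by auto
    then show ?thesis using 1 by (simp add: packet_labels_def long_suffixes_eq)
  next
    case 2
    then have "?E = {ps. suffix_data d n ps \<and> (\<exists>t. ps = [(t, k)])}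
        \<union> {ps. suffix_data d n ps \<and> (\<exists>t q qs. ps = (t, k + 1) # q # qs)}"
      using iff by auto
    then show ?thesis using 2
      by (simp add: packet_labels_def long_suffixes_eq image_Un single_suffixes_eq[symmetric])
  next
    case 3
    then have "?E = {ps. suffix_data d n ps \<and> (\<exists>t. ps = [(t, n - 1)])}
        \<union> {ps. suffix_data d n ps \<and> (\<exists>t. ps = [(t, n)])}"
      using iff assms by auto
    then have "suffix_word n ` ?E = {suffix_block n t (n - 1) | t. 1 \<le> t \<and> t < d}
        \<union> {suffix_block n t n | t. 1 \<le> t \<and> t < d}"
      using assms by (simp only: image_Un single_suffixes_eq[symmetric])
    also have "\<dots> = {suffix_block n t j | t j. 1 \<le> t \<and> t < d \<and> j \<in> {n - 1, n}}"
      by auto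
    finally show ?thesis using 3 assms by (simp add: packet_labels_def)
  next
    case 4
    then have "?E = {[]}" using iff assms by auto
    then show ?thesis using 4 assms by (simp add: packet_labels_def)
  next
    case 5
    then have "?E = {}" using packet_index_le by fastforce
    then show ?thesis using 5 by (simp add: packet_labels_def)
  qed
qed

lemma collection_eq:
  assumes "n \<ge> 3" "d > 0" "suffix_data d n ps"
  shows "collection d n (suffix_word n ps) = (\<lambda>p. p @ suffix_word n ps) ` good_prefixes n ps"
proof -
  have fc: "fully_commutative d n (word_elt d n (p @ suffix_word n ps)) \<longleftrightarrow> p \<in> good_prefixes n ps"
      and can: "p @ suffix_word n ps \<in> canonical_words d n"
    if "p \<in> prefix_words n" for p
  proof -
    show c: "p @ suffix_word n ps \<in> canonical_words d n"
      using that assms(3) unfolding canonical_words_def by blast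
    show "fully_commutative d n (word_elt d n (p @ suffix_word n ps)) \<longleftrightarrow> p \<in> good_prefixes n ps"
      using fully_commutative_iff_rigid[OF _ assms(2) c] assms(1)
        rigid_imp_good_prefix[OF that assms(3)] good_prefix_imp_rigid[OF assms(1,3)] by auto
  qed
  show ?thesis
    unfolding collection_def
    using fc can good_prefixes_prefix_words[OF assms(3)] by (auto simp: image_iff)
qed

lemma Nil_in_good_prefixes: "[] \<in> good_prefixes n ps"
proof -
  have "[] \<in> one_block_prefixes n j" for j by (cases n) (simp_all del: fc_prefixes.simps)
  then show ?thesis by (cases ps rule: suffix_cases) simp_all
qed

lemma inj_collection:
  assumes "n \<ge> 3" "d > 0"
  shows "inj_on (\<lambda>ps. collection d n (suffix_word n ps)) {ps. suffix_data d n ps}"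
proof (rule inj_onI, simp)
  fix ps qs assume d: "suffix_data d n ps" "suffix_data d n qs"
    and eq: "collection d n (suffix_word n ps) = collection d n (suffix_word n qs)"
  have "[] @ suffix_word n ps \<in> collection d n (suffix_word n ps)"
    unfolding collection_eq[OF assms d(1)] using Nil_in_good_prefixes by blast
  then obtain p where p: "p \<in> good_prefixes n qs" "[] @ suffix_word n ps = p @ suffix_word n qs"
    unfolding eq collection_eq[OF assms d(2)] by blast
  have "elt_equiv d n ([] @ suffix_word n ps) (p @ suffix_word n qs)"
    using p(2) set_suffix_word_over[OF d(1)] elt_equiv_refl[of "suffix_word n ps" n d] by simp
  then show "ps = qs"
    using canonical_unique[of n d "[]" p ps qs] assms d good_prefixes_prefix_words[OF d(2) p(1)]
      good_prefixes_prefix_words[OF d(1) Nil_in_good_prefixes] by auto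
qed

lemma count_list_suffix_word:
  "suffix_data d n ps \<Longrightarrow> n \<ge> 1 \<Longrightarrow> count_list (suffix_word n ps) n = sum_list (map fst ps)"
proof (induction ps)
  case (Cons p ps)
  obtain k j where p: "p = (k, j)" by force
  have "count_list (desc_word (n - 1) j) n = 0"
    using Cons.prems(2) by (intro count_notin) auto
  then show ?case using Cons by (simp add: p suffix_data_Cons suffix_block_def count_list_replicate)
qed simp

definition suffixes :: "nat \<Rightarrow> nat \<Rightarrow> nat \<Rightarrow> (nat \<times> nat) list set" where
  "suffixes d r n = {ps. suffix_data d n ps \<and> r dvd sum_list (map fst ps)}"

lemma word_elt_mem_Gdr_canonical:
  assumes "n \<ge> 2" "d > 0" "r dvd d" "suffix_data d n ps" "p \<in> prefix_words n"
  shows "word_elt d n (p @ suffix_word n ps) \<in> Gdr d r n \<longleftrightarrow> ps \<in> suffixes d r n"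
proof -
  have p: "set p \<subseteq> {1..<n}" using set_prefix_word[OF assms(5)] .
  have "count_list p n = 0" using p by (intro count_notin) auto
  then show ?thesis
    using p set_suffix_word_over[OF assms(4)] count_list_suffix_word[OF assms(4)] assms
    by (subst word_elt_mem_Gdr) (auto simp: suffixes_def)
qed

lemma packet_eq:
  assumes "n \<ge> 3" "d > 0" "r dvd d"
  shows "packet d r n k =
    (\<lambda>ps. collection d n (suffix_word n ps)) ` {ps \<in> suffixes d r n. packet_index n ps = k}"
proof -
  have "(\<forall>w \<in> collection d n (suffix_word n ps). word_elt d n w \<in> Gdr d r n) \<longleftrightarrow> ps \<in> suffixes d r n"
    if "suffix_data d n ps" for ps
    unfolding collection_eq[OF assms(1,2) that]
    using Nil_in_good_prefixes[of n ps] good_prefixes_prefix_words[OF that]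
      word_elt_mem_Gdr_canonical[OF _ assms(2,3) that] assms(1) by auto
  moreover have "n \<ge> 2" using assms(1) by simp
  ultimately show ?thesis
    unfolding packet_def packet_labels_eq[OF \<open>n \<ge> 2\<close>] by (auto simp: suffixes_def)
qed

lemma card_packet:
  assumes "n \<ge> 3" "d > 0" "r dvd d"
  shows "card (packet d r n k) = card {ps \<in> suffixes d r n. packet_index n ps = k}"
  unfolding packet_eq[OF assms]
  by (intro card_image inj_on_subset[OF inj_collection[OF assms(1,2)]]) (auto simp: suffixes_def)

text \<open>
  Every element has exactly one canonical word. Its exponent sum decides membership in \<open>G(d,r,n)\<close>, and
  its prefix decides full commutativity.
\<close>

lemma fully_commutative_Gdr:
  assumes "n \<ge> 3" "d > 0" "r dvd d"
  shows "bij_betw (\<lambda>(ps, p). word_elt d n (p @ suffix_word n ps))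
    (Sigma (suffixes d r n) (good_prefixes n)) {g \<in> Gdr d r n. fully_commutative d n g}"
proof -
  have n: "n \<ge> 2" using assms(1) by simp
  have over: "set (p @ suffix_word n ps) \<subseteq> {1..n}" if "suffix_data d n ps" "p \<in> prefix_words n" for p ps
    using canonical_words_over[of "p @ suffix_word n ps" d n] that unfolding canonical_words_def by blast
  have good: "p \<in> prefix_words n \<and> fully_commutative d n (word_elt d n (p @ suffix_word n ps))"
    if "suffix_data d n ps" "p \<in> good_prefixes n ps" for p ps
    using that collection_eq[OF assms(1,2) that(1)] good_prefixes_prefix_words[OF that]
    unfolding collection_def by blast
  show ?thesis
  proof (rule bij_betw_imageI)
    show "inj_on (\<lambda>(ps, p). word_elt d n (p @ suffix_word n ps)) (Sigma (suffixes d r n) (good_prefixes n))"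
    proof (rule inj_onI, clarify)
      fix ps p qs q
      assume *: "ps \<in> suffixes d r n" "p \<in> good_prefixes n ps" "qs \<in> suffixes d r n"
          "q \<in> good_prefixes n qs" "word_elt d n (p @ suffix_word n ps) = word_elt d n (q @ suffix_word n qs)"
      have d: "suffix_data d n ps" "suffix_data d n qs" using * by (auto simp: suffixes_def)
      have pq: "p \<in> prefix_words n" "q \<in> prefix_words n" using good * d by blast+
      have "elt_equiv d n (p @ suffix_word n ps) (q @ suffix_word n qs)"
        using *(5) word_elt_eq_iff[OF over[OF d(1) pq(1)]] by blast
      then show "ps = qs \<and> p = q"
        using canonical_unique[OF n assms(2) pq d] by blast
    qed
    show "(\<lambda>(ps, p). word_elt d n (p @ suffix_word n ps)) ` (Sigma (suffixes d r n) (good_prefixes n))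
        = {g \<in> Gdr d r n. fully_commutative d n g}"
    proof (intro equalityI subsetI)
      fix g assume "g \<in> (\<lambda>(ps, p). word_elt d n (p @ suffix_word n ps)) ` (Sigma (suffixes d r n) (good_prefixes n))"
      then obtain ps p where *: "ps \<in> suffixes d r n" "p \<in> good_prefixes n ps"
          "g = word_elt d n (p @ suffix_word n ps)" by auto
      then have "suffix_data d n ps" by (simp add: suffixes_def)
      with good * word_elt_mem_Gdr_canonical[OF n assms(2,3)]
      show "g \<in> {g \<in> Gdr d r n. fully_commutative d n g}" by blast
    next
      fix g assume g: "g \<in> {g \<in> Gdr d r n. fully_commutative d n g}"
      then have "g \<in> carrier (Gd1 d n)"
        using subgroup.subset[OF subgroup_Gdr[OF n]] by blast
      then obtain v where v: "set v \<subseteq> {1..n}" "g = word_elt d n v"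
        using carrier_positive[OF n assms(2)] by blast
      obtain w where w: "w \<in> canonical_words d n" "reduces d n v w"
        using reduces_to_canonical[OF n assms(2) v(1)] by blast
      then obtain p ps where ps: "w = p @ suffix_word n ps" "p \<in> prefix_words n" "suffix_data d n ps"
        unfolding canonical_words_def by blast
      have gw: "g = word_elt d n (p @ suffix_word n ps)"
        using w(2) v word_elt_eq_iff[OF v(1)] ps(1) unfolding reduces_def by blast
      have "w \<in> collection d n (suffix_word n ps)"
        unfolding collection_def using w(1) g gw ps by blast
      then have "p \<in> good_prefixes n ps"
        unfolding collection_eq[OF assms(1,2) ps(3)] using ps(1) by auto
      moreover have "ps \<in> suffixes d r n"
        using word_elt_mem_Gdr_canonical[OF n assms(2,3) ps(3,2)] g gw by blast
      ultimately show "g \<in> (\<lambda>(ps, p). word_elt d n (p @ suffix_word n ps)) ` (Sigma (suffixes d r n) (good_prefixes n))"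
        using gw by force
    qed
  qed
qed

section \<open>Counting suffixes\<close>

text \<open>
  When \<open>a\<close> grows by one, the window \<open>a, \<dots>, a + d - 1\<close> loses \<open>a\<close> and gains \<open>a + d\<close>, which are congruent modulo \<open>r\<close>.
\<close>

lemma card_dvd_shift:
  assumes "r > 0" "r dvd d"
  shows "card {t. t < d \<and> r dvd a + t} = d div r"
proof (induction a)
  case 0
  have "{t. t < d \<and> r dvd 0 + t} = (\<lambda>i. r * i) ` {..<d div r}"
    using assms by (auto simp: dvd_def image_iff)
  then show ?case using assms(1) by (simp add: card_image inj_on_def)
next
  case (Suc a)
  let ?f = "\<lambda>a t. if r dvd a + t then 1 else 0 :: nat"
  have c: "card {t. t < d \<and> r dvd a + t} = (\<Sum>t<d. ?f a t)" for a
    by (simp add: sum.If_cases lessThan_def Collect_conj_eq)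
  \<comment> \<open>Both sides count the multiples of \<open>r\<close> among \<open>a, \<dots>, a + d\<close>.\<close>
  have "?f a 0 + (\<Sum>t<d. ?f (Suc a) t) = (\<Sum>t<Suc d. ?f a t)"
    by (subst sum.lessThan_Suc_shift) simp
  also have "\<dots> = (\<Sum>t<d. ?f a t) + ?f a d" by simp
  also have "?f a d = ?f a 0" using assms(2) by (simp add: dvd_add_left_iff)
  finally have "(\<Sum>t<d. ?f (Suc a) t) = (\<Sum>t<d. ?f a t)" by simp
  then show ?case using Suc.IH unfolding c by simp
qed

text \<open>
  Suffixes supported on the positions \<open>m, \<dots>, n\<close>, with an offset \<open>a\<close> that collects the exponents already
  chosen at smaller positions.
\<close>

definition tails :: "nat \<Rightarrow> nat \<Rightarrow> nat \<Rightarrow> nat \<Rightarrow> nat \<Rightarrow> (nat \<times> nat) list set" where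
  "tails d r n m a = {ps. suffix_data d n ps \<and> (\<forall>q \<in> set ps. m \<le> snd q) \<and> r dvd a + sum_list (map fst ps)}"

text \<open>
  An absent block at position \<open>m\<close> acts as exponent \<open>t = 0\<close>, so all \<open>d\<close> residues are treated alike.
\<close>

lemma tails_Suc:
  assumes "1 \<le> m" "m \<le> n" "d > 0"
  shows "tails d r n m a = (\<Union>t<d. (if t = 0 then id else Cons (t, m)) ` tails d r n (Suc m) (a + t))"
    (is "_ = ?U")
proof (intro equalityI subsetI)
  fix ps assume ps: "ps \<in> tails d r n m a"
  show "ps \<in> ?U"
  proof (cases "\<forall>q \<in> set ps. Suc m \<le> snd q")
    case True
    then have "ps \<in> id ` tails d r n (Suc m) (a + 0)" using ps by (simp add: tails_def)
    then show ?thesis using assms(3) by (intro UN_I[of 0]) auto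
  next
    case False
    obtain t j qs where c: "ps = (t, j) # qs" using False by (cases ps) auto
    have d: "suffix_data d n qs" "\<forall>q \<in> set qs. j < snd q" "1 \<le> t" "t < d" "m \<le> j"
      using ps c by (auto simp: tails_def suffix_data_Cons)
    have "j = m" using False c d(2,5) by fastforce
    then have "qs \<in> tails d r n (Suc m) (a + t)"
      using ps c d by (auto simp: tails_def add.assoc)
    then show ?thesis using c \<open>j = m\<close> d by (intro UN_I[of t]) auto
  qed
next
  fix ps assume "ps \<in> ?U"
  then obtain t qs where t: "t < d" "qs \<in> tails d r n (Suc m) (a + t)"
      "ps = (if t = 0 then id else Cons (t, m)) qs"
    by auto
  then show "ps \<in> tails d r n m a"
    using assms by (cases "t = 0") (auto simp: tails_def suffix_data_Cons add.assoc Suc_le_eq)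
qed

lemma tails_top: "tails d r n (Suc n) a = (if r dvd a then {[]} else {})"
proof -
  have iff: "ps \<in> tails d r n (Suc n) a \<longleftrightarrow> ps = [] \<and> r dvd a" for ps
    unfolding tails_def by (cases ps) (auto simp: suffix_data_Cons)
  show ?thesis by (cases "r dvd a") (auto simp: iff)
qed

lemma card_tails_Suc:
  assumes "1 \<le> m" "m \<le> n" "d > 0" "\<And>a. finite (tails d r n (Suc m) a)"
  shows "finite (tails d r n m a) \<and> card (tails d r n m a) = (\<Sum>t<d. card (tails d r n (Suc m) (a + t)))"
proof -
  let ?h = "\<lambda>t. if t = 0 then id else Cons (t, m)"
  let ?U = "\<lambda>t. ?h t ` tails d r n (Suc m) (a + t)"
  have "card (\<Union>t<d. ?U t) = (\<Sum>t<d. card (?U t))"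
  proof (rule card_UN_disjoint)
    have no: "(t, m) # qs \<notin> tails d r n (Suc m) b" for t qs b by (auto simp: tails_def)
    show "\<forall>i\<in>{..<d}. \<forall>j\<in>{..<d}. i \<noteq> j \<longrightarrow> ?U i \<inter> ?U j = {}"
    proof (intro ballI impI)
      fix i j :: nat assume "i \<noteq> j"
      then show "?U i \<inter> ?U j = {}" using no by auto
    qed
  qed (use assms(4) in auto)
  also have "\<dots> = (\<Sum>t<d. card (tails d r n (Suc m) (a + t)))"
    by (intro sum.cong card_image) (auto intro!: inj_onI split: if_splits)
  finally show ?thesis unfolding tails_Suc[OF assms(1-3)] using assms(4) by auto
qed

text \<open>
  The exponents at \<open>m, \<dots>, n - 1\<close> are free; the one at \<open>n\<close> is then determined modulo \<open>r\<close>, which leaves \<open>d / r\<close>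
  choices.
\<close>

lemma card_tails:
  assumes "d > 0" "r > 0" "r dvd d" "1 \<le> m" "m \<le> n"
  shows "finite (tails d r n m a) \<and> card (tails d r n m a) = d ^ (n - m) * (d div r)"
  using assms(5,4)
proof (induction m arbitrary: a rule: inc_induct)
  case base
  have "(\<Sum>t<d. card (tails d r n (Suc n) (a + t))) = (\<Sum>t<d. if r dvd a + t then 1 else 0)"
    by (intro sum.cong) (auto simp: tails_top)
  also have "\<dots> = card {t. t < d \<and> r dvd a + t}"
    by (simp add: sum.If_cases lessThan_def Collect_conj_eq)
  also have "\<dots> = d div r" using card_dvd_shift[OF assms(2,3)] .
  finally show ?case
    using card_tails_Suc[OF base order_refl assms(1), of r a] by (simp add: tails_top)
next
  case (step m)
  have "n - m = Suc (n - Suc m)" using step by simp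
  then show ?case using card_tails_Suc[OF step(4) _ assms(1), of n r a] step by simp
qed

lemma card_single_suffixes:
  assumes "d > 0" "r > 0" "r dvd d" "1 \<le> j" "j \<le> n"
  shows "finite {ps \<in> suffixes d r n. \<exists>t. ps = [(t, j)]} \<and>
    card {ps \<in> suffixes d r n. \<exists>t. ps = [(t, j)]} = d div r - 1"
proof -
  have "{ps \<in> suffixes d r n. \<exists>t. ps = [(t, j)]} = (\<lambda>t. [(t, j)]) ` ({t. t < d \<and> r dvd 0 + t} - {0})"
    using assms(4,5) by (auto simp: suffixes_def suffix_data_Cons)
  moreover have "card ({t. t < d \<and> r dvd 0 + t} - {0}) = d div r - 1"
    using assms(1) card_dvd_shift[OF assms(2,3), of 0] by (subst card_Diff_singleton) auto
  ultimately show ?thesis by (simp add: card_image inj_on_def)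
qed

text \<open>
  The suffixes whose first block ends at \<open>j\<close> are those supported on \<open>j, \<dots>, n\<close> but not on \<open>j + 1, \<dots>, n\<close>; discarding
  those with a single block leaves the long ones.
\<close>

lemma card_long_suffixes:
  assumes "d > 0" "r > 0" "r dvd d" "1 \<le> j" "j < n"
  shows "finite {ps \<in> suffixes d r n. \<exists>t q qs. ps = (t, j) # q # qs} \<and>
    card {ps \<in> suffixes d r n. \<exists>t q qs. ps = (t, j) # q # qs} + (d div r - 1)
      = (d - 1) * d ^ (n - j - 1) * (d div r)"
proof -
  let ?L = "{ps \<in> suffixes d r n. \<exists>t q qs. ps = (t, j) # q # qs}"
  let ?S = "{ps \<in> suffixes d r n. \<exists>t. ps = [(t, j)]}"
  let ?A = "tails d r n j 0" and ?B = "tails d r n (Suc j) 0"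
  have A: "finite ?A" "card ?A = d ^ (n - j) * (d div r)"
    using card_tails[OF assms(1-4), of n 0] assms(5) by auto
  have B: "finite ?B" "card ?B = d ^ (n - Suc j) * (d div r)"
    using card_tails[OF assms(1-3), of "Suc j" n 0] assms(5) by auto
  have sub: "?B \<subseteq> ?A" by (auto simp: tails_def)
  have eq: "?A - ?B = ?L \<union> ?S"
  proof (intro equalityI subsetI)
    fix ps assume ps: "ps \<in> ?A - ?B"
    then have "\<not> (\<forall>q \<in> set ps. Suc j \<le> snd q)" by (auto simp: tails_def)
    then obtain t i qs where c: "ps = (t, i) # qs" by (cases ps) auto
    then have "\<forall>q \<in> set qs. i < snd q" "j \<le> i" using ps by (auto simp: tails_def suffix_data_Cons)
    then have "i = j" using ps c by (fastforce simp: tails_def)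
    then show "ps \<in> ?L \<union> ?S" using ps c by (cases qs) (auto simp: tails_def suffixes_def)
  next
    fix ps assume "ps \<in> ?L \<union> ?S"
    then obtain t qs where "ps \<in> suffixes d r n" "ps = (t, j) # qs" by blast
    then show "ps \<in> ?A - ?B" by (auto simp: tails_def suffixes_def suffix_data_Cons less_imp_le)
  qed
  have fin: "finite (?L \<union> ?S)" unfolding eq[symmetric] using A(1) by blast
  have "card (?L \<union> ?S) = card ?L + card ?S" using fin by (intro card_Un_disjoint) auto
  moreover have "card (?L \<union> ?S) = card ?A - card ?B"
    unfolding eq[symmetric] using B(1) sub by (rule card_Diff_subset)
  moreover have "n - j = Suc (n - Suc j)" using assms(5) by simp
  moreover have "card ?S = d div r - 1" using card_single_suffixes[OF assms(1-4)] assms(5) by auto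
  ultimately show ?thesis using fin unfolding A(2) B(2) by (simp add: diff_mult_distrib)
qed

lemma finite_suffixes:
  assumes "d > 0" "r > 0" "r dvd d" "1 \<le> n"
  shows "finite (suffixes d r n)"
proof -
  have "suffixes d r n = tails d r n 1 0"
    using suffix_data_pos by (fastforce simp: suffixes_def tails_def)
  then show ?thesis using card_tails[OF assms(1-3) order_refl assms(4), of 0] by simp
qed

text \<open>
  For \<open>1 \<le> k \<le> n - 2\<close> the single blocks ending at \<open>k\<close> make up for the \<open>d / r - 1\<close> suffixes missing from the long ones; for
  \<open>k = 0\<close> there is no such block, which explains the correction term.
\<close>

lemma card_packet_values:
  assumes "d > 0" "r > 0" "r dvd d" "n \<ge> 3"
  defines "q \<equiv> d div r"
  shows "real (card (packet d r n n)) = 1"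
    and "real (card (packet d r n (n - 1))) = 2 * (real q - 1)"
    and "k + 2 \<le> n \<Longrightarrow> real (card (packet d r n k))
        = (real d - 1) * real d ^ (n - 2 - k) * real q - (if k = 0 then real q - 1 else 0)"
proof -
  note packet = card_packet[OF assms(4,1,3)]
  have n2: "n \<ge> 2" using assms(4) by simp
  have q: "q \<ge> 1" 
    using assms(1-3) dvd_imp_le[of r d] div_greater_zero_iff[of d r] by (simp add: q_def Suc_le_eq)
  let ?E = "\<lambda>k. {ps \<in> suffixes d r n. packet_index n ps = k}"
  let ?S = "\<lambda>j. {ps \<in> suffixes d r n. \<exists>t. ps = [(t, j)]}"
  let ?L = "\<lambda>j. {ps \<in> suffixes d r n. \<exists>t q qs. ps = (t, j) # q # qs}"
  have E: "?E k = {ps \<in> suffixes d r n. (if k = 0 then \<exists>t q qs. ps = (t, 1) # q # qs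
      else if k + 2 \<le> n then (\<exists>t. ps = [(t, k)]) \<or> (\<exists>t q qs. ps = (t, k + 1) # q # qs)
      else if k + 1 = n then (\<exists>t. ps = [(t, n - 1)]) \<or> (\<exists>t. ps = [(t, n)])
      else k = n \<and> ps = [])}" for k
    by (intro Collect_cong conj_cong HOL.refl packet_index_iff[OF n2, of d]) (simp add: suffixes_def)
  have S: "finite (?S j)" "card (?S j) = q - 1" if "1 \<le> j" "j \<le> n" for j
    using card_single_suffixes[OF assms(1-3) that] unfolding q_def by auto
  have L: "finite (?L j)" "card (?L j) + (q - 1) = (d - 1) * d ^ (n - j - 1) * q" if "1 \<le> j" "j < n" for j
    using card_long_suffixes[OF assms(1-3) that] unfolding q_def by auto
  have "?E n = {[]}" using assms(4) by (subst E) (auto simp: suffixes_def)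
  then show "real (card (packet d r n n)) = 1" unfolding packet by simp
  have "?E (n - 1) = ?S (n - 1) \<union> ?S n" using assms(4) by (subst E) auto
  moreover have "card (?S (n - 1) \<union> ?S n) = card (?S (n - 1)) + card (?S n)"
    using S(1)[of n] S(1)[of "n - 1"] assms(4) by (intro card_Un_disjoint) auto
  ultimately show "real (card (packet d r n (n - 1))) = 2 * (real q - 1)"
    unfolding packet using S(2)[of n] S(2)[of "n - 1"] assms(4) q by (simp add: of_nat_diff)
  assume k: "k + 2 \<le> n"
  have Lk: "card (?L (k + 1)) + (q - 1) = (d - 1) * d ^ (n - 2 - k) * q"
    using L(2)[of "k + 1"] k by simp
  have Lr: "real (card (?L (k + 1))) + (real q - 1) = (real d - 1) * real d ^ (n - 2 - k) * real q"
    using arg_cong[OF Lk, of real] q assms(1) by (simp add: of_nat_diff)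
  show "real (card (packet d r n k))
        = (real d - 1) * real d ^ (n - 2 - k) * real q - (if k = 0 then real q - 1 else 0)"
  proof (cases "k = 0")
    case True
    then have "?E k = ?L (k + 1)" by (subst E) simp
    then show ?thesis unfolding packet using Lr True by simp
  next
    case False
    then have "?E k = ?S k \<union> ?L (k + 1)" using k by (subst E) auto
    moreover have "card (?S k \<union> ?L (k + 1)) = card (?S k) + card (?L (k + 1))"
      using S(1)[of k] L(1)[of "k + 1"] k False by (intro card_Un_disjoint) auto
    ultimately show ?thesis unfolding packet using Lr S(2)[of k] False k q by (simp add: of_nat_diff)
  qed
qed

section \<open>The number of fully commutative elements\<close>

theorem corollary5p6:
  fixes d r n :: nat
  assumes "d > 0" and "r > 0" and "r dvd d" and "n \<ge> 3"
  shows "real (card {g \<in> Gdr d r n. fully_commutative d n g})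
           = (\<Sum>k=0..n. catalan_triangle n k * real (card (packet d r n k)))
       \<and> (\<Sum>k=0..n. catalan_triangle n k * real (card (packet d r n k)))
           = real d * (real d - 1) / real r * catalan_poly n (n - 2) (real d)
             + (2 * real d / real r - 1) * catalan n - (real d / real r - 1)"
proof
  let ?S = "suffixes d r n"
  let ?T = "catalan_triangle n"
  have fin: "finite ?S" using finite_suffixes[OF assms(1-3)] assms(4) by simp
  have good: "finite (good_prefixes n ps)"
      "real (card (good_prefixes n ps)) = ?T (packet_index n ps)" if "ps \<in> ?S" for ps
    using card_good_prefixes[of n d ps] that assms(4) by (auto simp: suffixes_def)
  have "card {g \<in> Gdr d r n. fully_commutative d n g} = card (Sigma ?S (good_prefixes n))"
    using bij_betw_same_card[OF fully_commutative_Gdr[OF assms(4,1,3)]] by simp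
  also have "\<dots> = (\<Sum>ps\<in>?S. card (good_prefixes n ps))"
    using fin good(1) by (intro card_SigmaI) auto
  finally have "real (card {g \<in> Gdr d r n. fully_commutative d n g})
      = (\<Sum>ps\<in>?S. ?T (packet_index n ps))"
    using good(2) by simp
  also have "\<dots> = (\<Sum>k=0..n. \<Sum>ps\<in>{ps \<in> ?S. packet_index n ps = k}. ?T (packet_index n ps))"
    using fin packet_index_le by (intro sum.group[symmetric]) (auto simp: suffixes_def)
  also have "\<dots> = (\<Sum>k=0..n. ?T k * real (card (packet d r n k)))"
  proof (rule sum.cong[OF HOL.refl])
    fix k
    have "(\<Sum>ps\<in>{ps \<in> ?S. packet_index n ps = k}. ?T (packet_index n ps))
        = (\<Sum>ps\<in>{ps \<in> ?S. packet_index n ps = k}. ?T k)"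
      by (intro sum.cong) auto
    then show "(\<Sum>ps\<in>{ps \<in> ?S. packet_index n ps = k}. ?T (packet_index n ps))
        = ?T k * real (card (packet d r n k))"
      by (simp add: card_packet[OF assms(4,1,3)])
  qed
  finally show "real (card {g \<in> Gdr d r n. fully_commutative d n g})
      = (\<Sum>k=0..n. ?T k * real (card (packet d r n k)))" .
next
  let ?T = "catalan_triangle n"
  let ?P = "\<lambda>k. real (card (packet d r n k))"
  define q where "q = real (d div r)"
  have q: "real d / real r = q" using assms(2,3) by (simp add: q_def real_of_nat_div)
  obtain m where m: "n = Suc (Suc m)" using assms(4) by (metis add_2_eq_Suc le_Suc_ex numeral_3_eq_3 add_Suc)
  note val = card_packet_values[OF assms, folded q_def]
  have cat: "?T n = catalan n" "?T (n - 1) = catalan n"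
    using catalan_eq_triangle[of n] catalan_triangle_diagonal[of "Suc m"] m by auto
  have "(\<Sum>k=0..m. ?T k * ?P k)
      = (\<Sum>k=0..m. (real d - 1) * q * (?T k * real d ^ (m - k)) - (if k = 0 then q - 1 else 0))"
  proof (intro sum.cong HOL.refl)
    fix k assume "k \<in> {0..m}"
    then have P: "?P k = (real d - 1) * real d ^ (m - k) * q - (if k = 0 then q - 1 else 0)"
      using val(3)[of k] m by simp
    show "?T k * ?P k = (real d - 1) * q * (?T k * real d ^ (m - k)) - (if k = 0 then q - 1 else 0)"
      unfolding P by (cases "k = 0") (simp_all add: catalan_triangle_0 algebra_simps)
  qed
  also have "\<dots> = (real d - 1) * q * catalan_poly n (n - 2) (real d) - (q - 1)"
    by (simp add: sum_subtractf sum_distrib_left catalan_poly_def m)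
  finally have low: "(\<Sum>k=0..m. ?T k * ?P k)
      = (real d - 1) * q * catalan_poly n (n - 2) (real d) - (q - 1)" .
  have "(\<Sum>k=0..n. ?T k * ?P k) = (\<Sum>k=0..m. ?T k * ?P k) + ?T (n - 1) * ?P (n - 1) + ?T n * ?P n"
    using m by simp
  also have "\<dots> = (real d - 1) * q * catalan_poly n (n - 2) (real d) - (q - 1)
      + catalan n * (2 * (q - 1)) + catalan n"
    unfolding low cat val(1,2) by simp
  also have "\<dots> = (real d / real r) * (real d - 1) * catalan_poly n (n - 2) (real d)
      + (2 * (real d / real r) - 1) * catalan n - (real d / real r - 1)"
    unfolding q by (simp add: algebra_simps)
  finally show "(\<Sum>k=0..n. ?T k * ?P k)
      = real d * (real d - 1) / real r * catalan_poly n (n - 2) (real d)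
        + (2 * real d / real r - 1) * catalan n - (real d / real r - 1)"
    by simp
qed

end
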